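(* Let $f:(\mathbb B^n,kg_{\mathbb B^n})\to(\Omega,g_\Omega)$ be a holomorphic isometric embedding with $f(\mathbf 0)=\mathbf 0$, where $\Omega\Subset\mathbb C^N$ is an irreducible bounded symmetric domain in its Harish-Chandra realization and $k>0$ is a real constant. Define $$D_f:=\{z\in\Omega\mid\lVert z\rVert_f<k\},$$ where $\langle z,\overline\xi\rangle_f:=\overline\xi^T Jf(\mathbf 0)\overline{Jf(\mathbf 0)}^Tz$ is a complex Hermitian form on $\mathbb C^N$ (with $z,\xi\in\mathbb C^N$ identified with column vectors) and $\lVert z\rVert_f^2:=\langle z,\overline z\rangle_f=\lVert\overline{Jf(\mathbf 0)}^Tz\rVert_{\mathbb C^n}^2$. Then $D_f\Subset\mathbb C^N$ is a bounded balanced convex domain and $f(\mathbb B^n)\subset D_f$. In particular, there is a holomorphic map $\hat f:\mathbb B^n\to D_f$ such that $f=\iota\circ\hat f$, where $\iota:D_f\hookrightarrow\Omega$ is the inclusion map. Moreover, there is a surjective holomorphic submersion $\widetilde\pi_f:D_f\to\mathbb B^n$ such that $\widetilde\pi_f\circ\hat f=\mathrm{Id}_{\mathbb B^n}$, i.e. $\hat f:\mathbb B^n\to D_f$ is a global holomorphic section of the surjective holomorphic submersion $\widetilde\pi_f:D_f\to\mathbb B^n$.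
   Context: $\mathbb B^n$ is the complex unit ball in $\mathbb C^n$ and $\lVert\cdot\rVert_{\mathbb C^n}$ is the Euclidean norm. $Jf(\mathbf 0)=\big(\frac{\partial f_i}{\partial\zeta_j}(\mathbf 0)\big)$ is the $N\times n$ complex Jacobian matrix of $f=(f_1,\dots,f_N)$ at $\mathbf 0$. A subset $U\subset\mathbb C^N$ is balanced if $\lambda z\in U$ whenever $z\in U$, $\lambda\in\mathbb C$, $|\lambda|\le1$. For an irreducible bounded symmetric domain $\Omega\Subset\mathbb C^N$ in its Harish-Chandra realization, $g_\Omega$ denotes the canonical Kähler–Einstein metric normalized so that minimal disks of $\Omega$ have constant Gaussian curvature $-2$. Its Kähler form is $\omega_{g_\Omega}=-\sqrt{-1}\,\partial\overline\partial\log h_\Omega(z,z)$, where $h_\Omega(z,\xi)$ is a polynomial in $(z,\overline\xi)$ (the Bergman kernel of $\Omega$ is a positive constant times a negative integer power of $h_\Omega$). The Harish-Chandra coordinates are chosen such that $h_\Omega(z,\xi)=1-\sum_{j=1}^Nz_j\overline{\xi_j}+\sum_l(-1)^{\deg G_l}G_l(z)\overline{G_l(\xi)}$ for finitely many homogeneous polynomials $G_l$ of degree $\ge2$ (none if $\Omega=\mathbb B^N$); in particular $h_{\mathbb B^n}(z,\xi)=1-\sum_jz_j\overline{\xi_j}$. A holomorphic isometric embedding $f:(\mathbb B^n,kg_{\mathbb B^n})\to(\Omega,g_\Omega)$ is a holomorphic embedding with $f^*g_\Omega=kg_{\mathbb B^n}$. *)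

theory Defs
  imports "HOL-Analysis.Analysis"
begin

section \<open>Holomorphic functions and maps of several complex variables\<close>

definition holomorphic_fun_on :: "(complex^'a \<Rightarrow> complex) \<Rightarrow> (complex^'a) set \<Rightarrow> bool" where
  "holomorphic_fun_on F S \<longleftrightarrow> open S \<and>
     (\<forall>z\<in>S. \<exists>D. (F has_derivative D) (at z) \<and> (\<forall>c v. D (c *s v) = c * D v))"

definition holomorphic_map_on :: "(complex^'a \<Rightarrow> complex^'b) \<Rightarrow> (complex^'a) set \<Rightarrow> bool" where
  "holomorphic_map_on f S \<longleftrightarrow> (\<forall>i. holomorphic_fun_on (\<lambda>z. f z $ i) S)"

definition cjacobian :: "(complex^'a \<Rightarrow> complex^'b) \<Rightarrow> complex^'a \<Rightarrow> complex^'a^'b" where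
  "cjacobian f z = (\<chi> i j. deriv (\<lambda>t. f (z + t *s axis j 1) $ i) 0)"

definition biholomorphic_domains :: "(complex^'a) set \<Rightarrow> (complex^'b) set \<Rightarrow> bool" where
  "biholomorphic_domains S T \<longleftrightarrow> (\<exists>\<phi> \<psi>.
     holomorphic_map_on \<phi> S \<and> holomorphic_map_on \<psi> T \<and> \<phi> ` S = T \<and> \<psi> ` T = S \<and>
     (\<forall>z\<in>S. \<psi> (\<phi> z) = z) \<and> (\<forall>w\<in>T. \<phi> (\<psi> w) = w))"

definition holomorphic_embedding ::
  "(complex^'a \<Rightarrow> complex^'b) \<Rightarrow> (complex^'a) set \<Rightarrow> (complex^'b) set \<Rightarrow> bool" where
  "holomorphic_embedding f S T \<longleftrightarrow>
     holomorphic_map_on f S \<and> f ` S \<subseteq> T \<and>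
     (\<forall>z\<in>S. inj (\<lambda>v. cjacobian f z *v v)) \<and>
     (\<exists>g. homeomorphism S (f ` S) f g)"

definition holomorphic_submersion_on ::
  "(complex^'a \<Rightarrow> complex^'b) \<Rightarrow> (complex^'a) set \<Rightarrow> bool" where
  "holomorphic_submersion_on p S \<longleftrightarrow>
     holomorphic_map_on p S \<and> (\<forall>z\<in>S. surj (\<lambda>v. cjacobian p z *v v))"

definition balanced :: "(complex^'a) set \<Rightarrow> bool" where
  "balanced U \<longleftrightarrow> (\<forall>z\<in>U. \<forall>c::complex. norm c \<le> 1 \<longrightarrow> c *s z \<in> U)"

definition complex_domain :: "(complex^'a) set \<Rightarrow> bool" where
  "complex_domain U \<longleftrightarrow> open U \<and> connected U \<and> U \<noteq> {}"

section \<open>Irreducible bounded symmetric domains\<close>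

definition bounded_symmetric_domain :: "(complex^'a) set \<Rightarrow> bool" where
  "bounded_symmetric_domain U \<longleftrightarrow> complex_domain U \<and> bounded U \<and>
     (\<forall>p\<in>U. \<exists>s. holomorphic_map_on s U \<and> s ` U \<subseteq> U \<and> (\<forall>z\<in>U. s (s z) = z) \<and> s p = p \<and>
        (\<exists>V. open V \<and> p \<in> V \<and> (\<forall>z\<in>V \<inter> U. s z = z \<longrightarrow> z = p)))"

text \<open>
  \<open>U\<close> is a product of a subset of the coordinate space indexed by \<open>I\<close> with a subset of the
  coordinate space indexed by the complement of \<open>I\<close>.
\<close>
definition splits_along :: "'a set \<Rightarrow> (complex^'a) set \<Rightarrow> bool" where
  "splits_along I U \<longleftrightarrow> (\<forall>z\<in>U. \<forall>w\<in>U. (\<chi> i. if i \<in> I then z $ i else w $ i) \<in> U)"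

definition irreducible_bsd :: "(complex^'a) set \<Rightarrow> bool" where
  "irreducible_bsd U \<longleftrightarrow> bounded_symmetric_domain U \<and>
     \<not> (\<exists>(W::(complex^'a) set) I. I \<noteq> {} \<and> I \<noteq> UNIV \<and> splits_along I W \<and>
          bounded_symmetric_domain W \<and> biholomorphic_domains U W)"

definition circular :: "(complex^'a) set \<Rightarrow> bool" where
  "circular U \<longleftrightarrow> 0 \<in> U \<and> (\<forall>z\<in>U. \<forall>c::complex. norm c = 1 \<longrightarrow> c *s z \<in> U)"

section \<open>The Bergman kernel\<close>

definition bergman_space :: "(complex^'a) set \<Rightarrow> (complex^'a \<Rightarrow> complex) set" where
  "bergman_space U = {F. holomorphic_fun_on F U \<and>
     set_integrable lborel U (\<lambda>z. (norm (F z))\<^sup>2)}"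

definition is_bergman_kernel ::
  "(complex^'a) set \<Rightarrow> (complex^'a \<Rightarrow> complex^'a \<Rightarrow> complex) \<Rightarrow> bool" where
  "is_bergman_kernel U K \<longleftrightarrow> (\<forall>w\<in>U. (\<lambda>z. K z w) \<in> bergman_space U \<and>
     (\<forall>F\<in>bergman_space U. F w = set_lebesgue_integral lborel U (\<lambda>z. F z * cnj (K z w))))"

section \<open>Hermitian metrics, with entry \<open>(i, j)\<close> standing for \<open>g\<^sub>i\<^sub>j\<close>, \<open>j\<close> the conjugate index\<close>

text \<open>The Wirtinger derivatives with respect to the coordinate \<open>z\<^sub>i\<close> and its conjugate.\<close>

definition dz :: "'a \<Rightarrow> (complex^'a \<Rightarrow> complex) \<Rightarrow> complex^'a \<Rightarrow> complex" where
  "dz i u z =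
     (vector_derivative (\<lambda>t::real. u (z + complex_of_real t *s axis i 1)) (at 0)
      - \<i> * vector_derivative (\<lambda>t::real. u (z + (\<i> * complex_of_real t) *s axis i 1)) (at 0)) / 2"

definition dzbar :: "'a \<Rightarrow> (complex^'a \<Rightarrow> complex) \<Rightarrow> complex^'a \<Rightarrow> complex" where
  "dzbar i u z =
     (vector_derivative (\<lambda>t::real. u (z + complex_of_real t *s axis i 1)) (at 0)
      + \<i> * vector_derivative (\<lambda>t::real. u (z + (\<i> * complex_of_real t) *s axis i 1)) (at 0)) / 2"

definition metric_pairing :: "complex^'a^'a \<Rightarrow> complex^'a \<Rightarrow> complex^'a \<Rightarrow> complex" where
  "metric_pairing A u v = (\<Sum>i\<in>UNIV. \<Sum>j\<in>UNIV. A $ i $ j * u $ i * cnj (v $ j))"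

definition hermitian_metric_on :: "(complex^'a) set \<Rightarrow> (complex^'a \<Rightarrow> complex^'a^'a) \<Rightarrow> bool" where
  "hermitian_metric_on U g \<longleftrightarrow> (\<forall>z\<in>U.
     (\<forall>i j. g z $ j $ i = cnj (g z $ i $ j)) \<and>
     (\<forall>v. v \<noteq> 0 \<longrightarrow> 0 < Re (metric_pairing (g z) v v)))"

definition ricci :: "(complex^'a \<Rightarrow> complex^'a^'a) \<Rightarrow> complex^'a \<Rightarrow> complex^'a^'a" where
  "ricci g z = (\<chi> i j. - dz i (dzbar j (\<lambda>x. complex_of_real (ln (Re (det (g x)))))) z)"

definition einstein_on :: "(complex^'a) set \<Rightarrow> (complex^'a \<Rightarrow> complex^'a^'a) \<Rightarrow> bool" where
  "einstein_on U g \<longleftrightarrow> (\<exists>c::real. \<forall>z\<in>U. \<forall>i j. ricci g z $ i $ j = complex_of_real c * g z $ i $ j)"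

definition curvature ::
  "(complex^'a \<Rightarrow> complex^'a^'a) \<Rightarrow> complex^'a \<Rightarrow> 'a \<Rightarrow> 'a \<Rightarrow> 'a \<Rightarrow> 'a \<Rightarrow> complex" where
  "curvature g z i j k l =
     - dz k (dzbar l (\<lambda>x. g x $ i $ j)) z
     + (\<Sum>p\<in>UNIV. \<Sum>q\<in>UNIV. matrix_inv (g z) $ q $ p *
          dz k (\<lambda>x. g x $ i $ q) z * dzbar l (\<lambda>x. g x $ p $ j) z)"

text \<open>
  The underlying Riemannian metric is \<open>2 Re g\<close>. In dimension one the holomorphic sectional
  curvature below is therefore its Gaussian curvature, which is \<open>-2\<close> for the unit disk with
  Kaehler potential \<open>- log (1 - |z|\<^sup>2)\<close>.
\<close>
definition holo_sectional_curvature ::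
  "(complex^'a \<Rightarrow> complex^'a^'a) \<Rightarrow> complex^'a \<Rightarrow> complex^'a \<Rightarrow> real" where
  "holo_sectional_curvature g z v =
     Re (\<Sum>i\<in>UNIV. \<Sum>j\<in>UNIV. \<Sum>k\<in>UNIV. \<Sum>l\<in>UNIV.
           curvature g z i j k l * v $ i * cnj (v $ j) * v $ k * cnj (v $ l))
     / (Re (metric_pairing (g z) v v))\<^sup>2"

text \<open>
  Minimal disks are the totally geodesic holomorphic disks tangent to the directions in which the
  holomorphic sectional curvature is minimal; by total geodesy their Gaussian curvature is this
  minimum.
\<close>
definition minimal_disk_curvature ::
  "(complex^'a) set \<Rightarrow> (complex^'a \<Rightarrow> complex^'a^'a) \<Rightarrow> real \<Rightarrow> bool" where
  "minimal_disk_curvature U g c \<longleftrightarrow>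
     (\<forall>z\<in>U. \<forall>v. v \<noteq> 0 \<longrightarrow> c \<le> holo_sectional_curvature g z v) \<and>
     (\<exists>z\<in>U. \<exists>v. v \<noteq> 0 \<and> holo_sectional_curvature g z v = c)"

text \<open>The metric with Kaehler potential \<open>- log h(z, z)\<close>.\<close>
definition metric_of ::
  "(complex^'a \<Rightarrow> complex^'a \<Rightarrow> complex) \<Rightarrow> complex^'a \<Rightarrow> complex^'a^'a" where
  "metric_of h z = (\<chi> i j. - dz i (dzbar j (\<lambda>x. complex_of_real (ln (Re (h x x))))) z)"

definition isometric_on ::
  "(complex^'a \<Rightarrow> complex^'b) \<Rightarrow> (complex^'a) set \<Rightarrow> real \<Rightarrow>
   (complex^'a \<Rightarrow> complex^'a^'a) \<Rightarrow> (complex^'b \<Rightarrow> complex^'b^'b) \<Rightarrow> bool" where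
  "isometric_on f S k g g' \<longleftrightarrow> (\<forall>w\<in>S. \<forall>u v.
     metric_pairing (g' (f w)) (cjacobian f w *v u) (cjacobian f w *v v)
       = complex_of_real k * metric_pairing (g w) u v)"

section \<open>Harish-Chandra realizations\<close>

definition homogeneous_poly :: "nat \<Rightarrow> (complex^'a \<Rightarrow> complex) \<Rightarrow> bool" where
  "homogeneous_poly d P \<longleftrightarrow> (\<exists>c. \<forall>z. P z =
     (\<Sum>\<alpha>\<in>{\<alpha>::'a \<Rightarrow> nat. sum \<alpha> UNIV = d}. c \<alpha> * (\<Prod>i\<in>UNIV. z $ i ^ \<alpha> i)))"

definition h_ball :: "complex^'a \<Rightarrow> complex^'a \<Rightarrow> complex" where
  "h_ball z \<xi> = 1 - (\<Sum>j\<in>UNIV. z $ j * cnj (\<xi> $ j))"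

text \<open>
  \<open>U\<close> is an irreducible bounded symmetric domain in its Harish-Chandra realization and \<open>h\<close> is the
  polynomial \<open>h\<^sub>U\<close>. The Harish-Chandra realization of a bounded symmetric domain is circular, and
  by Cartan's theorem on biholomorphisms of bounded circular domains every circular realization
  agrees with it up to a linear change of coordinates. The shape of \<open>h\<close> together with the curvature
  normalization of the metric determines the coordinates up to a unitary map, so that \<open>U\<close> is the
  Harish-Chandra realization in the usual normalization. The exponent of \<open>h\<close> in the Bergman kernel
  is also fixed by the curvature normalization: for the disk of radius \<open>sqrt 2\<close>, say,
  \<open>(1 - z * cnj \<xi> / 2)\<^sup>2\<close> has the required shape, but its metric has curvature \<open>-1\<close>.
\<close>
definition harish_chandra_realization ::
  "(complex^'a) set \<Rightarrow> (complex^'a \<Rightarrow> complex^'a \<Rightarrow> complex) \<Rightarrow> bool" where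
  "harish_chandra_realization U h \<longleftrightarrow>
     irreducible_bsd U \<and> circular U \<and>
     (\<exists>(M::nat) (d::nat \<Rightarrow> nat) (G::nat \<Rightarrow> complex^'a \<Rightarrow> complex).
        (\<forall>l<M. 2 \<le> d l \<and> homogeneous_poly (d l) (G l)) \<and>
        (\<forall>z \<xi>. h z \<xi> = 1 - (\<Sum>j\<in>UNIV. z $ j * cnj (\<xi> $ j))
                         + (\<Sum>l<M. (-1) ^ d l * G l z * cnj (G l \<xi>)))) \<and>
     (\<exists>(c::real) (m::nat). 0 < c \<and> 1 \<le> m \<and>
        is_bergman_kernel U (\<lambda>z \<xi>. complex_of_real c * h z \<xi> powi (- int m))) \<and>
     hermitian_metric_on U (metric_of h) \<and> einstein_on U (metric_of h) \<and>
     minimal_disk_curvature U (metric_of h) (-2)"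

section \<open>The domain associated with a holomorphic isometric embedding\<close>

definition conj_transpose :: "complex^'n^'m \<Rightarrow> complex^'m^'n" where
  "conj_transpose A = (\<chi> j i. cnj (A $ i $ j))"

text \<open>\<open>f_form f z \<xi>\<close> is the value written with the second argument conjugated: it is
  conjugate linear in \<open>\<xi>\<close>.\<close>
definition f_form ::
  "(complex^'n \<Rightarrow> complex^'m) \<Rightarrow> complex^'m \<Rightarrow> complex^'m \<Rightarrow> complex" where
  "f_form f z \<xi> =
     (\<Sum>i\<in>UNIV. cnj (\<xi> $ i) * (cjacobian f 0 *v (conj_transpose (cjacobian f 0) *v z)) $ i)"

definition f_norm :: "(complex^'n \<Rightarrow> complex^'m) \<Rightarrow> complex^'m \<Rightarrow> real" where
  "f_norm f z = sqrt (Re (f_form f z z))"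

definition hermitian_form :: "(complex^'m \<Rightarrow> complex^'m \<Rightarrow> complex) \<Rightarrow> bool" where
  "hermitian_form B \<longleftrightarrow>
     (\<forall>x y z. B (x + y) z = B x z + B y z) \<and> (\<forall>c x z. B (c *s x) z = c * B x z) \<and>
     (\<forall>x z. B z x = cnj (B x z))"

definition D_dom ::
  "(complex^'m) set \<Rightarrow> (complex^'n \<Rightarrow> complex^'m) \<Rightarrow> real \<Rightarrow> (complex^'m) set" where
  "D_dom U f k = {z \<in> U. f_norm f z < k}"

end

theory Submission
  imports Defs "HOL-Complex_Analysis.Complex_Analysis"
begin

text \<open>
  The point is that \<open>\<Omega>\<close> is convex and balanced. Differentiating the transformation law of the Bergman
  kernel under the symmetry at \<open>t a\<close> shows, as \<open>t\<close> tends to \<open>0\<close>, that a quadratic vector field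
  \<open>a - {z a z}\<close> acts on \<open>h\<close> infinitesimally; here \<open>{z a z}\<close> is read off the terms of \<open>h\<close> of
  bidegree at most \<open>(2, 2)\<close>. This identity forces \<open>{x a y}\<close> to be a positive Hermitian Jordan triple
  product, and it forces \<open>\<Omega>\<close> to be the set where the operator \<open>{z z \<cdot>}\<close> is less than \<open>1\<close>, which is the
  unit ball of the spectral norm.

  For the map, the isometry equation polarizes to an identity between mixed derivatives of
  \<open>log h (f z, f w)\<close> and \<open>k log (1 - \<langle>z, w\<rangle>)\<close>; at \<open>w = 0\<close> it integrates to \<open>J\<^sup>* f(z) = k z\<close>, where
  \<open>J\<close> is the Jacobian of \<open>f\<close> at \<open>0\<close>. Hence \<open>f\<close> maps into \<open>D\<^sub>f\<close> and \<open>z \<mapsto> J\<^sup>* z / k\<close> is the submersion.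
\<close>

section \<open>Hermitian Jordan triple systems\<close>

text \<open>Neither the classification nor Lie theory enters: a symmetry is only known to be a
  holomorphic involution with an isolated fixed point. The kernel transforms under it with an
  unknown Jacobian factor; using the law at the fixed point as well eliminates that factor and
  leaves an equality of \<open>m\<close>-th powers of products of values of \<open>h\<close>. No
  root is extracted: two curves with equal \<open>m\<close>-th powers and a common nonzero value at
  \<open>0\<close> have the same derivative there, and only derivatives are used. The transvections
  are the maps \<open>z \<mapsto> - z\<close> followed by the symmetry at \<open>t a\<close>, which
  accounts for the factor \<open>2 t\<close>. Their expansion must be uniform on
  \<open>\<Omega>\<close>, for it serves twice: its derivative is the invariance of
  \<open>h\<close>, and its quadratic error bound replaces the flow of the field when the unit ball
  of the spectral norm is shown to lie in \<open>\<Omega>\<close>. Convexity is then the triangle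
  inequality of that norm: the spectral decomposition makes \<open><{x y u}, u>\<close> positive
  semidefinite in \<open>x\<close> and \<open>y\<close> for each \<open>u\<close>, so that
  Cauchy-Schwarz applies.\<close>

definition hip :: "complex^'a \<Rightarrow> complex^'a \<Rightarrow> complex" where
  "hip z w = (\<Sum>j\<in>UNIV. z $ j * cnj (w $ j))"

lemma hip_add_left: "hip (x + y) z = hip x z + hip y z"
  by (simp add: hip_def algebra_simps sum.distrib)

lemma hip_add_right: "hip z (x + y) = hip z x + hip z y"
  by (simp add: hip_def algebra_simps sum.distrib)

lemma hip_scale_left: "hip (c *s x) z = c * hip x z"
  by (simp add: hip_def algebra_simps sum_distrib_left)

lemma hip_scale_right: "hip z (c *s x) = cnj c * hip z x"
  by (simp add: hip_def algebra_simps sum_distrib_left)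

lemma scaleR_vec_complex: "r *\<^sub>R (x::complex^'a) = complex_of_real r *s x"
  unfolding vec_eq_iff by (metis vector_scaleR_component vector_smult_component scaleR_conv_of_real)

lemma hip_scaleR_left: "hip (r *\<^sub>R x) z = r * hip x z"
  by (simp add: scaleR_vec_complex hip_scale_left)

lemma hip_scaleR_right: "hip z (r *\<^sub>R x) = r * hip z x"
  by (simp add: scaleR_vec_complex hip_scale_right)

lemma hip_minus_left: "hip (- x) z = - hip x z"
  by (simp add: hip_def sum_negf)

lemma hip_minus_right: "hip z (- x) = - hip z x"
  by (simp add: hip_def sum_negf)

lemma hip_diff_left: "hip (x - y) z = hip x z - hip y z"
  by (simp add: hip_def algebra_simps sum_subtractf)

lemma hip_zero [simp]: "hip 0 z = 0" "hip z 0 = 0"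
  by (simp_all add: hip_def)

lemma cnj_hip: "cnj (hip x y) = hip y x"
  by (simp add: hip_def mult.commute)

lemma inner_eq_Re_hip: "x \<bullet> y = Re (hip x y)"
  by (simp add: inner_vec_def hip_def inner_complex_def)

lemma hip_self: "hip x x = complex_of_real ((norm x)\<^sup>2)"
proof -
  have "Im (hip x x) = 0" by (simp add: hip_def mult.commute)
  then show ?thesis
    by (metis complex_eq_iff complex_of_real_def inner_eq_Re_hip power2_norm_eq_inner Re_complex_of_real Im_complex_of_real)
qed

lemma hip_eqI: assumes "\<And>z. hip x z = hip y z" shows "x = y"
proof -
  have "hip (x - y) (x - y) = 0" using assms by (simp add: hip_diff_left)
  then show ?thesis by (simp add: hip_self)
qed

lemma hip_axis: "hip z (axis i 1) = z $ i"
  by (simp add: hip_def axis_def if_distrib cong: if_cong)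

lemma norm_smult: "norm (c *s (v::complex^'a)) = norm c * norm v"
  unfolding norm_vec_def L2_set_def
  by (simp add: norm_mult power_mult_distrib real_sqrt_mult flip: sum_distrib_left)

lemma hip_axis_left: "hip (axis i 1) z = cnj (z $ i)"
  using cnj_hip[of z "axis i 1"] by (simp add: hip_axis)

text \<open>\<open>quint\<close> says that \<open>{w b {w a w}}\<close> is symmetric in
  \<open>a\<close> and \<open>b\<close>. This is the form in which the kernel yields the algebra;
  the Jordan identity is derived from it below, with \<open>herm\<close> moving operators across
  \<open>hip\<close>.\<close>

locale jordan_triple =
  fixes tri :: "complex^'N \<Rightarrow> complex^'N \<Rightarrow> complex^'N \<Rightarrow> complex^'N"
  assumes sym: "tri x y z = tri z y x"
    and add_left: "tri (x + x') y z = tri x y z + tri x' y z"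
    and add_mid: "tri x (y + y') z = tri x y z + tri x y' z"
    and scale_left: "tri (c *s x) y z = c *s tri x y z"
    and scale_mid: "tri x (c *s y) z = cnj c *s tri x y z"
    and herm: "hip (tri w a u) z = hip u (tri a w z)"
    and quint: "tri (tri w a w) b w = tri (tri w b w) a w"
begin

lemma add_right: "tri x y (z + z') = tri x y z + tri x y z'"
  by (metis add_left sym)

lemma scale_right: "tri x y (c *s z) = c *s tri x y z"
  by (metis scale_left sym)

lemma scaleR: "tri (r *\<^sub>R x) y z = r *\<^sub>R tri x y z" "tri x (r *\<^sub>R y) z = r *\<^sub>R tri x y z"
   "tri x y (r *\<^sub>R z) = r *\<^sub>R tri x y z"
  by (simp_all add: scaleR_vec_complex scale_left scale_right scale_mid)

lemma minus: "tri (- x) y z = - tri x y z" "tri x (- y) z = - tri x y z" "tri x y (- z) = - tri x y z"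
  using scaleR(1)[of "-1" x y z] scaleR(2)[of x "-1" y z] scaleR(3)[of x y "-1" z] by simp_all

lemma diff: "tri (x - x') y z = tri x y z - tri x' y z" "tri x (y - y') z = tri x y z - tri x y' z"
   "tri x y (z - z') = tri x y z - tri x y z'"
  using add_left[of x "-x'"] add_mid[of x y "-y'"] add_right[of x y z "-z'"] by (simp_all add: minus)

lemma zero [simp]: "tri 0 y z = 0" "tri x 0 z = 0" "tri x y 0 = 0"
  using scaleR(1)[of 0 0 y z] scaleR(2)[of x 0 0 z] scaleR(3)[of x y 0 0] by simp_all

lemmas additive = add_left add_mid add_right minus diff

lemma herm': "hip z (tri w a u) = hip (tri a w z) u"
  by (metis herm cnj_hip)

lemma hip_tri_swap: "hip (tri w a u) z = hip (tri w z u) a"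
  by (metis herm herm' sym)

text \<open>The form \<open><{w b {w a w}}, c>\<close> is symmetric in \<open>a\<close>,
  \<open>b\<close> by \<open>quint\<close>, and in \<open>b\<close>, \<open>c\<close> because across
  \<open>hip\<close> they occur only in \<open>{b w c}\<close>. So it is totally symmetric, and
  exchanging \<open>a\<close> with \<open>c\<close> gives the claim.\<close>

lemma fundamental: "tri w b (tri w a w) = tri w (tri b w a) w"
proof (rule hip_eqI)
  fix c
  define \<phi> where "\<phi> a b c = hip (tri w b (tri w a w)) c" for a b c
  have eq: "\<phi> a b c = hip (tri w (tri b w c) w) a" for a b c
    unfolding \<phi>_def by (metis herm hip_tri_swap)
  have s1: "\<phi> a b c = \<phi> a c b" for a b c
    unfolding eq by (metis sym)
  have s2: "\<phi> a b c = \<phi> b a c" for a b c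
    unfolding \<phi>_def by (metis quint sym)
  have "\<phi> a b c = \<phi> c b a" using s1 s2 by metis
  then show "hip (tri w b (tri w a w)) c = hip (tri w (tri b w a) w) c"
    using eq[of c b a] \<phi>_def[of a b c] by simp
qed

text \<open>The part of \<open>fundamental\<close> linear in \<open>c\<close> after replacing
  \<open>w\<close> by \<open>w + c\<close>. The difference of the instances at \<open>w + c\<close>
  and \<open>w - c\<close> is odd in \<open>c\<close>, and the instance at \<open>c\<close> removes
  its cubic part.\<close>

lemma fundamental_lin:
  "tri c b (tri w a w) + tri w b (tri c a w) + tri w b (tri c a w) =
   tri c (tri b w a) w + tri c (tri b w a) w + tri w (tri b c a) w"
proof (rule hip_eqI)
  fix d
  have n: "tri w x c = tri c x w" for x by (rule sym)
  note h = arg_cong[where f = "\<lambda>v. hip v d"]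
  show "hip (tri c b (tri w a w) + tri w b (tri c a w) + tri w b (tri c a w)) d =
    hip (tri c (tri b w a) w + tri c (tri b w a) w + tri w (tri b c a) w) d"
    using h[OF fundamental[of "w + c" b a]] h[OF fundamental[of "w - c" b a]] h[OF fundamental[of c b a]]
    unfolding additive hip_add_left hip_diff_left n by algebra
qed

text \<open>Tested against \<open>d\<close>, the linearized fundamental formula gives
  \<open>x + 2 q = 2 y + r\<close>. With \<open>w\<close> and \<open>a\<close> exchanged and the
  operators moved to the other side of \<open>hip\<close> it gives \<open>y + 2 q = 2 x + r\<close>.
  Subtracting leaves \<open>3 x = 3 y\<close>.\<close>

lemma tri_square_shift: "tri (tri w a w) a c = tri w (tri a w a) c"
proof (rule hip_eqI)
  fix d
  let ?x = "hip (tri (tri w a w) a c) d" and ?y = "hip (tri w (tri a w a) c) d"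
  let ?q = "hip (tri w a (tri w a c)) d" and ?r = "hip (tri w (tri a c a) w) d"
  have s: "tri c a (tri w a w) = tri (tri w a w) a c" "tri c a w = tri w a c"
    "tri c (tri a w a) w = tri w (tri a w a) c"
    by (metis sym)+
  have 1: "?x + (?q + ?q) = (?y + ?y) + ?r"
    using arg_cong[OF fundamental_lin[of c a w a], of "\<lambda>v. hip v d"]
    unfolding hip_add_left s by algebra
  have 2: "hip c (tri d w (tri a w a)) = ?y"
    by (metis herm' sym)
  have 3: "hip c (tri a w (tri d w a)) = ?q"
    by (metis herm' sym)
  have 4: "hip c (tri d (tri w a w) a) = ?x"
    by (metis herm' sym)
  have 5: "hip c (tri a (tri w d w) a) = ?r"
    by (metis cnj_hip hip_tri_swap)
  have "?y + (?q + ?q) = (?x + ?x) + ?r"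
    using arg_cong[OF fundamental_lin[of d w a w], of "\<lambda>v. hip c v"]
    unfolding hip_add_right 2 3 4 5 by algebra
  with 1 have "3 * ?x = 3 * ?y" by algebra
  then show "?x = ?y" by simp
qed

lemma tri_square_shift_lin: "tri (tri w a w) b c + tri (tri w b w) a c = tri w (tri a w b) c + tri w (tri a w b) c"
proof (rule hip_eqI)
  fix d
  note h = arg_cong[where f = "\<lambda>v. hip v d"]
  show "hip (tri (tri w a w) b c + tri (tri w b w) a c) d = hip (tri w (tri a w b) c + tri w (tri a w b) c) d"
    using h[OF tri_square_shift[of w "a + b" c]] h[OF tri_square_shift[of w a c]] h[OF tri_square_shift[of w b c]]
    unfolding additive hip_add_left sym[of b w a] by algebra
qed

text \<open>The Jordan identity with equal outer arguments: the linearized fundamental formula minus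
  the linearized shift. Polarizing in \<open>w\<close> then gives \<open>jordan\<close>.\<close>

lemma jordan_square: "tri c b (tri w a w) + tri w (tri b c a) w = tri w a (tri c b w) + tri w a (tri c b w)"
proof (rule hip_eqI)
  fix d
  have s: "tri (tri w a w) b c = tri c b (tri w a w)" "tri (tri w b w) a c = tri c a (tri w b w)"
    "tri w (tri b w a) c = tri c (tri b w a) w" "tri a c b = tri b c a" "tri w b c = tri c b w" "tri a w b = tri b w a"
    by (metis sym)+
  note h = arg_cong[where f = "\<lambda>v. hip v d"]
  show "hip (tri c b (tri w a w) + tri w (tri b c a) w) d = hip (tri w a (tri c b w) + tri w a (tri c b w)) d"
    using h[OF tri_square_shift_lin[of w a b c]] h[OF fundamental_lin[of c a w b]]
    unfolding hip_add_left s by algebra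
qed

lemma jordan: "tri c b (tri x a y) = tri (tri c b x) a y - tri x (tri b c a) y + tri x a (tri c b y)"
proof (rule hip_eqI)
  fix d
  have s: "tri y a x = tri x a y" "tri y (tri b c a) x = tri x (tri b c a) y"
    "tri y a (tri c b x) = tri (tri c b x) a y"
    by (metis sym)+
  note h = arg_cong[where f = "\<lambda>v. hip v d"]
  show "hip (tri c b (tri x a y)) d = hip (tri (tri c b x) a y - tri x (tri b c a) y + tri x a (tri c b y)) d"
    using h[OF jordan_square[of c b "x + y" a]] h[OF jordan_square[of c b x a]] h[OF jordan_square[of c b y a]]
    unfolding additive hip_add_left hip_diff_left s by algebra
qed

end

section \<open>Spectral theorem on an invariant real subspace\<close>

lemma self_adjoint_eigenvector:
  fixes D :: "'a::euclidean_space \<Rightarrow> 'a"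
  assumes lin: "linear D" and adj: "\<And>x y. D x \<bullet> y = x \<bullet> D y"
    and S: "subspace S" "\<And>x. x \<in> S \<Longrightarrow> D x \<in> S" "S \<noteq> {0}"
  obtains u \<mu> where "u \<in> S" "u \<noteq> 0" "D u = \<mu> *\<^sub>R u" "\<And>v. v \<in> S \<Longrightarrow> D v \<bullet> v \<le> \<mu> * (v \<bullet> v)"
proof -
  let ?K = "S \<inter> sphere 0 1"
  obtain x where x: "x \<in> S" "x \<noteq> 0" using S(1,3) subspace_0 by blast
  have "x /\<^sub>R norm x \<in> ?K" using x S(1) by (simp add: subspace_scale)
  then have ne: "?K \<noteq> {}" by blast
  have cpt: "compact ?K" using closed_subspace[OF S(1)] by (simp add: closed_Int_compact)
  have cont: "continuous_on ?K (\<lambda>v. D v \<bullet> v)"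
    using lin by (intro continuous_on_inner linear_continuous_on continuous_on_id) (simp add: linear_conv_bounded_linear)
  obtain u where u: "u \<in> ?K" and max: "\<And>v. v \<in> ?K \<Longrightarrow> D v \<bullet> v \<le> D u \<bullet> u"
    using continuous_attains_sup[OF cpt ne cont] by blast
  define \<mu> where "\<mu> = D u \<bullet> u"
  have le: "D v \<bullet> v \<le> \<mu> * (v \<bullet> v)" if "v \<in> S" for v
  proof (cases "v = 0")
    case True then show ?thesis using lin by (simp add: linear_0)
  next
    case False
    have "v /\<^sub>R norm v \<in> ?K" using that S(1) False by (simp add: subspace_scale)
    from max[OF this] have "(D v \<bullet> v) / (norm v)\<^sup>2 \<le> \<mu>"
      using lin by (simp add: linear_cmul \<mu>_def power2_eq_square divide_inverse mult_ac)
    then show ?thesis using False by (simp add: field_simps power2_norm_eq_inner)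
  qed
  \<comment> \<open>At a maximum of the Rayleigh quotient the first variation vanishes in every
    direction of \<open>S\<close>.\<close>
  have orth: "(D u - \<mu> *\<^sub>R u) \<bullet> v = 0" if v: "v \<in> S" for v
  proof -
    define p where "p = (D u - \<mu> *\<^sub>R u) \<bullet> v"
    define q where "q = \<mu> * (v \<bullet> v) - D v \<bullet> v"
    have uu: "u \<bullet> u = 1" using u by (simp add: norm_eq_sqrt_inner)
    have "2 * t * p \<le> t\<^sup>2 * q" for t
    proof -
      have "u + t *\<^sub>R v \<in> S" using u v S(1) by (simp add: subspace_add subspace_scale)
      from le[OF this] have i: "D (u + t *\<^sub>R v) \<bullet> (u + t *\<^sub>R v) \<le> \<mu> * ((u + t *\<^sub>R v) \<bullet> (u + t *\<^sub>R v))" .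
      have i1: "D (u + t *\<^sub>R v) \<bullet> (u + t *\<^sub>R v) = \<mu> + 2 * t * (D u \<bullet> v) + t\<^sup>2 * (D v \<bullet> v)"
        using adj[of v u] by (simp add: linear_add[OF lin] linear_cmul[OF lin] inner_add_left inner_add_right \<mu>_def
            inner_commute[of v "D u"] power2_eq_square algebra_simps)
      have i2: "(u + t *\<^sub>R v) \<bullet> (u + t *\<^sub>R v) = 1 + 2 * t * (u \<bullet> v) + t\<^sup>2 * (v \<bullet> v)"
        by (simp add: inner_add_left inner_add_right uu inner_commute[of v u] power2_eq_square algebra_simps)
      show ?thesis using i unfolding i1 i2
        by (simp add: p_def q_def inner_diff_left algebra_simps)
    qed
    note B = this
    have q: "q \<ge> 0" using le[OF v] by (simp add: q_def)
    show ?thesis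
    proof (rule ccontr)
      assume "(D u - \<mu> *\<^sub>R u) \<bullet> v \<noteq> 0"
      then have p: "p\<^sup>2 > 0" by (simp add: p_def)
      \<comment> \<open>The quadratic \<open>2 t p - t^2 q\<close> peaks at
        \<open>t = p / q\<close>; the denominator \<open>q + 1\<close> also covers
        \<open>q = 0\<close> and still makes the value positive.\<close>
      have "2 * (p / (q + 1)) * p \<le> (p / (q + 1))\<^sup>2 * q" by (rule B)
      then have "2 * (p / (q + 1)) * p * (q + 1)\<^sup>2 \<le> (p / (q + 1))\<^sup>2 * q * (q + 1)\<^sup>2"
        by (rule mult_right_mono) simp
      moreover have "2 * (p / (q + 1)) * p * (q + 1)\<^sup>2 = p\<^sup>2 * (2 * (q + 1))"
        "(p / (q + 1))\<^sup>2 * q * (q + 1)\<^sup>2 = p\<^sup>2 * q"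
        using q by (simp_all add: power2_eq_square)
      ultimately have "2 * (q + 1) \<le> q" using p by (metis mult_le_cancel_left_pos)
      then show False using q by simp
    qed
  qed
  have "D u - \<mu> *\<^sub>R u \<in> S" using u S by (simp add: subspace_diff subspace_scale)
  from orth[OF this] have "D u = \<mu> *\<^sub>R u" by simp
  moreover have "u \<noteq> 0" "u \<in> S" using u by auto
  ultimately show ?thesis using le by (intro that[of u \<mu>])
qed

text \<open>The eigenvectors span \<open>S\<close>, since the orthogonal complement of their span in
  \<open>S\<close> is invariant and would contain another one. The summands are indexed by the
  eigenvalues themselves, so that distinct indices mean distinct eigenvalues.\<close>

lemma self_adjoint_eigendecomposition:
  fixes D :: "'a::euclidean_space \<Rightarrow> 'a"
  assumes lin: "linear D" and adj: "\<And>x y. D x \<bullet> y = x \<bullet> D y"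
    and S: "subspace S" "\<And>x. x \<in> S \<Longrightarrow> D x \<in> S" and z: "z \<in> S"
  obtains \<sigma> v where "finite \<sigma>" "z = (\<Sum>x\<in>\<sigma>. v x)" "\<And>x. x \<in> \<sigma> \<Longrightarrow> v x \<in> S \<and> v x \<noteq> 0 \<and> D (v x) = x *\<^sub>R v x"
proof -
  define V where "V = {v \<in> S. \<exists>x. D v = x *\<^sub>R v}"
  have VS: "span V \<subseteq> S" using S(1) unfolding V_def by (intro span_minimal) auto
  have DV: "D w \<in> span V" if "w \<in> span V" for w
    using that
  proof (induction rule: span_induct_alt)
    case base then show ?case using lin by (simp add: linear_0 span_0)
  next
    case (step c x y)
    then obtain r where "D x = r *\<^sub>R x" "x \<in> V" by (auto simp: V_def)
    then show ?case using lin step by (simp add: linear_add linear_cmul span_add span_base span_scale)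
  qed
  have "S \<subseteq> span V"
  proof
    fix s assume s: "s \<in> S"
    obtain y w where y: "y \<in> span V" "\<And>x. x \<in> span V \<Longrightarrow> orthogonal w x" "s = y + w"
      using orthogonal_subspace_decomp_exists by blast
    define T where "T = {w \<in> S. \<forall>x\<in>span V. w \<bullet> x = 0}"
    have "subspace T" unfolding T_def subspace_def using S(1)
      by (auto simp: subspace_0 subspace_add subspace_scale inner_add_left)
    moreover have "D x \<in> T" if "x \<in> T" for x
      using that S(2) DV by (auto simp: T_def adj)
    moreover have "w \<in> T" using y s VS S(1) by (auto simp: T_def orthogonal_def intro: subspace_diff dest: subspace_diff[of S s y])
    ultimately have "w = 0"
    proof (rule_tac ccontr)
      assume a: "subspace T" "\<And>x. x \<in> T \<Longrightarrow> D x \<in> T" "w \<in> T" "w \<noteq> 0"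
      then have "T \<noteq> {0}" by blast
      from self_adjoint_eigenvector[OF lin adj a(1,2) this] obtain u \<mu>
        where u: "u \<in> T" "u \<noteq> 0" "D u = \<mu> *\<^sub>R u" by blast
      then have "u \<in> span V" by (auto simp: V_def T_def intro!: span_base)
      with u show False by (auto simp: T_def)
    qed
    with y show "s \<in> span V" by simp
  qed
  with z have "z \<in> span V" by blast
  then have "\<exists>\<sigma> v. finite \<sigma> \<and> z = (\<Sum>x\<in>\<sigma>. v x) \<and> (\<forall>x. v x \<in> S \<and> D (v x) = x *\<^sub>R v x)"
  proof (induction rule: span_induct_alt)
    case base
    then show ?case using lin S(1) by (intro exI[of _ "{}"] exI[of _ "\<lambda>_. 0"]) (auto simp: linear_0 subspace_0)
  next
    case (step c x y)
    then obtain \<sigma> v where v: "finite \<sigma>" "y = (\<Sum>x\<in>\<sigma>. v x)" "\<forall>x. v x \<in> S \<and> D (v x) = x *\<^sub>R v x" by blast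
    obtain r where r: "D x = r *\<^sub>R x" "x \<in> S" using step by (auto simp: V_def)
    define v' where "v' t = (if t \<in> \<sigma> then v t else 0) + (if t = r then c *\<^sub>R x else 0)" for t
    have "(\<Sum>t\<in>insert r \<sigma>. v' t) = (\<Sum>t\<in>insert r \<sigma>. if t \<in> \<sigma> then v t else 0) + c *\<^sub>R x"
      using v(1) by (simp add: v'_def sum.distrib)
    also have "(\<Sum>t\<in>insert r \<sigma>. if t \<in> \<sigma> then v t else 0) = y"
      unfolding v(2) using v(1) by (intro sum.mono_neutral_cong_right) auto
    finally have "c *\<^sub>R x + y = (\<Sum>t\<in>insert r \<sigma>. v' t)" by simp
    moreover have "v' t \<in> S \<and> D (v' t) = t *\<^sub>R v' t" for t
      using v(3) r lin S(1) by (auto simp: v'_def linear_add linear_cmul linear_0 subspace_0 subspace_add subspace_scale algebra_simps)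
    ultimately show ?case using v(1) by blast
  qed
  then obtain \<sigma> v where v: "finite \<sigma>" "z = (\<Sum>x\<in>\<sigma>. v x)" "\<forall>x. v x \<in> S \<and> D (v x) = x *\<^sub>R v x" by blast
  have "z = (\<Sum>x\<in>{x\<in>\<sigma>. v x \<noteq> 0}. v x)"
    unfolding v(2) using v(1) by (intro sum.mono_neutral_right) auto
  show ?thesis
  proof (rule that)
    show "finite {x\<in>\<sigma>. v x \<noteq> 0}" using v(1) by simp
    show "z = (\<Sum>x\<in>{x\<in>\<sigma>. v x \<noteq> 0}. v x)" by fact
    show "v x \<in> S \<and> v x \<noteq> 0 \<and> D (v x) = x *\<^sub>R v x" if "x \<in> {x\<in>\<sigma>. v x \<noteq> 0}" for x
      using that v(3) by blast
  qed
qed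

section \<open>Odd powers of an element and the Peirce eigenvalues of a tripotent\<close>

context jordan_triple begin

lemma tri_sum_left: "tri (\<Sum>i\<in>I. x i) y z = (\<Sum>i\<in>I. tri (x i) y z)"
  by (induction I rule: infinite_finite_induct) (simp_all add: add_left)

lemma tri_sum_mid: "tri x (\<Sum>i\<in>I. y i) z = (\<Sum>i\<in>I. tri x (y i) z)"
  by (induction I rule: infinite_finite_induct) (simp_all add: add_mid)

lemma linear_tri: "linear (tri x y)"
  by (rule linearI) (simp_all add: add_right scaleR)

lemma tri_self_adjoint: "tri z z x \<bullet> y = x \<bullet> tri z z y"
  by (simp add: inner_eq_Re_hip herm)

text \<open>The odd power \<open>z^(2 k + 1)\<close>; a triple product yields no even ones.\<close>

definition pow :: "complex^'N \<Rightarrow> nat \<Rightarrow> complex^'N" where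
  "pow z k = (tri z z ^^ k) z"

lemma pow_0: "pow z 0 = z" and pow_Suc: "pow z (Suc k) = tri z z (pow z k)"
  by (simp_all add: pow_def)

lemma quadratic_commute: "tri z z (tri z x z) = tri z (tri z z x) z"
proof (rule hip_eqI)
  fix d
  note h = arg_cong[where f = "\<lambda>v. hip v d"]
  have s: "tri x z z = tri z z x" "tri (tri z z z) x z = tri z x (tri z z z)" "tri (tri z x z) z z = tri z z (tri z x z)"
    by (metis sym)+
  show "hip (tri z z (tri z x z)) d = hip (tri z (tri z z x) z) d"
    using h[OF jordan[of z z z x z]] h[OF jordan[of z x z z z]]
    unfolding hip_add_left hip_diff_left s by algebra
qed

text \<open>The Jordan identity expresses the operators attached to \<open>{z z y}\<close> through
  those attached to \<open>y\<close>. With \<open>y = pow z k\<close> this is the induction step of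
  \<open>pow_commute\<close>.\<close>

lemma pow_recursion:
  "tri (tri z z y) z x = tri y z (tri z z x) + tri z z (tri y z x) - tri z (tri z x z) y"
  "tri z x (tri z z y) = tri y z (tri z x z) - tri z (tri z z x) y + tri z z (tri z x y)"
proof -
  have "tri x z (tri z z y) = tri (tri x z z) z y - tri z (tri z x z) y + tri z z (tri x z y)"
    by (rule jordan)
  then show "tri (tri z z y) z x = tri y z (tri z z x) + tri z z (tri y z x) - tri z (tri z x z) y"
    by (metis sym add.commute add_diff_eq diff_add_eq)
  have "tri z x (tri z z y) = tri (tri z x z) z y - tri z (tri x z z) y + tri z z (tri z x y)"
    by (rule jordan)
  then show "tri z x (tri z z y) = tri y z (tri z x z) - tri z (tri z z x) y + tri z z (tri z x y)"
    by (metis sym)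
qed

lemma tri_two: "tri (2 * x) y z = 2 * tri x y z" "tri x (2 * y) z = 2 * tri x y z" "tri x y (2 * z) = 2 * tri x y z"
  by (simp_all only: mult_2 additive)

text \<open>The operators \<open>{(pow z k) z _}\<close> and \<open>{z _ (pow z k)}\<close> commute
  with \<open>{z z _}\<close> and \<open>{z _ z}\<close>. The four claims share one induction
  because the recursion mixes them.\<close>

lemma pow_commute:
  "tri (pow z k) z (tri z z x) = tri z z (tri (pow z k) z x)"
  "tri (pow z k) z (tri z x z) = tri z (tri (pow z k) z x) z"
  "tri z (tri z z x) (pow z k) = tri z z (tri z x (pow z k))"
  "tri z (tri z x z) (pow z k) = tri z (tri z x (pow z k)) z"
proof (induction k arbitrary: x)
  case 0
  {
    case 1 show ?case by (simp add: pow_0)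
  next
    case 2 show ?case by (simp add: pow_0 quadratic_commute)
  next
    case 3 show ?case by (simp add: pow_0 quadratic_commute)
  next
    case 4 show ?case by (simp add: pow_0)
  }
next
  case (Suc k)
  {
    case 1 show ?case by (simp add: pow_Suc pow_recursion[where y = "pow z k"] additive tri_two Suc quadratic_commute)
  next
    case 2 show ?case by (simp add: pow_Suc pow_recursion[where y = "pow z k"] additive tri_two Suc quadratic_commute)
  next
    case 3 show ?case by (simp add: pow_Suc pow_recursion[where y = "pow z k"] additive tri_two Suc quadratic_commute)
  next
    case 4 show ?case by (simp add: pow_Suc pow_recursion[where y = "pow z k"] additive tri_two Suc quadratic_commute)
  }
qed

text \<open>The Jordan identity shifts a factor \<open>{z z _}\<close> from the middle argument to
  the first one; the remaining two terms cancel by \<open>pow_commute\<close>. Hence only the sum of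
  the exponents counts.\<close>

lemma tri_pow_pow: "tri (pow z k) (pow z j) x = tri (pow z (k + j)) z x"
proof (induction j arbitrary: k x)
  case 0 then show ?case by (simp add: pow_0)
next
  case (Suc j)
  have "tri z z (tri (pow z k) (pow z j) x) = tri (pow z (Suc k)) (pow z j) x - tri (pow z k) (pow z (Suc j)) x
      + tri (pow z k) (pow z j) (tri z z x)"
    using jordan[of z z "pow z k" "pow z j" x] by (simp add: pow_Suc)
  then show ?case by (simp add: Suc pow_commute)
qed

text \<open>A real span on purpose: the triple product is conjugate linear in the middle, so that
  \<open>quadratic_pow_span\<close> does not pass to the complex span.\<close>

definition pow_span :: "complex^'N \<Rightarrow> (complex^'N) set" where
  "pow_span z = span (range (pow z))"

lemma subspace_pow_span: "subspace (pow_span z)"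
  by (simp add: pow_span_def)

lemma self_in_pow_span: "z \<in> pow_span z"
  unfolding pow_span_def by (metis pow_0 rangeI span_base)

lemma tri_in_pow_span: assumes "x \<in> pow_span z" shows "tri z z x \<in> pow_span z"
  using assms unfolding pow_span_def
proof (induction rule: span_induct_alt)
  case base then show ?case by (simp add: span_0)
next
  case (step c x y)
  then obtain k where "x = pow z k" by blast
  then have "tri z z x \<in> span (range (pow z))" by (metis pow_Suc rangeI span_base)
  with step show ?case by (simp add: add_right scaleR span_add span_scale)
qed

lemma pow_span_shift:
  assumes "u \<in> pow_span z" "v \<in> pow_span z"
  shows "tri (tri z z u) v x = tri u (tri z z v) x"
proof -
  have 1: "tri (tri z z u) (pow z j) x = tri u (tri z z (pow z j)) x" for j
    using assms(1) unfolding pow_span_def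
  proof (induction rule: span_induct_alt)
    case base then show ?case by simp
  next
    case (step c x y)
    then obtain k where "x = pow z k" by blast
    with step show ?case by (simp add: additive scaleR flip: pow_Suc) (simp add: tri_pow_pow)
  qed
  show ?thesis using assms(2) unfolding pow_span_def
  proof (induction rule: span_induct_alt)
    case base then show ?case by simp
  next
    case (step c x y)
    with 1 show ?case by (auto simp add: additive scaleR)
  qed
qed

lemma quadratic_pow_span:
  assumes "u \<in> pow_span z" shows "tri z u z = tri z z u"
  using assms unfolding pow_span_def
proof (induction rule: span_induct_alt)
  case base then show ?case by simp
next
  case (step c x y)
  then obtain k where k: "x = pow z k" by blast
  have "tri z (pow z k) z = tri z z (pow z k)"
  proof (induction k)
    case (Suc k)
    then show ?case using quadratic_commute[of z "pow z k"] by (simp add: pow_Suc)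
  qed (simp add: pow_0)
  with step k show ?case by (simp add: additive scaleR)
qed

lemma tripotent_quadratic:
  assumes e: "tri e e e = e"
  shows "tri e e (tri e x e) = tri e x e"
proof (rule hip_eqI)
  fix d
  note h = arg_cong[where f = "\<lambda>v. hip v d"]
  show "hip (tri e e (tri e x e)) d = hip (tri e x e) d"
    using h[OF jordan[of e e e x e]]
    unfolding hip_add_left hip_diff_left e quadratic_commute[of e x, symmetric] by algebra
qed

text \<open>That is, \<open>D (2 D - 1) (D - 1) = 0\<close>: the Peirce eigenvalues are
  \<open>0\<close>, \<open>1/2\<close> and \<open>1\<close>. With \<open>Q x = {e x e}\<close> the
  Jordan identity gives \<open>Q^2 = 2 D^2 - D\<close>, and \<open>D Q = Q\<close> turns this into
  the cubic.\<close>

lemma tripotent_cubic: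
  assumes e: "tri e e e = e"
  defines "D \<equiv> tri e e"
  shows "D (D (D x)) + D (D (D x)) + D x = D (D x) + D (D x) + D (D x)"
proof -
  have 1: "D x = D (D x) + D (D x) - tri e (tri e x e) e" for x
    using jordan[of x e e e e] unfolding D_def e sym[of x e e] sym[of "tri e e x" e e] by simp
  have 2: "D (tri e (tri e x e) e) = tri e (tri e x e) e"
    unfolding D_def by (rule tripotent_quadratic[OF e])
  have q: "tri e (tri e x e) e = D (D x) + D (D x) - D x"
    using 1[of x] by (simp add: algebra_simps)
  have "D (D (D x)) + D (D (D x)) - D (D x) = D (D x) + D (D x) - D x"
    using 2 unfolding q unfolding D_def additive .
  then show ?thesis by (simp add: diff_eq_eq)
qed

text \<open>The three Peirce eigenvalues lie between \<open>0\<close> and \<open>1\<close>. No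
  diagonalization is used: \<open><D u, u>\<close> and \<open><u - D u, u>\<close> are nonnegative
  combinations of squared norms of polynomials in \<open>D\<close> applied to
  \<open>u\<close>.\<close>

lemma tripotent_bounds:
  assumes e: "tri e e e = e"
  shows "0 \<le> tri e e u \<bullet> u" "tri e e u \<bullet> u \<le> u \<bullet> u"
proof -
  define D where "D = tri e e"
  have lin: "D (x + y) = D x + D y" "D (x - y) = D x - D y" for x y by (simp_all add: D_def additive)
  have adj: "D x \<bullet> y = x \<bullet> D y" for x y by (simp add: D_def tri_self_adjoint)
  have c: "D (D (D x)) + D (D (D x)) + D x = D (D x) + D (D x) + D (D x)" for x
    unfolding D_def by (rule tripotent_cubic[OF e])
  define a b c d g where "a = u \<bullet> u" "b = u \<bullet> D u" "c = u \<bullet> D (D u)" "d = u \<bullet> D (D (D u))"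
    "g = u \<bullet> D (D (D (D u)))"
  note defs = this
  have 1: "2 * d + b = 3 * c"
    using arg_cong[OF c[of u], of "\<lambda>v. u \<bullet> v"] unfolding inner_add_right defs[symmetric] by linarith
  have 2: "2 * g + c = 3 * d"
    using arg_cong[OF c[of "D u"], of "\<lambda>v. u \<bullet> v"] unfolding inner_add_right defs[symmetric] by linarith
  \<comment> \<open>the components of \<open>u\<close> in the eigenspaces of \<open>D\<close> for \<open>1\<close>, \<open>1/2\<close> and \<open>0\<close>, up to scaling\<close>
  have e1: "0 \<le> (D (D u) + D (D u) - D u) \<bullet> (D (D u) + D (D u) - D u)" by simp
  have e2: "0 \<le> (D u - D (D u)) \<bullet> (D u - D (D u))" by simp
  have e3: "0 \<le> (u - D u - D u - D u + D (D u) + D (D u)) \<bullet> (u - D u - D u - D u + D (D u) + D (D u))" by simp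
  note expand = inner_diff_left inner_diff_right inner_add_left inner_add_right adj defs[symmetric]
  have f1: "0 \<le> 4 * g - 4 * d + c" using e1 unfolding expand by linarith
  have f2: "0 \<le> g - 2 * d + c" using e2 unfolding expand by linarith
  have f3: "0 \<le> a - 6 * b + 13 * c - 12 * d + 4 * g" using e3 unfolding expand by linarith
  have "b = tri e e u \<bullet> u" by (simp add: defs D_def inner_commute)
  then show "0 \<le> tri e e u \<bullet> u" "tri e e u \<bullet> u \<le> u \<bullet> u"
    using f1 f2 f3 1 2 defs(1) by linarith+
qed

end

section \<open>Spectral decomposition and spectral norm of a positive triple\<close>

locale positive_jordan_triple = jordan_triple tri
  for tri :: "complex^'N \<Rightarrow> complex^'N \<Rightarrow> complex^'N \<Rightarrow> complex^'N" +
  assumes cube_positive: "\<And>v x. tri v v v = x *\<^sub>R v \<Longrightarrow> v \<noteq> 0 \<Longrightarrow> 0 < x"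
begin

text \<open>The index \<open>x\<close> is an eigenvalue of \<open>{z z _}\<close>, the square of a
  singular value of \<open>z\<close>, and \<open>v x / sqrt x\<close> is a tripotent. Distinct
  components annihilate each other: shifting \<open>{z z _}\<close> from \<open>v x\<close> to
  \<open>v y\<close> gives \<open>x {(v x) (v y) u} = y {(v x) (v y) u}\<close>. Expanding
  \<open>{z z (v x)}\<close> then leaves the cube of \<open>v x\<close>.\<close>

lemma spectral_decomposition:
  obtains \<sigma> v where "finite \<sigma>" "z = (\<Sum>x\<in>\<sigma>. v x)"
    "\<And>x. x \<in> \<sigma> \<Longrightarrow> 0 < x" "\<And>x. x \<in> \<sigma> \<Longrightarrow> v x \<in> pow_span z" "\<And>x. x \<in> \<sigma> \<Longrightarrow> v x \<noteq> 0"
    "\<And>x. x \<in> \<sigma> \<Longrightarrow> tri z z (v x) = x *\<^sub>R v x"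
    "\<And>x. x \<in> \<sigma> \<Longrightarrow> tri (v x) (v x) (v x) = x *\<^sub>R v x"
    "\<And>x y u. x \<in> \<sigma> \<Longrightarrow> y \<in> \<sigma> \<Longrightarrow> x \<noteq> y \<Longrightarrow> tri (v x) (v y) u = 0"
proof -
  obtain \<sigma> v where v: "finite \<sigma>" "z = (\<Sum>x\<in>\<sigma>. v x)"
      "\<And>x. x \<in> \<sigma> \<Longrightarrow> v x \<in> pow_span z \<and> v x \<noteq> 0 \<and> tri z z (v x) = x *\<^sub>R v x"
    using self_adjoint_eigendecomposition[OF linear_tri[of z z] tri_self_adjoint subspace_pow_span tri_in_pow_span self_in_pow_span] by metis
  have orth: "tri (v x) (v y) u = 0" if "x \<in> \<sigma>" "y \<in> \<sigma>" "x \<noteq> y" for x y u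
  proof -
    have "tri (tri z z (v x)) (v y) u = tri (v x) (tri z z (v y)) u"
      using v(3) that by (blast intro: pow_span_shift)
    then have "x *\<^sub>R tri (v x) (v y) u = y *\<^sub>R tri (v x) (v y) u" using v(3) that by (simp add: scaleR)
    then show ?thesis using that by simp
  qed
  have cube: "tri (v x) (v x) (v x) = x *\<^sub>R v x" if "x \<in> \<sigma>" for x
  proof -
    have "tri (\<Sum>y\<in>\<sigma>. v y) (\<Sum>w\<in>\<sigma>. v w) (v x) = (\<Sum>w\<in>\<sigma>. \<Sum>y\<in>\<sigma>. tri (v y) (v w) (v x))"
      by (simp only: tri_sum_left tri_sum_mid)
    also have "\<dots> = (\<Sum>w\<in>\<sigma>. if w = x then tri (v x) (v x) (v x) else 0)"
    proof (rule sum.cong[OF refl])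
      fix w assume w: "w \<in> \<sigma>"
      have "(\<Sum>y\<in>\<sigma>. tri (v y) (v w) (v x)) = (\<Sum>y\<in>\<sigma>. if y = w then tri (v w) (v w) (v x) else 0)"
        using orth w by (intro sum.cong) auto
      also have "\<dots> = tri (v x) (v w) (v w)" using v(1) w sym[of "v w" "v w" "v x"] by simp
      finally show "(\<Sum>y\<in>\<sigma>. tri (v y) (v w) (v x)) = (if w = x then tri (v x) (v x) (v x) else 0)"
        using orth w that by auto
    qed
    also have "\<dots> = tri (v x) (v x) (v x)" using v(1) that by simp
    finally show ?thesis using v(2,3) that by metis
  qed
  show ?thesis
    by (rule that[OF v(1,2)]) (use v(3) cube orth cube_positive in blast)+
qed

text \<open>\<open>{z z _}\<close> is the combination with coefficients \<open>x\<close> of the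
  nonnegative operators \<open>{(e x) (e x) _}\<close>. These add up to \<open>{E E _}\<close> for
  the tripotent \<open>E\<close>, hence to at most \<open>1\<close>. The \<open>max M 0\<close>
  covers an empty \<open>\<sigma>\<close>, for which \<open>M\<close> is arbitrary.\<close>

lemma spectral_bounds:
  assumes "finite \<sigma>" "z = (\<Sum>x\<in>\<sigma>. v x)" "\<And>x. x \<in> \<sigma> \<Longrightarrow> 0 < x"
    "\<And>x. x \<in> \<sigma> \<Longrightarrow> tri (v x) (v x) (v x) = x *\<^sub>R v x"
    "\<And>x y u. x \<in> \<sigma> \<Longrightarrow> y \<in> \<sigma> \<Longrightarrow> x \<noteq> y \<Longrightarrow> tri (v x) (v y) u = 0"
  shows "0 \<le> tri z z u \<bullet> u" "\<And>M. (\<And>x. x \<in> \<sigma> \<Longrightarrow> x \<le> M) \<Longrightarrow> tri z z u \<bullet> u \<le> max M 0 * (u \<bullet> u)"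
proof -
  have diag: "tri (\<Sum>x\<in>\<sigma>. c x *\<^sub>R v x) (\<Sum>x\<in>\<sigma>. c x *\<^sub>R v x) u = (\<Sum>x\<in>\<sigma>. (c x)\<^sup>2 *\<^sub>R tri (v x) (v x) u)" for c u
  proof -
    have "tri (\<Sum>x\<in>\<sigma>. c x *\<^sub>R v x) (\<Sum>x\<in>\<sigma>. c x *\<^sub>R v x) u
        = (\<Sum>y\<in>\<sigma>. \<Sum>x\<in>\<sigma>. (c x * c y) *\<^sub>R tri (v x) (v y) u)"
      by (simp add: tri_sum_left tri_sum_mid scaleR scaleR_sum_right mult.commute)
    also have "\<dots> = (\<Sum>y\<in>\<sigma>. \<Sum>x\<in>\<sigma>. if x = y then (c x)\<^sup>2 *\<^sub>R tri (v x) (v x) u else 0)"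
      using assms(5) by (intro sum.cong) (auto simp: power2_eq_square)
    also have "\<dots> = (\<Sum>y\<in>\<sigma>. (c y)\<^sup>2 *\<^sub>R tri (v y) (v y) u)"
      using assms(1) by (simp cong: if_cong)
    finally show ?thesis .
  qed
  define e where "e x = v x /\<^sub>R sqrt x" for x
  have e: "tri (e x) (e x) (e x) = e x" "tri (v x) (v x) u = x *\<^sub>R tri (e x) (e x) u" if "x \<in> \<sigma>" for x u
    using assms(3,4)[OF that] by (simp_all add: e_def scaleR field_simps flip: power2_eq_square)
  have pos: "0 \<le> tri (e x) (e x) u \<bullet> u" if "x \<in> \<sigma>" for x
    by (rule tripotent_bounds(1)[OF e(1)[OF that]])
  have zu: "tri z z u = (\<Sum>x\<in>\<sigma>. x *\<^sub>R tri (e x) (e x) u)"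
    using diag[of "\<lambda>_. 1" u] e(2) by (simp add: assms(2))
  then have zuu: "tri z z u \<bullet> u = (\<Sum>x\<in>\<sigma>. x * (tri (e x) (e x) u \<bullet> u))"
    by (simp add: inner_sum_left)
  show "0 \<le> tri z z u \<bullet> u" unfolding zuu using assms(3) pos by (intro sum_nonneg mult_nonneg_nonneg) (auto intro: less_imp_le)
  fix M assume M: "\<And>x. x \<in> \<sigma> \<Longrightarrow> x \<le> M"
  define E where "E = (\<Sum>x\<in>\<sigma>. (1 / sqrt x) *\<^sub>R v x)"
  have Eu: "tri E E u = (\<Sum>x\<in>\<sigma>. tri (e x) (e x) u)" for u
    unfolding E_def diag using assms(3) e(2) by (intro sum.cong) (auto simp: power_divide less_imp_le)
  have "tri E E E = (\<Sum>x\<in>\<sigma>. \<Sum>y\<in>\<sigma>. (1 / sqrt y) *\<^sub>R tri (e x) (e x) (v y))"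
    unfolding Eu by (simp add: E_def tri_sum_left sym[of "e _" "e _"] scaleR)
  also have "\<dots> = (\<Sum>x\<in>\<sigma>. \<Sum>y\<in>\<sigma>. if y = x then e x else 0)"
  proof (intro sum.cong refl)
    fix x y assume xy: "x \<in> \<sigma>" "y \<in> \<sigma>"
    show "(1 / sqrt y) *\<^sub>R tri (e x) (e x) (v y) = (if y = x then e x else 0)"
    proof (cases "y = x")
      case True
      have "(1 / sqrt x) *\<^sub>R tri (e x) (e x) (v x) = tri (e x) (e x) (e x)" by (simp add: e_def scaleR divide_inverse)
      with True e(1) xy show ?thesis by simp
    next
      case False
      then have "tri (v y) (e x) (e x) = 0" using assms(5) xy by (simp add: e_def scaleR)
      then show ?thesis using False by (metis sym scaleR_zero_right)
    qed
  qed
  also have "\<dots> = E" using assms(1) by (simp add: e_def E_def divide_inverse cong: if_cong)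
  finally have "tri E E u \<bullet> u \<le> u \<bullet> u" by (rule tripotent_bounds(2))
  then have le: "(\<Sum>x\<in>\<sigma>. tri (e x) (e x) u \<bullet> u) \<le> u \<bullet> u" by (simp add: Eu inner_sum_left)
  have "tri z z u \<bullet> u \<le> (\<Sum>x\<in>\<sigma>. max M 0 * (tri (e x) (e x) u \<bullet> u))"
    unfolding zuu using M pos by (intro sum_mono mult_right_mono) (auto intro: max.coboundedI1)
  also have "\<dots> \<le> max M 0 * (u \<bullet> u)"
    using le by (simp add: sum_distrib_left[symmetric] mult_left_mono)
  finally show "tri z z u \<bullet> u \<le> max M 0 * (u \<bullet> u)" .
qed

lemma tri_nonneg: "0 \<le> tri z z u \<bullet> u"
  by (rule spectral_decomposition[of z]) (rule spectral_bounds(1))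

text \<open>The square root of the largest eigenvalue of \<open>{z z _}\<close>; in the matrix case
  it is the operator norm.\<close>

definition snorm :: "complex^'N \<Rightarrow> real" where
  "snorm z = sqrt (SUP u\<in>sphere 0 1. tri z z u \<bullet> u)"

lemma axis_sphere: "axis i 1 \<in> sphere (0::complex^'N) 1"
  by simp

lemma tri_attains_sup:
  obtains u where "norm u = 1" "\<And>v. norm v = 1 \<Longrightarrow> tri z z v \<bullet> v \<le> tri z z u \<bullet> u"
proof -
  have "continuous_on (sphere 0 1) (\<lambda>v. tri z z v \<bullet> v)"
    using linear_tri[of z z] by (intro continuous_on_inner linear_continuous_on continuous_on_id) (simp add: linear_conv_bounded_linear)
  moreover have "sphere (0::complex^'N) 1 \<noteq> {}" using axis_sphere by blast
  ultimately obtain u where "u \<in> sphere 0 1" "\<And>v. v \<in> sphere 0 1 \<Longrightarrow> tri z z v \<bullet> v \<le> tri z z u \<bullet> u"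
    using continuous_attains_sup[OF compact_sphere] by blast
  then show ?thesis using that by auto
qed

lemma snorm_attained:
  obtains u where "norm u = 1" "tri z z u \<bullet> u = (snorm z)\<^sup>2"
proof -
  obtain u where u: "norm u = 1" "\<And>v. norm v = 1 \<Longrightarrow> tri z z v \<bullet> v \<le> tri z z u \<bullet> u"
    using tri_attains_sup by blast
  have "(SUP u\<in>sphere 0 1. tri z z u \<bullet> u) = tri z z u \<bullet> u"
    using u by (intro cSup_eq_maximum) auto
  then show ?thesis using that[of u] u tri_nonneg[of z u] by (simp add: snorm_def)
qed

lemma snorm_nonneg [simp]: "0 \<le> snorm z"
proof -
  have "(SUP u\<in>sphere 0 1. tri z z u \<bullet> u) \<ge> 0"
  proof -
    obtain u where u: "norm u = 1" "\<And>v. norm v = 1 \<Longrightarrow> tri z z v \<bullet> v \<le> tri z z u \<bullet> u"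
      using tri_attains_sup by blast
    have "(SUP u\<in>sphere 0 1. tri z z u \<bullet> u) = tri z z u \<bullet> u"
      using u by (intro cSup_eq_maximum) auto
    then show ?thesis using tri_nonneg by simp
  qed
  then show ?thesis by (simp add: snorm_def)
qed

lemma tri_le_snorm: "tri z z u \<bullet> u \<le> (snorm z)\<^sup>2 * (u \<bullet> u)"
proof (cases "u = 0")
  case True then show ?thesis by simp
next
  case False
  obtain w where w: "norm w = 1" "\<And>v. norm v = 1 \<Longrightarrow> tri z z v \<bullet> v \<le> tri z z w \<bullet> w"
    using tri_attains_sup by blast
  have "(SUP u\<in>sphere 0 1. tri z z u \<bullet> u) = tri z z w \<bullet> w"
    using w by (intro cSup_eq_maximum) auto
  then have s: "(snorm z)\<^sup>2 = tri z z w \<bullet> w" using tri_nonneg[of z w] by (simp add: snorm_def)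
  have "tri z z (u /\<^sub>R norm u) \<bullet> (u /\<^sub>R norm u) \<le> (snorm z)\<^sup>2"
    unfolding s using False by (intro w(2)) simp
  then have "(tri z z u \<bullet> u) / (norm u)\<^sup>2 \<le> (snorm z)\<^sup>2"
    by (simp add: scaleR divide_inverse power2_eq_square mult_ac)
  then show ?thesis using False by (simp add: field_simps power2_norm_eq_inner)
qed

lemma snorm_le_iff: assumes "0 \<le> r" shows "snorm z \<le> r \<longleftrightarrow> (\<forall>u. tri z z u \<bullet> u \<le> r\<^sup>2 * (u \<bullet> u))"
proof
  assume "snorm z \<le> r"
  then have "(snorm z)\<^sup>2 \<le> r\<^sup>2" by (simp add: power_mono)
  then show "\<forall>u. tri z z u \<bullet> u \<le> r\<^sup>2 * (u \<bullet> u)"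
    by (meson tri_le_snorm inner_ge_zero mult_right_mono order_trans)
next
  assume *: "\<forall>u. tri z z u \<bullet> u \<le> r\<^sup>2 * (u \<bullet> u)"
  obtain u where u: "norm u = 1" "tri z z u \<bullet> u = (snorm z)\<^sup>2" using snorm_attained by blast
  have "u \<bullet> u = 1" using u by (simp flip: power2_norm_eq_inner)
  with * u have "(snorm z)\<^sup>2 \<le> r\<^sup>2" by (metis mult.right_neutral)
  then show "snorm z \<le> r" using assms by (simp add: power2_le_iff_abs_le)
qed

lemma snorm_scale: "snorm (c *s z) = norm c * snorm z"
proof -
  have *: "tri (c *s z) (c *s z) u \<bullet> u = (norm c)\<^sup>2 * (tri z z u \<bullet> u)" for u
  proof -
    have "tri (c *s z) (c *s z) u = (c * cnj c) *s tri z z u"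
      by (simp add: scale_left scale_mid vector_smult_assoc)
    also have "\<dots> = (norm c)\<^sup>2 *\<^sub>R tri z z u"
      by (simp add: scaleR_vec_complex complex_norm_square[symmetric] flip: of_real_power)
    finally show ?thesis by simp
  qed
  have "(SUP u\<in>sphere 0 1. (norm c)\<^sup>2 * (tri z z u \<bullet> u)) = (norm c)\<^sup>2 * (SUP u\<in>sphere 0 1. tri z z u \<bullet> u)"
  proof -
    obtain u where u: "norm u = 1" "\<And>v. norm v = 1 \<Longrightarrow> tri z z v \<bullet> v \<le> tri z z u \<bullet> u"
      using tri_attains_sup by blast
    have "(SUP u\<in>sphere 0 1. tri z z u \<bullet> u) = tri z z u \<bullet> u"
      using u by (intro cSup_eq_maximum) auto
    moreover have "(SUP u\<in>sphere 0 1. (norm c)\<^sup>2 * (tri z z u \<bullet> u)) = (norm c)\<^sup>2 * (tri z z u \<bullet> u)"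
      using u by (intro cSup_eq_maximum) (auto intro: mult_left_mono)
    ultimately show ?thesis by simp
  qed
  then show ?thesis unfolding snorm_def * by (simp add: real_sqrt_mult)
qed

text \<open>For fixed \<open>u\<close>, \<open><{x y u}, u>\<close> is a positive semidefinite
  Hermitian form in \<open>x\<close> and \<open>y\<close>. Its Cauchy-Schwarz inequality, obtained
  from the discriminant, bounds the mixed terms.\<close>

lemma snorm_triangle: "snorm (z + w) \<le> snorm z + snorm w"
proof (subst snorm_le_iff)
  show "0 \<le> snorm z + snorm w" by simp
  show "\<forall>u. tri (z + w) (z + w) u \<bullet> u \<le> (snorm z + snorm w)\<^sup>2 * (u \<bullet> u)"
  proof
    fix u
    define a b c where "a = tri z z u \<bullet> u" "b = tri z w u \<bullet> u" "c = tri w w u \<bullet> u"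
    note defs = this
    have b': "tri w z u \<bullet> u = b"
    proof -
      have "hip (tri w z u) u = cnj (hip (tri z w u) u)" by (simp add: cnj_hip herm[of w])
      then show ?thesis by (simp add: defs inner_eq_Re_hip)
    qed
    have "0 \<le> t\<^sup>2 * a + 2 * t * b + c" for t
      using tri_nonneg[of "t *\<^sub>R z + w" u] b'
      by (simp add: additive scaleR inner_add_left defs power2_eq_square algebra_simps)
    note quad = this
    have ac: "0 \<le> a" "0 \<le> c" using tri_nonneg by (simp_all add: defs)
    have "b\<^sup>2 \<le> a * c"
    proof (cases "a = 0")
      case True
      have "b = 0"
      proof (rule ccontr)
        assume "b \<noteq> 0"
        \<comment> \<open>For \<open>a = 0\<close> the quadratic is affine, and it takes the value
          \<open>-1\<close> at this \<open>t\<close>.\<close>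
        then show False using quad[of "- (c + 1) / (2 * b)"] True by (simp add: field_simps)
      qed
      then show ?thesis using True by simp
    next
      case False
      then show ?thesis using quad[of "- b / a"] ac by (simp add: field_simps power2_eq_square)
    qed
    then have "b \<le> sqrt a * sqrt c" by (metis abs_le_D1 real_sqrt_abs real_sqrt_le_mono real_sqrt_mult)
    moreover have "sqrt a \<le> snorm z * norm u" "sqrt c \<le> snorm w * norm u"
      using tri_le_snorm[of z u] tri_le_snorm[of w u]
      by (simp_all add: defs real_le_lsqrt power_mult_distrib power2_norm_eq_inner)
    then have "(sqrt a + sqrt c)\<^sup>2 \<le> (snorm z * norm u + snorm w * norm u)\<^sup>2"
      using ac by (intro power_mono add_mono) auto
    ultimately have "a + 2 * b + c \<le> (snorm z * norm u + snorm w * norm u)\<^sup>2"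
      using ac by (simp add: power2_sum)
    also have "\<dots> = (snorm z + snorm w)\<^sup>2 * (u \<bullet> u)"
      by (simp add: power2_norm_eq_inner[symmetric] power_mult_distrib flip: distrib_right)
    finally show "tri (z + w) (z + w) u \<bullet> u \<le> (snorm z + snorm w)\<^sup>2 * (u \<bullet> u)"
      by (simp add: additive inner_add_left b' defs[symmetric])
  qed
qed

lemma snorm_zero [simp]: "snorm 0 = 0"
  using snorm_scale[of 0 0] by simp

lemma snorm_scaleR: "snorm (r *\<^sub>R z) = \<bar>r\<bar> * snorm z"
  by (simp add: scaleR_vec_complex snorm_scale)

lemma snorm_sum: "snorm (\<Sum>i\<in>I. x i) \<le> (\<Sum>i\<in>I. snorm (x i))"
  by (induction I rule: infinite_finite_induct) (auto intro: order_trans[OF snorm_triangle])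

lemma snorm_le_norm: obtains C where "0 < C" "\<And>z. snorm z \<le> C * norm z"
proof -
  define C where "C = (\<Sum>b\<in>Basis. snorm b) + 1"
  have "snorm z \<le> C * norm z" for z
  proof -
    have "snorm z = snorm (\<Sum>b\<in>Basis. (z \<bullet> b) *\<^sub>R b)" by (simp add: euclidean_representation)
    also have "\<dots> \<le> (\<Sum>b\<in>Basis. \<bar>z \<bullet> b\<bar> * snorm b)" using snorm_sum[of "\<lambda>b. (z \<bullet> b) *\<^sub>R b" Basis] by (simp add: snorm_scaleR)
    also have "\<dots> \<le> (\<Sum>b\<in>Basis. norm z * snorm b)"
      by (intro sum_mono mult_right_mono) (auto simp: Basis_le_norm)
    also have "\<dots> \<le> C * norm z" by (simp add: C_def sum_distrib_left[symmetric] algebra_simps)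
    finally show ?thesis .
  qed
  moreover have "C > 0" by (simp add: C_def add_nonneg_pos sum_nonneg)
  ultimately show ?thesis using that by blast
qed

lemma continuous_on_snorm: "continuous_on S snorm"
proof -
  obtain C where C: "0 < C" "\<And>z. snorm z \<le> C * norm z" using snorm_le_norm by blast
  have "dist (snorm x) (snorm y) \<le> C * dist x y" for x y
  proof -
    have "snorm x \<le> snorm y + snorm (x - y)" "snorm y \<le> snorm x + snorm (y - x)"
      using snorm_triangle[of y "x - y"] snorm_triangle[of x "y - x"] by simp_all
    moreover have "snorm (x - y) \<le> C * dist x y" "snorm (y - x) \<le> C * dist x y"
      using C(2)[of "x - y"] C(2)[of "y - x"] by (simp_all add: dist_norm norm_minus_commute)
    ultimately show ?thesis by (simp add: dist_real_def)
  qed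
  then have "C-lipschitz_on S snorm" using C(1) by (intro lipschitz_onI) auto
  then show ?thesis by (rule lipschitz_on_continuous_on)
qed

lemma eigenvalue_le_snorm:
  assumes "tri z z u = x *\<^sub>R u" "u \<noteq> 0" shows "x \<le> (snorm z)\<^sup>2"
  using tri_le_snorm[of z u] assms by simp

text \<open>On the real span of the odd powers \<open>{z a z} = {z z a}\<close>, so the equation is
  diagonal in the spectral components, with factors \<open>1 - x\<close> that do not vanish as
  \<open>x \<le> (snorm z)^2 < 1\<close>. The solution makes the quadratic field of \<open>a\<close>
  radial at \<open>z\<close>.\<close>

lemma quadratic_field_solvable:
  assumes "snorm z < 1" obtains a where "a - tri z a z = z"
proof (rule spectral_decomposition[of z])
  fix \<sigma> v
  assume v: "finite \<sigma>" "z = (\<Sum>x\<in>\<sigma>. v x)""\<And>x. x \<in> \<sigma> \<Longrightarrow> 0 < x"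
    "\<And>x. x \<in> \<sigma> \<Longrightarrow> v x \<in> pow_span z" "\<And>x. x \<in> \<sigma> \<Longrightarrow> v x \<noteq> 0" "\<And>x. x \<in> \<sigma> \<Longrightarrow> tri z z (v x) = x *\<^sub>R v x"
    "\<And>x. x \<in> \<sigma> \<Longrightarrow> tri (v x) (v x) (v x) = x *\<^sub>R v x"
    "\<And>x y u. x \<in> \<sigma> \<Longrightarrow> y \<in> \<sigma> \<Longrightarrow> x \<noteq> y \<Longrightarrow> tri (v x) (v y) u = 0"
  define a where "a = (\<Sum>x\<in>\<sigma>. (1 / (1 - x)) *\<^sub>R v x)"
  have "a \<in> pow_span z" unfolding a_def
    by (intro subspace_sum subspace_scale subspace_pow_span v(4))
  then have "tri z a z = tri z z a" by (rule quadratic_pow_span)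
  also have "\<dots> = (\<Sum>x\<in>\<sigma>. (x / (1 - x)) *\<^sub>R v x)"
    using v(6) by (simp add: a_def linear_sum[OF linear_tri] scaleR)
  finally have "a - tri z a z = (\<Sum>x\<in>\<sigma>. (1 / (1 - x) - x / (1 - x)) *\<^sub>R v x)"
    by (simp add: a_def sum_subtractf scaleR_left_diff_distrib)
  also have "\<dots> = (\<Sum>x\<in>\<sigma>. v x)"
  proof (rule sum.cong[OF refl])
    fix x assume "x \<in> \<sigma>"
    then have "x \<le> (snorm z)\<^sup>2" using v by (intro eigenvalue_le_snorm) auto
    moreover have "(snorm z)\<^sup>2 < 1" using assms by (simp add: power_less_one_iff abs_square_less_1)
    ultimately have "x \<noteq> 1" by simp
    then show "(1 / (1 - x) - x / (1 - x)) *\<^sub>R v x = v x" by (simp flip: diff_divide_distrib)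
  qed
  finally show ?thesis using that v(2) by simp
qed

text \<open>On the unit sphere of \<open>snorm\<close> the eigenvalue \<open>1\<close> occurs, and
  \<open>a\<close> is its spectral component. The quadratic field of \<open>a\<close> is then zero
  at \<open>z\<close> although \<open>a\<close> is not orthogonal to \<open>z\<close>, which will
  exclude \<open>z\<close> from \<open>\<Omega>\<close>.\<close>

lemma quadratic_field_zero:
  assumes "snorm z = 1" obtains a where "tri z a z = a" "0 < z \<bullet> a"
proof (rule spectral_decomposition[of z])
  fix \<sigma> v
  assume v: "finite \<sigma>" "z = (\<Sum>x\<in>\<sigma>. v x)" "\<And>x. x \<in> \<sigma> \<Longrightarrow> 0 < x"
    "\<And>x. x \<in> \<sigma> \<Longrightarrow> v x \<in> pow_span z" "\<And>x. x \<in> \<sigma> \<Longrightarrow> v x \<noteq> 0" "\<And>x. x \<in> \<sigma> \<Longrightarrow> tri z z (v x) = x *\<^sub>R v x"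
    "\<And>x. x \<in> \<sigma> \<Longrightarrow> tri (v x) (v x) (v x) = x *\<^sub>R v x"
    "\<And>x y u. x \<in> \<sigma> \<Longrightarrow> y \<in> \<sigma> \<Longrightarrow> x \<noteq> y \<Longrightarrow> tri (v x) (v y) u = 0"
  have le1: "x \<le> 1" if "x \<in> \<sigma>" for x
    using eigenvalue_le_snorm[OF v(6)[OF that] v(5)[OF that]] assms by simp
  \<comment> \<open>Otherwise all eigenvalues are at most some \<open>M < 1\<close>, and then the
    form stays below \<open>1\<close> on unit vectors. The \<open>0\<close> inserted in
    \<open>Max\<close> serves an empty \<open>\<sigma>\<close>.\<close>
  have "1 \<in> \<sigma>"
  proof (rule ccontr)
    assume "1 \<notin> \<sigma>"
    define M where "M = Max (insert 0 \<sigma>)"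
    have M: "x \<le> M" if "x \<in> \<sigma>" for x using v(1) that by (simp add: M_def)
    have M01: "0 \<le> M" using v(1) by (simp add: M_def)
    have "M \<in> insert 0 \<sigma>" unfolding M_def using v(1) by (intro Max_in) auto
    then have "M < 1" using le1 \<open>1 \<notin> \<sigma>\<close> by (cases "M = 0") (auto simp: order_less_le)
    obtain u where u: "norm u = 1" "tri z z u \<bullet> u = (snorm z)\<^sup>2" using snorm_attained by blast
    have "tri z z u \<bullet> u \<le> max M 0 * (u \<bullet> u)"
      by (rule spectral_bounds(2)[OF v(1,2,3,7,8) M])
    then show False using u M01 \<open>M < 1\<close> assms by (simp flip: power2_norm_eq_inner)
  qed
  have "tri z (v 1) z = v 1" using quadratic_pow_span v(4,6) \<open>1 \<in> \<sigma>\<close> by simp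
  moreover have "z \<bullet> v 1 = v 1 \<bullet> v 1"
  proof -
    have "v x \<bullet> v 1 = 0" if "x \<in> \<sigma>" "x \<noteq> 1" for x
      using tri_self_adjoint[of z "v x" "v 1"] v(6) that \<open>1 \<in> \<sigma>\<close> by simp
    then have "(\<Sum>x\<in>\<sigma>. v x \<bullet> v 1) = (\<Sum>x\<in>\<sigma>. if x = 1 then v 1 \<bullet> v 1 else 0)" by (intro sum.cong) auto
    then have "(\<Sum>x\<in>\<sigma>. v x) \<bullet> v 1 = v 1 \<bullet> v 1" using v(1) \<open>1 \<in> \<sigma>\<close> by (simp add: inner_sum_left)
    then show ?thesis by (metis v(2))
  qed
  ultimately show ?thesis using that v(5) \<open>1 \<in> \<sigma>\<close> by simp
qed

end

section \<open>Homogeneous polynomials\<close>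

abbreviation fd :: "(complex^'a \<Rightarrow> complex) \<Rightarrow> complex^'a \<Rightarrow> complex^'a \<Rightarrow> complex" where
  "fd P z \<equiv> frechet_derivative P (at z)"

text \<open>The symmetric second derivative is carried along, so that polynomials acquire it by
  closure under sums and products. Complex linearity is stated for the first derivative; the second
  one inherits it in both arguments.\<close>

definition twice_holomorphic :: "(complex^'a \<Rightarrow> complex) \<Rightarrow> bool" where
  "twice_holomorphic P \<longleftrightarrow> (\<exists>P' P''. (\<forall>z. (P has_derivative P' z) (at z)) \<and>
     (\<forall>z v. ((\<lambda>z. P' z v) has_derivative P'' z v) (at z)) \<and>
     (\<forall>z c v. P' z (c *s v) = c * P' z v) \<and>
     (\<forall>z v w. P'' z v w = P'' z w v))"

lemma twice_holomorphic_const: "twice_holomorphic (\<lambda>z. c)"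
  unfolding twice_holomorphic_def by (rule exI[of _ "\<lambda>_ _. 0"], rule exI[of _ "\<lambda>_ _ _. 0"]) auto

lemma twice_holomorphic_nth: "twice_holomorphic (\<lambda>z. z $ i)"
  unfolding twice_holomorphic_def
  by (rule exI[of _ "\<lambda>_ v. v $ i"], rule exI[of _ "\<lambda>_ _ _. 0"]) (auto intro!: bounded_linear_imp_has_derivative bounded_linear_vec_nth)

lemma twice_holomorphicE:
  assumes "twice_holomorphic P"
  obtains P' P'' where "\<And>z. (P has_derivative P' z) (at z)" "\<And>z v. ((\<lambda>z. P' z v) has_derivative P'' z v) (at z)"
    "\<And>z c v. P' z (c *s v) = c * P' z v" "\<And>z v w. P'' z v w = P'' z w v"
proof -
  from assms obtain P' P'' where *: "(\<forall>z. (P has_derivative P' z) (at z)) \<and>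
     (\<forall>z v. ((\<lambda>z. P' z v) has_derivative P'' z v) (at z)) \<and>
     (\<forall>z c v. P' z (c *s v) = c * P' z v) \<and>
     (\<forall>z v w. P'' z v w = P'' z w v)"
    unfolding twice_holomorphic_def by (elim exE)
  show ?thesis by (rule that[of P' P'']) (use * in blast)+
qed

lemma twice_holomorphic_add:
  assumes "twice_holomorphic P" "twice_holomorphic Q" shows "twice_holomorphic (\<lambda>z. P z + Q z)"
proof -
  obtain P' P'' where P: "\<And>z. (P has_derivative P' z) (at z)" "\<And>z v. ((\<lambda>z. P' z v) has_derivative P'' z v) (at z)"
    "\<And>z c v. P' z (c *s v) = c * P' z v" "\<And>z v w. P'' z v w = P'' z w v"
    using twice_holomorphicE[OF assms(1)] by metis
  obtain Q' Q'' where Q: "\<And>z. (Q has_derivative Q' z) (at z)" "\<And>z v. ((\<lambda>z. Q' z v) has_derivative Q'' z v) (at z)"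
    "\<And>z c v. Q' z (c *s v) = c * Q' z v" "\<And>z v w. Q'' z v w = Q'' z w v"
    using twice_holomorphicE[OF assms(2)] by metis
  note PQ = P Q
  show ?thesis unfolding twice_holomorphic_def
    by (rule exI[of _ "\<lambda>z v. P' z v + Q' z v"], rule exI[of _ "\<lambda>z v w. P'' z v w + Q'' z v w"])
       (auto intro!: derivative_eq_intros PQ simp: PQ(3,7) algebra_simps, metis PQ(4,8))
qed

lemma twice_holomorphic_mult:
  assumes "twice_holomorphic P" "twice_holomorphic Q" shows "twice_holomorphic (\<lambda>z. P z * Q z)"
proof -
  obtain P' P'' where P: "\<And>z. (P has_derivative P' z) (at z)" "\<And>z v. ((\<lambda>z. P' z v) has_derivative P'' z v) (at z)"
    "\<And>z c v. P' z (c *s v) = c * P' z v" "\<And>z v w. P'' z v w = P'' z w v"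
    using twice_holomorphicE[OF assms(1)] by metis
  obtain Q' Q'' where Q: "\<And>z. (Q has_derivative Q' z) (at z)" "\<And>z v. ((\<lambda>z. Q' z v) has_derivative Q'' z v) (at z)"
    "\<And>z c v. Q' z (c *s v) = c * Q' z v" "\<And>z v w. Q'' z v w = Q'' z w v"
    using twice_holomorphicE[OF assms(2)] by metis
  note PQ = P Q
  show ?thesis unfolding twice_holomorphic_def
  proof (intro exI conjI allI)
    show "((\<lambda>z. P z * Q z) has_derivative (\<lambda>v. P z * Q' z v + P' z v * Q z)) (at z)" for z
      by (rule has_derivative_mult PQ)+
    show "((\<lambda>z. P z * Q' z v + P' z v * Q z) has_derivative
        (\<lambda>w. (P z * Q'' z v w + P' z w * Q' z v) + (P' z v * Q' z w + P'' z v w * Q z))) (at z)" for z v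
      by (rule has_derivative_add has_derivative_mult PQ)+
    show "P z * Q' z (c *s v) + P' z (c *s v) * Q z = c * (P z * Q' z v + P' z v * Q z)" for z c v
      by (simp add: PQ(3,7) algebra_simps)
    show "(P z * Q'' z v w + P' z w * Q' z v) + (P' z v * Q' z w + P'' z v w * Q z) =
      (P z * Q'' z w v + P' z v * Q' z w) + (P' z w * Q' z v + P'' z w v * Q z)" for z v w
      using PQ(4)[of z v w] PQ(8)[of z v w] by simp
  qed
qed

lemma twice_holomorphic_sum:
  assumes "\<And>i. i \<in> I \<Longrightarrow> twice_holomorphic (P i)" shows "twice_holomorphic (\<lambda>z. \<Sum>i\<in>I. P i z)"
  using assms by (induction I rule: infinite_finite_induct) (auto intro: twice_holomorphic_const twice_holomorphic_add)

lemma twice_holomorphic_prod: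
  assumes "\<And>i. i \<in> I \<Longrightarrow> twice_holomorphic (P i)" shows "twice_holomorphic (\<lambda>z. \<Prod>i\<in>I. P i z)"
  using assms by (induction I rule: infinite_finite_induct) (auto intro: twice_holomorphic_const twice_holomorphic_mult)

lemma twice_holomorphic_power:
  assumes "twice_holomorphic P" shows "twice_holomorphic (\<lambda>z. P z ^ n)"
  using assms by (induction n) (auto intro: twice_holomorphic_const twice_holomorphic_mult)

lemma twice_holomorphic_homogeneous: assumes "homogeneous_poly n P" shows "twice_holomorphic P"
proof -
  obtain c where c: "P = (\<lambda>z. \<Sum>\<alpha>\<in>{\<alpha>. sum \<alpha> UNIV = n}. c \<alpha> * (\<Prod>i\<in>UNIV. z $ i ^ \<alpha> i))"
    using assms unfolding homogeneous_poly_def by blast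
  show ?thesis unfolding c
    by (intro twice_holomorphic_sum twice_holomorphic_mult twice_holomorphic_const twice_holomorphic_prod
        twice_holomorphic_power twice_holomorphic_nth)
qed

context
  fixes P :: "complex^'a \<Rightarrow> complex"
  assumes P: "twice_holomorphic P"
begin

lemma has_derivative_fd: "(P has_derivative fd P z) (at z)"
  using P unfolding twice_holomorphic_def by (metis frechet_derivative_at)

lemma linear_fd: "linear (fd P z)"
  using has_derivative_fd by (rule has_derivative_linear)

lemma fd_scale: "fd P z (c *s v) = c * fd P z v"
  using P unfolding twice_holomorphic_def by (metis frechet_derivative_at)

lemma fd_basis: "fd P z u = (\<Sum>i\<in>UNIV. u $ i * fd P z (axis i 1))"
  using linear_sum[OF linear_fd, of z "\<lambda>i. u $ i *s axis i 1" UNIV] by (simp add: basis_expansion fd_scale)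

lemma second_derivative_symmetric:
  obtains P'' where "\<And>z v. ((\<lambda>z. fd P z v) has_derivative P'' z v) (at z)" "\<And>z v w. P'' z v w = P'' z w v"
proof -
  from P obtain P' P'' where PQ:
    "\<And>z. (P has_derivative P' z) (at z)" "\<And>z v. ((\<lambda>z. P' z v) has_derivative P'' z v) (at z)"
    "\<And>z v w. P'' z v w = P'' z w v"
    unfolding twice_holomorphic_def by blast
  have "P' = (\<lambda>z. fd P z)" using PQ(1) frechet_derivative_at by blast
  then show ?thesis using that[of P''] PQ(2,3) by simp
qed

lemma continuous_on_twice_holomorphic: "continuous_on S P"
  using has_derivative_fd by (meson continuous_at_imp_continuous_on has_derivative_continuous)

end

lemma homogeneous_poly_scale:
  assumes "homogeneous_poly n P" shows "P (c *s z) = c ^ n * P z"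
proof -
  obtain a where a: "P = (\<lambda>z. \<Sum>\<alpha>\<in>{\<alpha>. sum \<alpha> UNIV = n}. a \<alpha> * (\<Prod>i\<in>UNIV. z $ i ^ \<alpha> i))"
    using assms unfolding homogeneous_poly_def by blast
  show ?thesis unfolding a sum_distrib_left
    by (intro sum.cong) (auto simp: power_mult_distrib prod.distrib power_sum[symmetric])
qed

lemma fd_homogeneous:
  assumes "homogeneous_poly n P" shows "fd P (c *s z) v * c = c ^ n * fd P z v"
proof -
  note P = twice_holomorphic_homogeneous[OF assms]
  have "((\<lambda>z. P (c *s z)) has_derivative (\<lambda>v. fd P (c *s z) (c *s v))) (at z)"
  proof (rule has_derivative_compose[OF _ has_derivative_fd[OF P], where f = "\<lambda>z. c *s z"])
    have "linear (\<lambda>v. c *s v)" by (rule linearI) (auto simp: vec_eq_iff algebra_simps)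
    then show "((\<lambda>v. c *s v) has_derivative (\<lambda>v. c *s v)) (at z)"
      by (intro bounded_linear_imp_has_derivative) (simp add: linear_conv_bounded_linear)
  qed
  moreover have "((\<lambda>z. P (c *s z)) has_derivative (\<lambda>v. c ^ n * fd P z v)) (at z)"
    unfolding homogeneous_poly_scale[OF assms]
    by (rule has_derivative_mult_right[OF has_derivative_fd[OF P]])
  ultimately have "(\<lambda>v. fd P (c *s z) (c *s v)) = (\<lambda>v. c ^ n * fd P z v)"
    by (rule has_derivative_unique)
  from fun_cong[OF this, of v] show ?thesis by (simp add: fd_scale[OF P] mult.commute)
qed

text \<open>For \<open>c \<noteq> 0\<close> a factor \<open>c\<close> cancels. At
  \<open>c = 0\<close> the linear case rests on continuity of the derivative; in higher degree the
  derivative at the origin vanishes, as scaling by \<open>2\<close> shows.\<close>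

lemma fd_homogeneous_Suc:
  assumes "homogeneous_poly (Suc n) P" shows "fd P (c *s z) v = c ^ n * fd P z v"
proof (cases "c = 0")
  case False
  then show ?thesis using fd_homogeneous[OF assms, of c z v] by simp
next
  case True
  note P = twice_holomorphic_homogeneous[OF assms]
  show ?thesis
  proof (cases n)
    case 0
    obtain P'' where "((\<lambda>z. fd P z v) has_derivative P'' v) (at 0)"
      using second_derivative_symmetric[OF P] by metis
    then have "isCont (\<lambda>z. fd P z v) 0" by (rule has_derivative_continuous)
    moreover have "((\<lambda>t. complex_of_real t *s z) \<longlongrightarrow> complex_of_real 0 *s z) (at 0)"
      unfolding scaleR_vec_complex[symmetric] by (intro tendsto_intros)
    ultimately have "((\<lambda>t. fd P (complex_of_real t *s z) v) \<longlongrightarrow> fd P 0 v) (at (0::real))"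
      using isCont_tendsto_compose[of 0 "\<lambda>z. fd P z v"] by simp
    moreover have "eventually (\<lambda>t. fd P (complex_of_real t *s z) v = fd P z v) (at (0::real))"
      using fd_homogeneous[OF assms] 0 by (intro eventually_at_filter[THEN iffD2] always_eventually) (metis mult.commute mult_right_cancel of_real_eq_0_iff power_one_right One_nat_def)
    ultimately have "((\<lambda>t. fd P z v) \<longlongrightarrow> fd P 0 v) (at (0::real))"
      by (simp add: tendsto_cong)
    then have "fd P 0 v = fd P z v"
      by (simp add: tendsto_const_iff)
    then show ?thesis using True 0 by simp
  next
    case (Suc m)
    have "(2 ^ Suc m - 1) * fd P 0 v = 0"
      using fd_homogeneous[OF assms, of 2 0 v] Suc by (simp add: algebra_simps)
    moreover have "(2::complex) ^ Suc m \<noteq> 1"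
      using power_eq_1_iff[of "2::complex" "Suc m"] by auto
    ultimately have "fd P 0 v = 0" by auto
    then show ?thesis using True Suc by simp
  qed
qed

lemma fd_self: assumes "homogeneous_poly n P" shows "fd P z z = of_nat n * P z"
proof -
  note P = twice_holomorphic_homogeneous[OF assms]
  have "((\<lambda>t. P (of_real t *s z)) has_derivative (\<lambda>s. fd P (of_real 1 *s z) (of_real s *s z))) (at (1::real))"
    by (rule has_derivative_compose[OF _ has_derivative_fd[OF P]])
       (auto simp flip: scaleR_vec_complex intro!: derivative_eq_intros)
  moreover have "((\<lambda>t. P (of_real t *s z)) has_derivative (\<lambda>s. of_real s * (of_nat n * P z))) (at (1::real))"
    unfolding homogeneous_poly_scale[OF assms]
    by (auto intro!: derivative_eq_intros simp: algebra_simps)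
  ultimately have "fd P (of_real 1 *s z) (of_real 1 *s z) = of_real 1 * (of_nat n * P z)"
    using has_derivative_unique by (metis (no_types, lifting))
  then show ?thesis by simp
qed

text \<open>The differential of a quadratic form is its polar form: homogeneity identifies
  \<open>fd P x v\<close> with the second derivative at the origin, which is bilinear and
  symmetric.\<close>

lemma quadratic_polarization:
  assumes "homogeneous_poly 2 P"
  shows "fd P (x + y) v = fd P x v + fd P y v" "fd P (c *s x) v = c * fd P x v" "fd P x y = fd P y x"
    "fd P x x = 2 * P x"
proof -
  note P = twice_holomorphic_homogeneous[OF assms]
  have sc: "fd P (c *s x) v = c * fd P x v" for c x v
    using fd_homogeneous_Suc[of 1 P c x v] assms by (simp add: numeral_2_eq_2)
  then show "fd P (c *s x) v = c * fd P x v" .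
  show "fd P x x = 2 * P x" using fd_self[OF assms, of x] by simp
  obtain P'' where P'': "\<And>z v. ((\<lambda>z. fd P z v) has_derivative P'' z v) (at z)" "\<And>z v w. P'' z v w = P'' z w v"
    using second_derivative_symmetric[OF P] by blast
  have eq: "fd P x v = P'' 0 v x" for x v
  proof -
    have "((\<lambda>t. fd P (of_real t *s x) v) has_derivative (\<lambda>s. P'' (of_real 0 *s x) v (of_real s *s x))) (at (0::real))"
      by (rule has_derivative_compose[OF _ P''(1)])
       (auto simp flip: scaleR_vec_complex intro!: derivative_eq_intros)
    moreover have "((\<lambda>t. fd P (of_real t *s x) v) has_derivative (\<lambda>s. of_real s * fd P x v)) (at (0::real))"
      unfolding sc by (auto intro!: derivative_eq_intros)
    ultimately have "P'' (of_real 0 *s x) v (of_real 1 *s x) = of_real 1 * fd P x v"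
      using has_derivative_unique by (metis (no_types, lifting))
    then show ?thesis by simp
  qed
  have "linear (P'' 0 v)" for v using P''(1) by (rule has_derivative_linear)
  then show "fd P (x + y) v = fd P x v + fd P y v" unfolding eq by (rule linear_add)
  show "fd P x y = fd P y x" unfolding eq by (rule P''(2))
qed

lemma poly_vanish_near_0:
  fixes p :: "complex poly"
  assumes "\<And>t. norm t \<le> 1 \<Longrightarrow> poly p t = 0" shows "p = 0"
proof (rule ccontr)
  assume "p \<noteq> 0"
  then have "finite {t. poly p t = 0}" by (rule poly_roots_finite)
  then have "finite (cball (0::complex) 1)" by (rule finite_subset[rotated]) (auto intro: assms)
  moreover have "uncountable (cball (0::complex) 1)" by (simp add: uncountable_cball)
  ultimately show False using countable_finite by blast
qed

lemma pderiv_finite_sum: "pderiv (\<Sum>i\<in>I. p i) = (\<Sum>i\<in>I. pderiv (p i))"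
  by (induction I rule: infinite_finite_induct) (simp_all add: pderiv_add)

section \<open>Polynomial kernels\<close>

locale polynomial_kernel =
  fixes M :: nat and d :: "nat \<Rightarrow> nat" and G :: "nat \<Rightarrow> complex^'N \<Rightarrow> complex"
    and h :: "complex^'N \<Rightarrow> complex^'N \<Rightarrow> complex"
  assumes deg: "\<And>l. l < M \<Longrightarrow> 2 \<le> d l"
    and hom: "\<And>l. l < M \<Longrightarrow> homogeneous_poly (d l) (G l)"
    and h_eq: "\<And>z w. h z w = 1 - hip z w + (\<Sum>l<M. (-1) ^ d l * G l z * cnj (G l w))"
begin

definition Q2 :: "nat set" where "Q2 = {l. l < M \<and> d l = 2}"

lemma Q2: "finite Q2" "l \<in> Q2 \<Longrightarrow> l < M" "l \<in> Q2 \<Longrightarrow> homogeneous_poly 2 (G l)"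
  unfolding Q2_def using hom by (auto, metis)

lemma degree_Suc: assumes "l < M" obtains n where "d l = Suc (Suc n)"
  using deg[OF assms] by (metis le_Suc_ex numeral_2_eq_2 add_Suc plus_nat.add_0)

lemma G_0: assumes "l < M" shows "G l 0 = 0"
  using homogeneous_poly_scale[OF hom[OF assms], of 0 0] deg[OF assms] by (simp add: power_0_left split: if_splits)

lemma fd_0: assumes l: "l < M" shows "fd (G l) 0 u = 0"
proof -
  obtain n where n: "d l = Suc (Suc n)" using l by (rule degree_Suc)
  show ?thesis using fd_homogeneous_Suc[of "Suc n" "G l" 0 0 u] hom[OF l] n by simp
qed

lemma fd_Q2: assumes "l \<in> Q2"
  shows "fd (G l) (x + y) v = fd (G l) x v + fd (G l) y v" "fd (G l) (c *s x) v = c * fd (G l) x v"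
    "fd (G l) x x = 2 * G l x"
  using quadratic_polarization Q2(3)[OF assms] by blast+

lemma fd_Q2_sym: assumes "l \<in> Q2" shows "fd (G l) x y = fd (G l) y x"
  using quadratic_polarization(3) Q2(3)[OF assms] by blast

text \<open>For the kernel \<open>det (1 - z w\<^sup>*)\<close> on matrices this is the usual triple product \<open>(x a\<^sup>* y + y a\<^sup>* x) / 2\<close>.\<close>

definition trip :: "complex^'N \<Rightarrow> complex^'N \<Rightarrow> complex^'N \<Rightarrow> complex^'N" where
  "trip x a y = (\<chi> i. (hip x a * y $ i + hip y a * x $ i
     - (\<Sum>l\<in>Q2. fd (G l) x y * cnj (fd (G l) a (axis i 1)))) / 2)"

text \<open>The derivative of \<open>h\<close> at \<open>(z, w)\<close> in its first argument; in the second one it is \<open>cnj (hz w z u)\<close>.\<close>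

definition hz :: "complex^'N \<Rightarrow> complex^'N \<Rightarrow> complex^'N \<Rightarrow> complex" where
  "hz z w u = - hip u w + (\<Sum>l<M. (-1) ^ d l * fd (G l) z u * cnj (G l w))"

definition quad_field :: "complex^'N \<Rightarrow> complex^'N \<Rightarrow> complex^'N" where
  "quad_field a z = a - trip z a z"

lemma twice_holomorphic_G: "l < M \<Longrightarrow> twice_holomorphic (G l)"
  using hom twice_holomorphic_homogeneous by blast

lemma hip_trip: "2 * hip (trip x a y) u = hip x a * hip y u + hip y a * hip x u
     - (\<Sum>l\<in>Q2. fd (G l) x y * cnj (fd (G l) a u))"
proof -
  have "2 * hip (trip x a y) u = (\<Sum>i\<in>UNIV. hip x a * (y $ i * cnj (u $ i)) + hip y a * (x $ i * cnj (u $ i))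
     - (\<Sum>l\<in>Q2. fd (G l) x y * (cnj (u $ i) * cnj (fd (G l) a (axis i 1)))))"
    unfolding hip_def[of _ u] sum_distrib_left[of 2]
  proof (rule sum.cong[OF refl])
    fix i
    have "2 * (trip x a y $ i * cnj (u $ i)) = (hip x a * y $ i + hip y a * x $ i
     - (\<Sum>l\<in>Q2. fd (G l) x y * cnj (fd (G l) a (axis i 1)))) * cnj (u $ i)"
      by (simp add: trip_def)
    then show "2 * (trip x a y $ i * cnj (u $ i)) = hip x a * (y $ i * cnj (u $ i)) + hip y a * (x $ i * cnj (u $ i))
     - (\<Sum>l\<in>Q2. fd (G l) x y * (cnj (u $ i) * cnj (fd (G l) a (axis i 1))))"
      unfolding left_diff_distrib sum_distrib_right distrib_right by (simp add: mult_ac)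
  qed
  also have "\<dots> = hip x a * hip y u + hip y a * hip x u
     - (\<Sum>l\<in>Q2. fd (G l) x y * (\<Sum>i\<in>UNIV. cnj (u $ i) * cnj (fd (G l) a (axis i 1))))"
    unfolding sum_subtractf sum.distrib sum_distrib_left[symmetric] hip_def[symmetric]
    by (simp add: sum_distrib_left) (rule sum.swap)
  also have "(\<Sum>l\<in>Q2. fd (G l) x y * (\<Sum>i\<in>UNIV. cnj (u $ i) * cnj (fd (G l) a (axis i 1)))) =
      (\<Sum>l\<in>Q2. fd (G l) x y * cnj (fd (G l) a u))"
    using Q2(2) by (intro sum.cong) (auto simp: fd_basis[OF twice_holomorphic_G, of _ a u])
  finally show ?thesis .
qed

lemma trip_eqI: assumes "\<And>u. 2 * hip x u = 2 * hip y u" shows "x = y"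
  using assms by (intro hip_eqI) simp

lemma trip_sym: "trip x a y = trip y a x"
  by (intro trip_eqI) (simp add: hip_trip fd_Q2_sym[of _ x y] cong: sum.cong)

lemma trip_add_left: "trip (x + x') a y = trip x a y + trip x' a y"
  by (intro trip_eqI) (simp add: hip_trip hip_add_left distrib_left distrib_right sum.distrib fd_Q2 cong: sum.cong)

lemma trip_scale_left: "trip (c *s x) a y = c *s trip x a y"
  by (intro trip_eqI, unfold hip_scale_left mult.left_commute[of 2 c] hip_trip)
    (simp add: hip_scale_left sum_distrib_left algebra_simps fd_Q2 cong: sum.cong)

lemma trip_bound: obtains K where "0 < K" "\<And>x y. norm (trip x a y) \<le> norm x * norm y * K"
proof -
  have "linear (\<lambda>x. trip x a y)" for y
    by (rule linearI) (simp_all add: trip_add_left scaleR_vec_complex trip_scale_left)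
  then have "bilinear (\<lambda>x y. trip x a y)"
    unfolding bilinear_def by (simp add: trip_sym[of _ a])
  then have "bounded_bilinear (\<lambda>x y. trip x a y)" by (simp add: bilinear_conv_bounded_bilinear)
  then show ?thesis using bounded_bilinear.pos_bounded that by blast
qed

lemma trip_add_mid: "trip x (a + b) y = trip x a y + trip x b y"
  by (intro trip_eqI) (simp add: hip_trip hip_add_left hip_add_right distrib_left distrib_right sum.distrib fd_Q2 cong: sum.cong)

lemma trip_scale_mid: "trip x (c *s a) y = cnj c *s trip x a y"
  by (intro trip_eqI, unfold hip_scale_left mult.left_commute[of 2 "cnj c"] hip_trip)
    (simp add: hip_scale_right sum_distrib_left algebra_simps fd_Q2 cong: sum.cong)

lemma trip_herm: "hip (trip w a u) z = hip u (trip a w z)"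
proof -
  have c: "fd (G l) z a = fd (G l) a z" "fd (G l) u w = fd (G l) w u" if "l \<in> Q2" for l
    using Q2(3)[OF that] quadratic_polarization(3) by blast+
  have "2 * hip u (trip a w z) = cnj (2 * hip (trip a w z) u)" by (simp add: cnj_hip)
  also have "\<dots> = 2 * hip (trip w a u) z"
    unfolding hip_trip by (simp add: c cnj_hip algebra_simps cong: sum.cong)
  finally show ?thesis by simp
qed

lemma hz_add: "hz z w (u + v) = hz z w u + hz z w v"
  by (simp add: hz_def hip_add_left linear_add[OF linear_fd[OF twice_holomorphic_G]] algebra_simps sum.distrib cong: sum.cong_simp)

lemma hz_scale: "hz z w (c *s u) = c * hz z w u"
  by (simp add: hz_def hip_scale_left fd_scale[OF twice_holomorphic_G] algebra_simps sum_distrib_left cong: sum.cong_simp)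

lemma hz_diff: "hz z w (u - v) = hz z w u - hz z w v"
  using hz_add[of z w "u - v" v] by simp

lemma continuous_h: "continuous_on S (\<lambda>p. h (fst p) (snd p))"
proof -
  have "continuous_on S (\<lambda>p. G l (fst p))" "continuous_on S (\<lambda>p. G l (snd p))" if "l < M" for l
    by (rule continuous_on_compose2[OF continuous_on_twice_holomorphic[OF twice_holomorphic_G[OF that], of UNIV]];
        intro continuous_on_fst continuous_on_snd continuous_on_id subset_UNIV)+
  then show ?thesis unfolding h_eq hip_def by (intro continuous_intros) auto
qed

lemma h_cnj: "cnj (h z w) = h w z"
  by (simp add: h_eq cnj_hip mult.commute mult.left_commute)

lemma h_0 [simp]: "h 0 w = 1" "h z 0 = 1"
proof -
  have "G l 0 = 0" if "l < M" for l
    using homogeneous_poly_scale[OF hom[OF that], of 0 0] deg[OF that] by (simp add: power_0_left split: if_splits)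
  then show "h 0 w = 1" "h z 0 = 1" by (simp_all add: h_eq)
qed

end

section \<open>The Jordan triple of an infinitesimally invariant kernel\<close>

locale invariant_kernel = polynomial_kernel M d G h
  for M d and G :: "nat \<Rightarrow> complex^'N \<Rightarrow> complex" and h +
  fixes \<Omega> :: "(complex^'N) set"
  assumes open_\<Omega>: "open \<Omega>" and zero_in_\<Omega>: "0 \<in> \<Omega>"
    and star: "\<And>z w a. z \<in> \<Omega> \<Longrightarrow> w \<in> \<Omega> \<Longrightarrow> h z w \<noteq> 0 \<Longrightarrow>
      hz z w (quad_field a z) + cnj (hz w z (quad_field a w)) = - (hip z a + hip a w) * h z w"
begin

lemma small_ball:
  obtains \<epsilon> where "0 < \<epsilon>" "\<And>z. norm z < \<epsilon> \<Longrightarrow> z \<in> \<Omega>" "\<And>z w. norm z < \<epsilon> \<Longrightarrow> norm w < \<epsilon> \<Longrightarrow> h z w \<noteq> 0"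
proof -
  obtain r where r: "0 < r" "ball 0 r \<subseteq> \<Omega>" using open_\<Omega> zero_in_\<Omega> openE by blast
  have "continuous_on UNIV (\<lambda>p. h (fst p) (snd p))" by (rule continuous_h)
  then have "isCont (\<lambda>p. h (fst p) (snd p)) (0, 0)" by (simp add: continuous_on_eq_continuous_at)
  then obtain s where s: "0 < s" "\<And>p. dist p (0,0) < s \<Longrightarrow> dist (h (fst p) (snd p)) (h 0 0) < 1"
    unfolding continuous_at_eps_delta by (metis fst_conv snd_conv zero_less_one)
  have "h z w \<noteq> 0" if "norm z < s / 2" "norm w < s / 2" for z w
  proof -
    have "norm (z, w) \<le> norm z + norm w" by (rule norm_Pair_le)
    then have "dist (z, w) (0, 0) < s" using that by (simp add: dist_norm)
    from s(2)[OF this] show ?thesis by auto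
  qed
  moreover have "z \<in> \<Omega>" if "norm z < r" for z using r(2) that by auto
  ultimately show ?thesis using r(1) s(1) by (intro that[of "min r (s / 2)"]) auto
qed

text \<open>The part of \<open>star\<close> that is complex linear in \<open>a\<close>. Using
  \<open>star\<close> for \<open>\<i> *s a\<close> as well separates it from the conjugate linear
  part.\<close>

lemma star_linear:
  assumes "z \<in> \<Omega>" "w \<in> \<Omega>" "h z w \<noteq> 0"
  shows "hz z w a - cnj (hz w z (trip w a w)) = - hip a w * h z w"
proof -
  have q: "quad_field (\<i> *s a) x = \<i> *s (a + trip x a x)" for x
    by (simp add: quad_field_def trip_scale_mid vec_eq_iff algebra_simps)
  have 1: "hz z w a - hz z w (trip z a z) + cnj (hz w z a) - cnj (hz w z (trip w a w)) = - (hip z a + hip a w) * h z w"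
    using star[OF assms, of a] by (simp add: quad_field_def hz_diff add_diff_eq)
  have "\<i> * (hz z w a + hz z w (trip z a z)) - \<i> * (cnj (hz w z a) + cnj (hz w z (trip w a w)))
     = - (- \<i> * hip z a + \<i> * hip a w) * h z w"
    using star[OF assms, of "\<i> *s a"] unfolding q
    by (simp add: hz_scale hz_add hip_scale_left hip_scale_right algebra_simps)
  then have "\<i> * ((hz z w a + hz z w (trip z a z)) - (cnj (hz w z a) + cnj (hz w z (trip w a w))))
     = \<i> * ((hip z a - hip a w) * h z w)"
    by (simp add: algebra_simps)
  then have 2: "(hz z w a + hz z w (trip z a z)) - (cnj (hz w z a) + cnj (hz w z (trip w a w))) = (hip z a - hip a w) * h z w"
    by simp
  have "2 * (hz z w a - cnj (hz w z (trip w a w))) = 2 * (- hip a w * h z w)"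
    using 1 2 by algebra
  then show ?thesis by (metis mult_left_cancel zero_neq_numeral)
qed

text \<open>With \<open>t z\<close> for \<open>z\<close>, \<open>star_linear\<close> is a polynomial
  identity in \<open>t\<close>; this is its coefficient of \<open>t^2\<close>. It ties the cubic
  terms of \<open>h\<close> to the quadratic ones, from which \<open>trip\<close> is built.\<close>

lemma star_degree_2:
  assumes e: "0 < \<epsilon>" "\<And>z. norm z < \<epsilon> \<Longrightarrow> z \<in> \<Omega>" "\<And>z w. norm z < \<epsilon> \<Longrightarrow> norm w < \<epsilon> \<Longrightarrow> h z w \<noteq> 0"
    and zw: "norm z < \<epsilon>" "norm w < \<epsilon>"
  shows "(\<Sum>l\<in>{l. l < M \<and> d l = 3}. fd (G l) z a * cnj (G l w)) =
     hip a w * (\<Sum>l\<in>Q2. G l z * cnj (G l w)) - (\<Sum>l\<in>Q2. G l z * cnj (fd (G l) w (trip w a w)))"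
proof -
  let ?u = "trip w a w"
  define p where "p = [:- hip a w:] + (\<Sum>l<M. monom ((-1) ^ d l * fd (G l) z a * cnj (G l w)) (d l - 1))
     + [:0, hip z ?u:] - (\<Sum>l<M. monom ((-1) ^ d l * G l z * cnj (fd (G l) w ?u)) (d l))
     + smult (hip a w) (1 - [:0, hip z w:] + (\<Sum>l<M. monom ((-1) ^ d l * G l z * cnj (G l w)) (d l)))"
  have "poly p t = 0" if t: "norm t \<le> 1" for t
  proof -
    have "norm (t *s z) \<le> norm z"
    proof -
      have "norm (t *s z) = norm t * norm z" by (rule norm_smult)
      then show ?thesis using t by (simp add: mult_left_le_one_le)
    qed
    then have tz: "norm (t *s z) < \<epsilon>" using zw by simp
    have 1: "hz (t *s z) w a = - hip a w + (\<Sum>l<M. (-1) ^ d l * fd (G l) z a * cnj (G l w) * t ^ (d l - 1))"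
    proof -
      have "fd (G l) (t *s z) a = t ^ (d l - 1) * fd (G l) z a" if "l < M" for l
        using fd_homogeneous_Suc[of "d l - 1" "G l" t z a] hom[OF that] deg[OF that] by simp
      then show ?thesis by (simp add: hz_def algebra_simps)
    qed
    have 2: "cnj (hz w (t *s z) ?u) = - hip z ?u * t + (\<Sum>l<M. (-1) ^ d l * G l z * cnj (fd (G l) w ?u) * t ^ d l)"
      by (simp add: hz_def cnj_hip hip_scale_left homogeneous_poly_scale[OF hom] algebra_simps)
    have 3: "h (t *s z) w = 1 - hip z w * t + (\<Sum>l<M. (-1) ^ d l * G l z * cnj (G l w) * t ^ d l)"
      by (simp add: h_eq hip_scale_left homogeneous_poly_scale[OF hom] algebra_simps)
    have "hz (t *s z) w a - cnj (hz w (t *s z) ?u) = - hip a w * h (t *s z) w"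
      using star_linear e tz zw by blast
    then show ?thesis unfolding 1 2 3
      by (simp add: p_def poly_sum poly_monom algebra_simps)
  qed
  then have "p = 0" by (rule poly_vanish_near_0)
  then have "coeff p 2 = 0" by simp
  moreover have "coeff p 2 = (\<Sum>l<M. if d l = 3 then (-1) ^ d l * fd (G l) z a * cnj (G l w) else 0)
     - (\<Sum>l<M. if d l = 2 then (-1) ^ d l * G l z * cnj (fd (G l) w ?u) else 0)
     + hip a w * (\<Sum>l<M. if d l = 2 then (-1) ^ d l * G l z * cnj (G l w) else 0)"
  proof -
    have "(if d l - 1 = 2 then c else 0) = (if d l = 3 then c else (0::complex))" for l c by auto
    then show ?thesis by (simp add: p_def coeff_sum numeral_2_eq_2 cong: if_cong)
  qed
  ultimately have "- (\<Sum>l\<in>{l. l < M \<and> d l = 3}. fd (G l) z a * cnj (G l w))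
      - (\<Sum>l\<in>Q2. G l z * cnj (fd (G l) w ?u)) + hip a w * (\<Sum>l\<in>Q2. G l z * cnj (G l w)) = 0"
    by (simp add: Q2_def sum.inter_filter[symmetric] sum_negf lessThan_def[symmetric] cong: conj_cong)
  then show ?thesis by algebra
qed

lemma sum_fd_Q2: "(\<Sum>l\<in>Q2. fd (G l) x y * cnj (fd (G l) a u)) = hip x a * hip y u + hip y a * hip x u - 2 * hip (trip x a y) u"
  by (simp add: hip_trip)

text \<open>The left side of \<open>star_degree_2\<close> is a derivative in direction
  \<open>a\<close> of a function of \<open>z\<close>. Differentiating once more, in direction
  \<open>b\<close>, gives an expression \<open>E\<close> symmetric in \<open>a\<close> and
  \<open>b\<close>; rewritten with \<open>trip\<close>, this is the symmetry of
  \<open><z, {w b {w a w}}>\<close>. Scaling removes the smallness of \<open>z\<close> and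
  \<open>w\<close>.\<close>

lemma trip_quint: "trip (trip w a w) b w = trip (trip w b w) a w"
proof -
  obtain \<epsilon> where e: "0 < \<epsilon>" "\<And>z. norm z < \<epsilon> \<Longrightarrow> z \<in> \<Omega>" "\<And>z w. norm z < \<epsilon> \<Longrightarrow> norm w < \<epsilon> \<Longrightarrow> h z w \<noteq> 0"
    using small_ball by blast
  define E where "E z w a b = hip a w * (\<Sum>l\<in>Q2. fd (G l) z b * cnj (G l w))
       - (\<Sum>l\<in>Q2. fd (G l) z b * cnj (fd (G l) w (trip w a w)))" for z w a b
  have sym: "E z w a b = E z w b a" if zw: "norm z < \<epsilon>" "norm w < \<epsilon>" for z w a b
  proof -
    have "\<forall>l. \<exists>P. l < M \<longrightarrow> (\<forall>z v. ((\<lambda>z. fd (G l) z v) has_derivative P z v) (at z)) \<and> (\<forall>z v w. P z v w = P z w v)"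
      using second_derivative_symmetric[OF twice_holomorphic_G] by metis
    then obtain P where P: "\<And>l z v. l < M \<Longrightarrow> ((\<lambda>z. fd (G l) z v) has_derivative P l z v) (at z)"
      "\<And>l z v w. l < M \<Longrightarrow> P l z v w = P l z w v" by metis
    have E_P: "E z w a b = (\<Sum>l\<in>{l. l < M \<and> d l = 3}. P l z a b * cnj (G l w))" for a b
    proof -
      have "((\<lambda>z. \<Sum>l\<in>{l. l < M \<and> d l = 3}. fd (G l) z a * cnj (G l w)) has_derivative
         (\<lambda>b. \<Sum>l\<in>{l. l < M \<and> d l = 3}. P l z a b * cnj (G l w))) (at z)"
        by (intro has_derivative_sum has_derivative_mult_left P) simp
      then have "((\<lambda>z. hip a w * (\<Sum>l\<in>Q2. G l z * cnj (G l w)) - (\<Sum>l\<in>Q2. G l z * cnj (fd (G l) w (trip w a w)))) has_derivative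
         (\<lambda>b. \<Sum>l\<in>{l. l < M \<and> d l = 3}. P l z a b * cnj (G l w))) (at z)"
      proof (rule has_derivative_transform_within_open[of _ _ _ _ "ball 0 \<epsilon>"])
        fix y assume "y \<in> ball (0::complex^'N) \<epsilon>"
        then show "(\<Sum>l\<in>{l. l < M \<and> d l = 3}. fd (G l) y a * cnj (G l w)) =
            hip a w * (\<Sum>l\<in>Q2. G l y * cnj (G l w)) - (\<Sum>l\<in>Q2. G l y * cnj (fd (G l) w (trip w a w)))"
          using star_degree_2[OF e _ zw(2), of y a] by simp
      qed (use zw in auto)
      moreover have "((\<lambda>z. hip a w * (\<Sum>l\<in>Q2. G l z * cnj (G l w)) - (\<Sum>l\<in>Q2. G l z * cnj (fd (G l) w (trip w a w)))) has_derivative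
         (\<lambda>b. hip a w * (\<Sum>l\<in>Q2. fd (G l) z b * cnj (G l w)) - (\<Sum>l\<in>Q2. fd (G l) z b * cnj (fd (G l) w (trip w a w))))) (at z)"
        by (intro has_derivative_sum has_derivative_diff has_derivative_mult_left has_derivative_mult_right has_derivative_fd twice_holomorphic_G Q2(2))
      ultimately have "(\<lambda>b. E z w a b) = (\<lambda>b. \<Sum>l\<in>{l. l < M \<and> d l = 3}. P l z a b * cnj (G l w))"
        unfolding E_def by (rule has_derivative_unique[rotated])
      from fun_cong[OF this] show ?thesis .
    qed
    show ?thesis unfolding E_P using P(2)[of _ z a b] by (intro sum.cong) auto
  qed
  have E_eq: "E z w a b = hip a w * (hip z w * hip b w - hip z (trip w b w))
      - (hip z w * hip b (trip w a w) + hip b w * hip z (trip w a w) - 2 * hip z (trip w b (trip w a w)))" for z w a b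
  proof -
    have g: "fd (G l) z b * cnj (G l w) = fd (G l) z b * cnj (fd (G l) w w) / 2" if "l \<in> Q2" for l
      using fd_Q2(3)[OF that, of w] by simp
    have "(\<Sum>l\<in>Q2. fd (G l) z b * cnj (G l w)) = (\<Sum>l\<in>Q2. fd (G l) z b * cnj (fd (G l) w w)) / 2"
      by (simp add: g sum_divide_distrib cong: sum.cong)
    also have "\<dots> = hip z w * hip b w - hip (trip z w b) w" by (simp add: sum_fd_Q2)
    finally show ?thesis
      unfolding E_def sum_fd_Q2 by (simp add: trip_sym[of z w b] trip_herm)
  qed
  have swap: "hip b (trip w a w) = hip a (trip w b w)" for a b w
    by (metis trip_herm trip_sym)
  have small: "hip z (trip w b (trip w a w)) = hip z (trip w a (trip w b w))" if "norm z < \<epsilon>" "norm w < \<epsilon>" for z w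
    using sym[OF that, of a b] swap[of b w a] unfolding E_eq by algebra
  have small': "trip w b (trip w a w) = trip w a (trip w b w)" if w: "norm w < \<epsilon>" for w
  proof (rule hip_eqI)
    fix u :: "complex^'N"
    define r where "r = \<epsilon> / (norm u + 1) / 2"
    have u1: "0 < norm u + 1" by (simp add: add_nonneg_pos)
    have r: "r > 0" using e(1) u1 by (simp add: r_def)
    have "norm (r *\<^sub>R u) = \<epsilon> / 2 * (norm u / (norm u + 1))" using e(1) u1 by (simp add: r_def)
    also have "\<dots> \<le> \<epsilon> / 2 * 1" using e(1) u1 by (intro mult_left_mono) (auto simp: divide_le_eq_1)
    also have "\<dots> < \<epsilon>" using e(1) by simp
    finally have "hip (r *\<^sub>R u) (trip w b (trip w a w)) = hip (r *\<^sub>R u) (trip w a (trip w b w))"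
      using small w by blast
    then have "hip u (trip w b (trip w a w)) = hip u (trip w a (trip w b w))"
      using r by (simp add: hip_scaleR_left)
    then show "hip (trip w b (trip w a w)) u = hip (trip w a (trip w b w)) u"
      by (metis cnj_hip)
  qed
  define r where "r = complex_of_real (\<epsilon> / (norm w + 1) / 2)"
  have w1: "0 < norm w + 1" by (simp add: add_nonneg_pos)
  then have r: "r \<noteq> 0" unfolding r_def of_real_eq_0_iff using e(1) by auto
  have "norm r = \<epsilon> / (norm w + 1) / 2" unfolding r_def norm_of_real using e(1) w1 by simp
  then have "norm (r *s w) = \<epsilon> / 2 * (norm w / (norm w + 1))" by (simp add: norm_smult)
  also have "\<dots> \<le> \<epsilon> / 2 * 1" using e(1) w1 by (intro mult_left_mono) (auto simp: divide_le_eq_1)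
  also have "\<dots> < \<epsilon>" using e(1) by simp
  finally have "trip (r *s w) b (trip (r *s w) a (r *s w)) = trip (r *s w) a (trip (r *s w) b (r *s w))"
    by (rule small')
  moreover have "trip (r *s w) b (trip (r *s w) a (r *s w)) = r ^ 3 *s trip w b (trip w a w)" for a b
  proof -
    have s: "trip x a (c *s y) = c *s trip x a y" for c x a y by (metis trip_scale_left trip_sym)
    show ?thesis by (simp add: s trip_scale_left vector_smult_assoc power3_eq_cube)
  qed
  ultimately have "r ^ 3 *s trip w b (trip w a w) = r ^ 3 *s trip w a (trip w b w)" by simp
  then have "trip w b (trip w a w) = trip w a (trip w b w)" using r by (simp add: vec_eq_iff)
  then show ?thesis by (metis trip_sym)
qed

lemma jordan_triple_trip: "jordan_triple trip"
  by (rule jordan_triple.intro) (fact trip_sym trip_add_left trip_add_mid trip_scale_left trip_scale_mid trip_herm trip_quint)+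

text \<open>Along a real line spanned by \<open>v\<close> with \<open>trip v v v = x v\<close> the invariance of the kernel reads
  \<open>(1 - x s\<^sup>2) \<Phi>' = - 2 |v|\<^sup>2 s \<Phi>\<close>, and comparing leading coefficients gives \<open>x deg \<Phi> = 2 |v|\<^sup>2\<close>.\<close>

lemma trip_cube_positive:
  assumes v: "trip v v v = x *\<^sub>R v" "v \<noteq> 0" shows "0 < x"
proof -
  obtain \<epsilon> where e: "0 < \<epsilon>" "\<And>z. norm z < \<epsilon> \<Longrightarrow> z \<in> \<Omega>" "\<And>z w. norm z < \<epsilon> \<Longrightarrow> norm w < \<epsilon> \<Longrightarrow> h z w \<noteq> 0"
    using small_ball by blast
  define \<Phi> :: "real poly" where "\<Phi> = 1 - monom ((norm v)\<^sup>2) 2 + (\<Sum>l<M. monom ((-1) ^ d l * (norm (G l v))\<^sup>2) (2 * d l))"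
  have h\<Phi>: "h (s *\<^sub>R v) (s *\<^sub>R v) = of_real (poly \<Phi> s)" for s
  proof -
    have "G l (s *\<^sub>R v) * cnj (G l (s *\<^sub>R v)) = of_real ((norm (G l v))\<^sup>2 * s ^ (2 * d l))" if "l < M" for l
      using homogeneous_poly_scale[OF hom[OF that], of "of_real s" v]
      by (simp add: scaleR_vec_complex complex_norm_square power_mult_distrib flip: of_real_power)
        (simp add: complex_norm_square power_mult mult_ac power2_eq_square power_mult_distrib)
    then show ?thesis
      by (simp add: h_eq hip_scaleR_left hip_scaleR_right hip_self[of v] \<Phi>_def poly_sum poly_monom mult.assoc power2_eq_square)
  qed
  have hz\<Phi>: "2 * s * hz (s *\<^sub>R v) (s *\<^sub>R v) v = of_real (s * poly (pderiv \<Phi>) s)" for s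
  proof -
    have g: "s * (fd (G l) (s *\<^sub>R v) v * cnj (G l (s *\<^sub>R v))) = of_real (d l * (norm (G l v))\<^sup>2 * s ^ (2 * d l))" if "l < M" for l
    proof -
      have "fd (G l) (s *\<^sub>R v) v * s = of_real s ^ d l * (of_nat (d l) * G l v)"
        using fd_homogeneous[OF hom[OF that], of "of_real s" v v] fd_self[OF hom[OF that], of v] by (simp add: scaleR_vec_complex)
      moreover have "cnj (G l (s *\<^sub>R v)) = of_real s ^ d l * cnj (G l v)"
        using homogeneous_poly_scale[OF hom[OF that], of "of_real s" v] by (simp add: scaleR_vec_complex)
      ultimately have "(fd (G l) (s *\<^sub>R v) v * s) * cnj (G l (s *\<^sub>R v)) =
         of_real s ^ d l * (of_nat (d l) * G l v) * (of_real s ^ d l * cnj (G l v))" by simp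
      then have "s * (fd (G l) (s *\<^sub>R v) v * cnj (G l (s *\<^sub>R v))) =
         of_nat (d l) * (G l v * cnj (G l v)) * (of_real s ^ d l * of_real s ^ d l)" by (simp add: mult_ac)
      also have "\<dots> = of_real (d l * (norm (G l v))\<^sup>2 * s ^ (2 * d l))"
        by (simp only: complex_norm_square[symmetric] power_add[symmetric] mult_2[symmetric] of_real_mult of_real_power of_real_of_nat_eq)
      finally show ?thesis .
    qed
    have "2 * s * hz (s *\<^sub>R v) (s *\<^sub>R v) v = of_real (- 2 * s\<^sup>2 * (norm v)\<^sup>2) + (\<Sum>l<M. 2 * (-1) ^ d l * (s * (fd (G l) (s *\<^sub>R v) v * cnj (G l (s *\<^sub>R v)))))"
      by (simp add: hz_def hip_scaleR_right hip_self algebra_simps sum_distrib_left power2_eq_square)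
    also have "\<dots> = of_real (- 2 * s\<^sup>2 * (norm v)\<^sup>2) + (\<Sum>l<M. 2 * (-1) ^ d l * of_real (d l * (norm (G l v))\<^sup>2 * s ^ (2 * d l)))"
      by (simp add: g cong: sum.cong_simp)
    also have "\<dots> = of_real (s * poly (pderiv \<Phi>) s)"
    proof -
      have e: "s * poly (pderiv (monom c n)) s = n * c * s ^ n" for c n
        by (cases n) (simp_all add: pderiv_monom poly_monom)
      have "s * poly (pderiv \<Phi>) s = - (s * poly (pderiv (monom ((norm v)\<^sup>2) 2)) s)
          + (\<Sum>l<M. s * poly (pderiv (monom ((-1) ^ d l * (norm (G l v))\<^sup>2) (2 * d l))) s)"
        unfolding \<Phi>_def pderiv_add pderiv_diff pderiv_finite_sum by (simp add: poly_sum sum_distrib_left algebra_simps)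
      then have "s * poly (pderiv \<Phi>) s = - 2 * s\<^sup>2 * (norm v)\<^sup>2 + (\<Sum>l<M. 2 * (-1) ^ d l * (d l * (norm (G l v))\<^sup>2 * s ^ (2 * d l)))"
        unfolding e by (simp add: algebra_simps)
      then show ?thesis by simp
    qed
    finally show ?thesis by simp
  qed
  define p where "p = [:1, 0, - x:] * pderiv \<Phi> + smult (2 * (norm v)\<^sup>2) ([:0, 1:] * \<Phi>)"
  have p0: "poly p s = 0" if s: "0 < s" "s < \<epsilon> / norm v" for s
  proof -
    let ?z = "s *\<^sub>R v"
    have "norm ?z < \<epsilon>" using s v by (simp add: field_simps)
    then have st: "hz ?z ?z (quad_field v ?z) + cnj (hz ?z ?z (quad_field v ?z)) = - (hip ?z v + hip v ?z) * h ?z ?z"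
      using e by (intro star) auto
    have tz: "trip ?z v ?z = (s\<^sup>2 * x) *\<^sub>R v"
    proof -
      have "trip ?z v ?z = (of_real s * of_real s) *s trip v v v"
        unfolding scaleR_vec_complex by (metis trip_scale_left trip_sym vector_smult_assoc)
      also have "\<dots> = of_real (s\<^sup>2 * x) *s v"
        unfolding v(1) scaleR_vec_complex vector_smult_assoc by (simp add: power2_eq_square)
      finally show ?thesis unfolding scaleR_vec_complex[of "s\<^sup>2 * x"] .
    qed
    have "quad_field v ?z = of_real (1 - s\<^sup>2 * x) *s v"
      unfolding quad_field_def tz scaleR_vec_complex[symmetric] by (simp add: scaleR_left_diff_distrib)
    then have q: "hz ?z ?z (quad_field v ?z) = of_real (1 - s\<^sup>2 * x) * hz ?z ?z v" by (simp only: hz_scale)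
    have r: "hz ?z ?z v = of_real (poly (pderiv \<Phi>) s / 2)"
      using hz\<Phi>[of s] s(1) by (simp add: mult.commute[of _ 2])
    have "complex_of_real ((1 - s\<^sup>2 * x) * poly (pderiv \<Phi>) s) = of_real (- (2 * s * (norm v)\<^sup>2) * poly \<Phi> s)"
      using st unfolding q r h\<Phi> by (simp add: hip_scaleR_left hip_scaleR_right hip_self algebra_simps)
    then have "(1 - s\<^sup>2 * x) * poly (pderiv \<Phi>) s = - (2 * s * (norm v)\<^sup>2) * poly \<Phi> s"
      by (simp only: of_real_eq_iff)
    then show ?thesis by (simp add: p_def algebra_simps power2_eq_square)
  qed
  have "p = 0"
  proof (rule ccontr)
    assume "p \<noteq> 0"
    then have "finite {s. poly p s = 0}" by (rule poly_roots_finite)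
    moreover have "{0<..<\<epsilon> / norm v} \<subseteq> {s. poly p s = 0}" using p0 by auto
    moreover have "infinite {0<..<\<epsilon> / norm v}" using e(1) v(2) by (simp add: infinite_Ioo)
    ultimately show False using finite_subset by blast
  qed
  define n where "n = degree \<Phi>"
  have "poly \<Phi> 0 = 1" using h\<Phi>[of 0] by simp
  then have lc: "coeff \<Phi> n \<noteq> 0" unfolding n_def by (metis leading_coeff_0_iff poly_0 zero_neq_one)
  have big: "coeff \<Phi> (n + 2) = 0" by (simp add: n_def coeff_eq_0)
  have "coeff p (n + 1) = - x * n * coeff \<Phi> n + 2 * (norm v)\<^sup>2 * coeff \<Phi> n"
  proof (cases n)
    case 0
    then show ?thesis using big
      by (simp add: p_def coeff_pCons coeff_pderiv split: nat.splits)
  next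
    case (Suc m)
    then show ?thesis using big
      by (simp add: p_def coeff_pCons coeff_pderiv algebra_simps split: nat.splits)
  qed
  with \<open>p = 0\<close> have "(x * n) * coeff \<Phi> n = (2 * (norm v)\<^sup>2) * coeff \<Phi> n" by (simp add: algebra_simps)
  then have "x * n = 2 * (norm v)\<^sup>2" using lc by simp
  moreover have "0 < (norm v)\<^sup>2" using v(2) by simp
  ultimately have "0 < x * n" by linarith
  then show ?thesis by (simp add: zero_less_mult_iff)
qed

end

sublocale invariant_kernel \<subseteq> jt: positive_jordan_triple trip
  by (rule positive_jordan_triple.intro[OF jordan_triple_trip])
    (unfold_locales, rule trip_cube_positive)

section \<open>The domain as the unit ball of the spectral norm\<close>

context positive_jordan_triple begin

text \<open>If \<open>snorm z = 0\<close>, the nonnegative form of \<open>{z z _}\<close> vanishes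
  identically, and polarizing it gives \<open>{z z z} = 0\<close>, against
  \<open>cube_positive\<close> with eigenvalue \<open>0\<close>.\<close>

lemma snorm_pos: assumes "z \<noteq> 0" shows "0 < snorm z"
proof (rule ccontr)
  assume "\<not> 0 < snorm z"
  then have s: "snorm z = 0" using snorm_nonneg[of z] by linarith
  have quad: "tri z z u \<bullet> u = 0" for u
    using tri_le_snorm[of z u] tri_nonneg[of z u] s by simp
  have "tri z z z \<bullet> w = 0" for w
  proof -
    have "tri z z (z + w) \<bullet> (z + w) = 0" by (rule quad)
    moreover have "tri z z w \<bullet> z = tri z z z \<bullet> w" by (metis tri_self_adjoint inner_commute)
    ultimately show ?thesis using quad[of z] quad[of w] by (simp add: additive inner_add_left inner_add_right)
  qed
  then have "tri z z z = 0" using inner_eq_zero_iff by blast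
  then show False using cube_positive[of z 0] assms by simp
qed

lemma norm_le_snorm: obtains m where "0 < m" "\<And>z. m * norm z \<le> snorm z"
proof -
  have ne: "sphere (0::complex^'N) 1 \<noteq> {}" using axis_sphere by blast
  obtain w where w: "w \<in> sphere 0 1" "\<And>z. z \<in> sphere 0 1 \<Longrightarrow> snorm w \<le> snorm z"
    using continuous_attains_inf[OF compact_sphere ne continuous_on_snorm] by blast
  have "snorm w * norm z \<le> snorm z" for z
  proof (cases "z = 0")
    case False
    then have "snorm w \<le> snorm (z /\<^sub>R norm z)" by (intro w(2)) simp
    then show ?thesis using False by (simp add: snorm_scaleR field_simps)
  qed simp
  moreover have "0 < snorm w" using w(1) by (intro snorm_pos) auto
  ultimately show ?thesis using that by blast
qed

end

text \<open>The map \<open>g\<close> follows the quadratic field for time \<open>2 t\<close> up to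
  an error quadratic in \<open>t\<close>, uniformly on \<open>\<Omega>\<close>. Its continuity is
  there for Brouwer's theorem.\<close>

locale transvection_domain = invariant_kernel M d G h \<Omega>
  for M d and G :: "nat \<Rightarrow> complex^'N \<Rightarrow> complex" and h and \<Omega> :: "(complex^'N) set" +
  assumes connected_\<Omega>: "connected \<Omega>"
    and h_diag: "\<And>z. z \<in> \<Omega> \<Longrightarrow> h z z \<noteq> 0"
    and transvections: "\<And>a. \<exists>C \<delta>. 0 < \<delta> \<and> (\<forall>t. 0 < t \<and> t < \<delta> \<longrightarrow>
      (\<exists>g. continuous_on \<Omega> g \<and> g ` \<Omega> \<subseteq> \<Omega> \<and>
         (\<forall>z\<in>\<Omega>. norm (g z - z - (2 * t) *\<^sub>R quad_field a z) \<le> C * t\<^sup>2)))"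
begin

text \<open>If \<open>snorm\<close> reached \<open>1\<close> on \<open>\<Omega>\<close>,
  connectedness would give a point \<open>w\<close> of norm exactly \<open>1\<close>. A field that
  vanishes at \<open>w\<close> with \<open>w \<bullet> a > 0\<close> turns \<open>star\<close> at
  \<open>(w, w)\<close> into \<open>0 = - 2 (w \<bullet> a) h w w\<close>, against
  \<open>h_diag\<close>.\<close>

lemma snorm_less_1: assumes "z \<in> \<Omega>" shows "jt.snorm z < 1"
proof (rule ccontr)
  assume "\<not> jt.snorm z < 1"
  moreover have "connected (jt.snorm ` \<Omega>)"
    using connected_\<Omega> jt.continuous_on_snorm by (rule connected_continuous_image[rotated])
  moreover have "0 \<in> jt.snorm ` \<Omega>" using zero_in_\<Omega> by (metis image_eqI jt.snorm_zero)
  ultimately have "1 \<in> jt.snorm ` \<Omega>" using assms connectedD_interval[of _ 0 "jt.snorm z" 1] by auto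
  then obtain w where w: "w \<in> \<Omega>" "jt.snorm w = 1" by auto
  obtain a where a: "trip w a w = a" "0 < w \<bullet> a" by (rule jt.quadratic_field_zero[OF w(2)])
  have "quad_field a w = 0" using a(1) by (simp add: quad_field_def)
  moreover have "hz w w 0 = 0" using hz_scale[of w w 0 0] by simp
  ultimately have "(hip w a + hip a w) * h w w = 0"
    using star[OF w(1) w(1) h_diag[OF w(1)], of a] by (simp only: complex_cnj_zero add_0 mult_minus_left neg_0_equal_iff_equal)
  then have "Re (hip w a + hip a w) = 0" using h_diag[OF w(1)] by simp
  moreover have "Re (hip a w) = w \<bullet> a" by (simp add: inner_commute inner_eq_Re_hip)
  ultimately show False using a(2) by (simp add: inner_eq_Re_hip)
qed

lemma quad_field_lipschitz:
  obtains L where "0 < L" "\<And>z. norm (z - w) \<le> 1 \<Longrightarrow> norm (quad_field a z - quad_field a w) \<le> L * norm (z - w)"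
proof -
  obtain K where K: "0 < K" "\<And>x y. norm (trip x a y) \<le> norm x * norm y * K" by (rule trip_bound) blast
  have "norm (quad_field a z - quad_field a w) \<le> (K * (1 + 2 * norm w)) * norm (z - w)" if z: "norm (z - w) \<le> 1" for z
  proof -
    have "quad_field a z - quad_field a w = - (trip (z - w) a z + trip w a (z - w))"
      by (simp add: quad_field_def jt.diff)
    then have "norm (quad_field a z - quad_field a w) \<le> norm (z - w) * norm z * K + norm w * norm (z - w) * K"
      using norm_triangle_ineq[of "trip (z - w) a z" "trip w a (z - w)"] K(2)[of "z - w" z] K(2)[of w "z - w"]
      by (simp only: norm_minus_cancel)
    also have "norm (z - w) * norm z * K \<le> norm (z - w) * (1 + norm w) * K"
      using z norm_triangle_sub[of z w] K(1) by (intro mult_left_mono mult_right_mono) auto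
    finally show ?thesis by (simp add: algebra_simps)
  qed
  then show ?thesis using that[of "K * (1 + 2 * norm w)"] K(1) by (simp add: add_pos_nonneg)
qed

text \<open>A boundary point \<open>w\<close> closest to the origin is the image, under an approximate flow of a quadratic
  field through \<open>w\<close>, of an interior point; Brouwer's theorem absorbs the error.\<close>

lemma snorm_less_1_imp: assumes z0: "jt.snorm z0 < 1" shows "z0 \<in> \<Omega>"
proof (rule ccontr)
  assume nz0: "z0 \<notin> \<Omega>"
  obtain m where m: "0 < m" "\<And>z. m * norm z \<le> jt.snorm z" using jt.norm_le_snorm by blast
  define K where "K = {z. jt.snorm z \<le> jt.snorm z0} - \<Omega>"
  have "closed {z. jt.snorm z \<le> jt.snorm z0}"
    by (intro closed_Collect_le jt.continuous_on_snorm continuous_on_const)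
  then have "closed K" unfolding K_def using open_\<Omega> by (rule closed_Diff)
  moreover have "bounded K"
  proof -
    have "norm z \<le> jt.snorm z0 / m" if "z \<in> K" for z
      using m(2)[of z] that m(1) by (simp add: K_def field_simps)
    then show ?thesis by (meson boundedI)
  qed
  moreover have "K \<noteq> {}" using nz0 by (auto simp: K_def)
  ultimately obtain w where w: "w \<in> K" "\<And>z. z \<in> K \<Longrightarrow> jt.snorm w \<le> jt.snorm z"
    using continuous_attains_inf[OF _ _ jt.continuous_on_snorm] compact_eq_bounded_closed by metis
  have inside: "z \<in> \<Omega>" if "jt.snorm z < jt.snorm w" for z
    using w(2)[of z] w(1) that by (force simp: K_def)
  have w\<Omega>: "w \<notin> \<Omega>" and w1: "jt.snorm w < 1" using w(1) z0 by (auto simp: K_def)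
  define \<rho> where "\<rho> = jt.snorm w"
  have \<rho>: "0 < \<rho>" unfolding \<rho>_def using w\<Omega> zero_in_\<Omega> by (intro jt.snorm_pos) auto
  obtain a where a: "a - trip w a w = w" by (rule jt.quadratic_field_solvable[OF w1])
  then have qa: "quad_field a w = w" by (simp add: quad_field_def)
  obtain C0 \<delta> where C0: "0 < \<delta>" "\<And>t. 0 < t \<Longrightarrow> t < \<delta> \<Longrightarrow>
      (\<exists>g. continuous_on \<Omega> g \<and> g ` \<Omega> \<subseteq> \<Omega> \<and> (\<forall>z\<in>\<Omega>. norm (g z - z - (2 * t) *\<^sub>R quad_field a z) \<le> C0 * t\<^sup>2))"
    using transvections[of a] by blast
  define C where "C = max C0 0"
  have C: "0 \<le> C" "C0 \<le> C" by (auto simp: C_def)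
  obtain L where L: "0 < L" "\<And>z. norm (z - w) \<le> 1 \<Longrightarrow> norm (quad_field a z - quad_field a w) \<le> L * norm (z - w)"
    using quad_field_lipschitz[where w = w and a = a] by blast
  obtain B where B: "0 < B" "\<And>z. jt.snorm z \<le> B * norm z" using jt.snorm_le_norm by blast
  \<comment> \<open>A ball of radius \<open>c t\<close> around \<open>q\<close> keeps
    \<open>snorm\<close> below \<open>\<rho>\<close>, since \<open>q\<close> has norm
    \<open>(1 - 2 t) \<rho>\<close> and \<open>B (c t) = \<rho> t\<close>. Its points are within
    \<open>t D\<close> of \<open>w\<close>, and \<open>E\<close> collects the Lipschitz and the
    remainder constants.\<close>
  define c where "c = \<rho> / B"
  have c: "0 < c" using \<rho> B(1) by (simp add: c_def)
  define D where "D = c + 2 * norm w"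
  have D: "0 < D" using c by (simp add: D_def add_pos_nonneg)
  define E where "E = 2 * L * D + C"
  have E: "0 < E" using L(1) D C(1) by (simp add: E_def add_pos_nonneg)
  define t where "t = Min {\<delta>, 1, 1 / D, c / E} / 2"
  have t: "0 < t" "t < \<delta>" "t < 1 / 2 \<or> t = 1 / 2" "t * D \<le> 1" "t * E \<le> c"
  proof -
    have "0 < Min {\<delta>, 1, 1 / D, c / E}" using C0(1) D E c by simp
    moreover have "Min {\<delta>, 1, 1 / D, c / E} \<le> \<delta>" "Min {\<delta>, 1, 1 / D, c / E} \<le> 1"
        "Min {\<delta>, 1, 1 / D, c / E} \<le> 1 / D" "Min {\<delta>, 1, 1 / D, c / E} \<le> c / E" by auto
    ultimately have *: "0 < t" "2 * t \<le> \<delta>" "2 * t \<le> 1" "2 * t \<le> 1 / D" "2 * t \<le> c / E" by (auto simp: t_def)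
    show "0 < t" by fact
    show "t < \<delta>" using * by linarith
    show "t < 1 / 2 \<or> t = 1 / 2" using * by linarith
    have "t \<le> 1 / D" "t \<le> c / E" using * by linarith+
    then show "t * D \<le> 1" "t * E \<le> c" using D E by (simp_all add: field_simps)
  qed
  obtain g where g: "continuous_on \<Omega> g" "g ` \<Omega> \<subseteq> \<Omega>"
      "\<And>z. z \<in> \<Omega> \<Longrightarrow> norm (g z - z - (2 * t) *\<^sub>R quad_field a z) \<le> C0 * t\<^sup>2"
    using C0(2)[OF t(1,2)] by blast
  \<comment> \<open>An Euler step of length \<open>2 t\<close> backwards from \<open>w\<close>,
    where the field equals \<open>w\<close>.\<close>
  define q where "q = (1 - 2 * t) *\<^sub>R w"
  have cball: "z \<in> \<Omega>" if "z \<in> cball q (c * t)" for z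
  proof (rule inside)
    have "jt.snorm z \<le> jt.snorm q + jt.snorm (z - q)" using jt.snorm_triangle[of q "z - q"] by simp
    also have "jt.snorm q = (1 - 2 * t) * \<rho>" using t(3) by (auto simp: q_def jt.snorm_scaleR \<rho>_def)
    also have "jt.snorm (z - q) \<le> B * (c * t)"
    proof (rule order_trans[OF B(2)])
      show "B * norm (z - q) \<le> B * (c * t)"
        using B(1) that by (intro mult_left_mono) (auto simp: dist_norm norm_minus_commute)
    qed
    also have "B * (c * t) = \<rho> * t" using B(1) by (simp add: c_def)
    also have "(1 - 2 * t) * \<rho> + \<rho> * t < \<rho>" using \<rho> t(1) by (simp add: algebra_simps)
    finally show "jt.snorm z < jt.snorm w" by (simp add: \<rho>_def)
  qed
  \<comment> \<open>A fixed point of \<open>\<phi>\<close> is a point that \<open>g\<close> maps to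
    \<open>w\<close>.\<close>
  define \<phi> where "\<phi> z = w - (g z - z)" for z
  have cont: "continuous_on (cball q (c * t)) \<phi>"
    unfolding \<phi>_def using cball by (intro continuous_intros continuous_on_subset[OF g(1)]) auto
  have maps: "\<phi> z \<in> cball q (c * t)" if z: "z \<in> cball q (c * t)" for z
  proof -
    have zw: "norm (z - w) \<le> t * D"
    proof -
      have "norm (z - w) \<le> norm (z - q) + norm (q - w)" using norm_triangle_ineq[of "z - q" "q - w"] by simp
      also have "norm (z - q) \<le> c * t" using z by (simp add: dist_norm norm_minus_commute)
      also have "q - w = (- 2 * t) *\<^sub>R w" by (simp add: q_def algebra_simps)
      finally show ?thesis using t(1) by (simp add: D_def algebra_simps)
    qed
    have "\<phi> z - q = (2 * t) *\<^sub>R (quad_field a w - quad_field a z) - (g z - z - (2 * t) *\<^sub>R quad_field a z)"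
      unfolding qa by (simp add: \<phi>_def q_def algebra_simps)
    then have "norm (\<phi> z - q) \<le> 2 * t * norm (quad_field a w - quad_field a z) + norm (g z - z - (2 * t) *\<^sub>R quad_field a z)"
      using norm_triangle_ineq4[of "(2 * t) *\<^sub>R (quad_field a w - quad_field a z)"] t(1) by simp
    also have "\<dots> \<le> 2 * t * (L * (t * D)) + C * t\<^sup>2"
    proof (intro add_mono mult_left_mono)
      have "norm (quad_field a w - quad_field a z) \<le> L * norm (z - w)"
        using L(2)[of z] zw t(4) by (simp add: norm_minus_commute)
      also have "\<dots> \<le> L * (t * D)" using zw L(1) by (intro mult_left_mono) auto
      finally show "norm (quad_field a w - quad_field a z) \<le> L * (t * D)" .
      show "norm (g z - z - (2 * t) *\<^sub>R quad_field a z) \<le> C * t\<^sup>2"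
        using g(3)[OF cball[OF z]] mult_right_mono[OF C(2), of "t\<^sup>2"] by simp
    qed (use t in auto)
    also have "\<dots> = t * (t * E)"
      by (simp add: E_def algebra_simps power2_eq_square)
    also have "\<dots> \<le> t * c" using t by (intro mult_left_mono) auto
    finally show ?thesis by (simp add: dist_norm norm_minus_commute mult.commute)
  qed
  obtain z where z: "z \<in> cball q (c * t)" "\<phi> z = z"
    by (rule brouwer_ball[OF _ cont]) (use maps c t(1) in auto)
  then have "g z = w" by (simp add: \<phi>_def)
  then show False using g(2) cball[OF z(1)] w\<Omega> by blast
qed

lemma convex_\<Omega>: "convex \<Omega>"
proof (rule convexI)
  fix x y and u v :: real assume *: "x \<in> \<Omega>" "y \<in> \<Omega>" "0 \<le> u" "0 \<le> v" "u + v = 1"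
  have "jt.snorm (u *\<^sub>R x + v *\<^sub>R y) \<le> u * jt.snorm x + v * jt.snorm y"
    using jt.snorm_triangle[of "u *\<^sub>R x" "v *\<^sub>R y"] * by (simp add: jt.snorm_scaleR)
  also have "\<dots> < 1"
    by (rule convex_bound_lt) (use * snorm_less_1 in auto)
  finally show "u *\<^sub>R x + v *\<^sub>R y \<in> \<Omega>" by (rule snorm_less_1_imp)
qed

lemma balanced_\<Omega>: "balanced \<Omega>"
  unfolding balanced_def
proof (intro ballI allI impI)
  fix z and c :: complex assume "z \<in> \<Omega>" "norm c \<le> 1"
  then have "jt.snorm (c *s z) < 1"
    using snorm_less_1[of z] by (simp add: jt.snorm_scale) (meson jt.snorm_nonneg mult_left_le_one_le norm_ge_zero order_le_less_trans)
  then show "c *s z \<in> \<Omega>" by (rule snorm_less_1_imp)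
qed

end

section \<open>The real Jacobian of a complex linear map\<close>

text \<open>The library has determinants and the change of variables formula only on \<open>real^'n\<close>; the type
  \<open>'a bit0\<close> has twice as many elements as \<open>'a\<close>.\<close>

definition coord :: "'a::finite bit0 \<Rightarrow> complex^'a" where
  "coord = (SOME \<beta>. bij_betw \<beta> UNIV Basis)"

lemma bij_coord: "bij_betw (coord :: 'a::finite bit0 \<Rightarrow> complex^'a) UNIV Basis"
proof -
  have "card (UNIV :: 'a bit0 set) = card (Basis :: (complex^'a) set)" by simp
  then have "\<exists>\<beta> :: 'a bit0 \<Rightarrow> complex^'a. bij_betw \<beta> UNIV Basis"
    using finite_same_card_bij[of "UNIV :: 'a bit0 set" "Basis :: (complex^'a) set"] by auto
  then show ?thesis unfolding coord_def by (rule someI_ex)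
qed

definition to_real :: "complex^'a \<Rightarrow> real^('a bit0)" where
  "to_real x = (\<chi> i. x \<bullet> coord i)"

definition from_real :: "real^('a bit0) \<Rightarrow> complex^'a" where
  "from_real y = (\<Sum>i\<in>UNIV. y $ i *\<^sub>R coord i)"

lemma coord_Basis: "coord i \<in> Basis"
  using bij_coord by (auto simp: bij_betw_def)

lemma inner_coord: "coord i \<bullet> coord j = (if i = j then 1 else 0)"
proof -
  have "coord i = coord j \<longleftrightarrow> i = j" using bij_coord by (auto simp: bij_betw_def inj_on_def)
  then show ?thesis using inner_Basis[OF coord_Basis coord_Basis, of i j] by auto
qed

lemma from_to_real [simp]: "from_real (to_real x) = x"
proof -
  have "from_real (to_real x) = (\<Sum>b\<in>Basis. (x \<bullet> b) *\<^sub>R b)"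
    unfolding from_real_def to_real_def using sum.reindex_bij_betw[OF bij_coord, of "\<lambda>b. (x \<bullet> b) *\<^sub>R b"] by simp
  then show ?thesis by (simp add: euclidean_representation)
qed

lemma to_from_real [simp]: "to_real (from_real y) = y"
  by (simp add: to_real_def from_real_def vec_eq_iff inner_sum_left inner_coord if_distrib cong: if_cong)

lemma linear_to_real: "linear to_real"
  by (rule linearI) (simp_all add: to_real_def vec_eq_iff inner_add_left)

lemma linear_from_real: "linear from_real"
  by (rule linearI) (simp_all add: from_real_def scaleR_add_left sum.distrib scaleR_sum_right)

lemma inner_to_real: "to_real x \<bullet> to_real y = x \<bullet> y"
proof -
  have "to_real x \<bullet> to_real y = (\<Sum>b\<in>Basis. (x \<bullet> b) * (y \<bullet> b))"
    unfolding to_real_def inner_vec_def[of "\<chi> i. x \<bullet> coord i"]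
    using sum.reindex_bij_betw[OF bij_coord, of "\<lambda>b. (x \<bullet> b) * (y \<bullet> b)"] by simp
  also have "\<dots> = x \<bullet> y" by (rule euclidean_inner[symmetric])
  finally show ?thesis .
qed

lemma inner_from_real: "from_real x \<bullet> from_real y = x \<bullet> y"
  by (metis inner_to_real to_from_real)

definition rdet :: "(complex^'a \<Rightarrow> complex^'a) \<Rightarrow> real" where
  "rdet L = det (matrix (to_real \<circ> L \<circ> from_real))"

lemma linear_realify: assumes "linear L" shows "linear (to_real \<circ> L \<circ> from_real)"
  by (rule linear_compose[OF linear_from_real linear_compose[OF assms linear_to_real], unfolded comp_assoc[symmetric]])

lemma rdet_compose: assumes "linear L" "linear K" shows "rdet (L \<circ> K) = rdet L * rdet K"
proof -
  have "to_real \<circ> (L \<circ> K) \<circ> from_real = (to_real \<circ> L \<circ> from_real) \<circ> (to_real \<circ> K \<circ> from_real)"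
    by (simp add: fun_eq_iff)
  then show ?thesis unfolding rdet_def
    by (simp only: matrix_compose[OF linear_realify[OF assms(2)] linear_realify[OF assms(1)]] det_mul)
qed

lemma rdet_id: "rdet id = 1"
proof -
  have "to_real \<circ> id \<circ> from_real = (id :: real^('a bit0) \<Rightarrow> real^('a bit0))" by (simp add: fun_eq_iff)
  then show ?thesis unfolding rdet_def by (metis det_I matrix_id_mat_1)
qed

lemma rdet_eq_0: assumes "linear L" "L x = 0" "x \<noteq> 0" shows "rdet L = 0"
proof -
  let ?K = "to_real \<circ> L \<circ> from_real"
  have lin: "linear ?K" using assms(1) by (rule linear_realify)
  have "matrix ?K *v to_real x = 0"
    unfolding fun_cong[OF matrix_vector_mul(2)[OF lin]] using assms(2) by (simp add: linear_0[OF linear_to_real])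
  moreover have "to_real x \<noteq> 0" using assms(3) by (metis from_to_real linear_0 linear_from_real)
  ultimately have "\<not> invertible (matrix ?K)"
    by (metis invertible_def matrix_vector_mul_assoc matrix_vector_mul_lid matrix_vector_mult_0_right)
  then show ?thesis by (simp add: rdet_def invertible_det_nz)
qed

lemma rdet_isometry: assumes "linear L" "\<And>x. norm (L x) = norm x" shows "\<bar>rdet L\<bar> = 1"
proof -
  let ?K = "to_real \<circ> L \<circ> from_real"
  have lin: "linear ?K" using assms(1) by (rule linear_realify)
  have "norm (?K x) = norm x" for x
    using assms(2) by (simp add: norm_eq_sqrt_inner inner_to_real inner_from_real)
  with lin have "orthogonal_transformation ?K" by (simp add: orthogonal_transformation)
  then show ?thesis unfolding rdet_def by (rule orthogonal_transformation_det)
qed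

text \<open>Named because it passes to products and cancels from them, which is all that Gaussian
  elimination asks for.\<close>

definition det_property :: "complex^'a^'a \<Rightarrow> bool" where
  "det_property A \<longleftrightarrow> \<bar>rdet ((*v) A)\<bar> = (norm (det A))\<^sup>2"

lemma linear_matrix_vector: "linear ((*v) (A :: complex^'a^'b))"
  by simp

lemma det_property_mult: "det_property A \<Longrightarrow> det_property B \<Longrightarrow> det_property (A ** B)"
proof -
  assume *: "det_property A" "det_property B"
  have "(*v) (A ** B) = (*v) A \<circ> (*v) B" by (simp add: fun_eq_iff matrix_vector_mul_assoc)
  then show "det_property (A ** B)"
    using * by (simp add: det_property_def rdet_compose det_mul abs_mult norm_mult power_mult_distrib)
qed

lemma det_property_cancel: assumes "det_property E" "det_property (E ** A)" "det E \<noteq> 0" shows "det_property A"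
proof -
  have "(*v) (E ** A) = (*v) E \<circ> (*v) A" by (simp add: fun_eq_iff matrix_vector_mul_assoc)
  then have "(norm (det E))\<^sup>2 * \<bar>rdet ((*v) A)\<bar> = (norm (det E))\<^sup>2 * (norm (det A))\<^sup>2"
    using assms by (simp add: det_property_def rdet_compose det_mul abs_mult norm_mult power_mult_distrib)
  then show ?thesis using assms(3) by (simp add: det_property_def)
qed

lemma det_property_mat_1: "det_property (mat 1)"
proof -
  have "(*v) (mat 1) = (id :: complex^'a \<Rightarrow> _)" by (simp add: fun_eq_iff)
  then show ?thesis by (simp add: det_property_def rdet_id)
qed

lemma det_property_involution: assumes "A ** A = mat 1" shows "det_property A" "det A \<noteq> 0"
proof -
  have "det A * det A = 1" by (metis assms det_I det_mul)
  then have "norm (det A) * norm (det A) = 1" by (metis norm_mult norm_one)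
  then have 1: "(norm (det A))\<^sup>2 = 1" by (simp add: power2_eq_square)
  then show "det A \<noteq> 0" by auto
  have "(*v) A \<circ> (*v) A = id" by (simp add: fun_eq_iff matrix_vector_mul_assoc assms)
  then have "rdet ((*v) A) * rdet ((*v) A) = 1" using rdet_compose[OF linear_matrix_vector linear_matrix_vector, of A A] by (simp add: rdet_id)
  then have "\<bar>rdet ((*v) A)\<bar> = 1" by (metis abs_mult_self_eq abs_1 abs_square_eq_1 power2_eq_square)
  with 1 show "det_property A" by (simp add: det_property_def)
qed

text \<open>A shear is conjugate to its inverse, hence both of its determinants have square \<open>1\<close>.\<close>

lemma det_property_conjugate_inverse:
  assumes "D ** D = mat 1" "(D ** S) ** (D ** S) = mat 1" shows "det_property S" "det S \<noteq> 0"
proof -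
  note D = det_property_involution[OF assms(1)] and DS = det_property_involution[OF assms(2)]
  show "det_property S" by (rule det_property_cancel[OF D(1) DS(1) D(2)])
  show "det S \<noteq> 0" using DS(2) by (simp add: det_mul)
qed

definition scale_coordinate :: "'a \<Rightarrow> complex \<Rightarrow> complex^'a^'a" where
  "scale_coordinate k c = (\<chi> i j. if i = j then if i = k then c else 1 else 0)"

lemma scale_coordinate_mv: "scale_coordinate k c *v x = (\<chi> i. if i = k then c * x $ i else x $ i)"
  by (simp add: scale_coordinate_def matrix_vector_mult_def vec_eq_iff if_distrib[of "\<lambda>a. a * b" for b] cong: if_cong)

lemma det_scale_coordinate: "det (scale_coordinate k c) = c"
  by (subst det_diagonal) (simp_all add: scale_coordinate_def)

lemma matrix_eq_mvI: "(\<And>x. A *v x = B *v x) \<Longrightarrow> A = (B :: complex^'a^'b)"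
  by (simp add: matrix_eq)

text \<open>Polar decomposition of \<open>c\<close>: the factor of modulus \<open>1\<close> gives an
  isometry, while the positive factor \<open>r\<close> is diagonal in the real basis and scales
  exactly the two vectors of coordinate \<open>k\<close>, whence \<open>r^2\<close>.\<close>

lemma det_property_scale_coordinate:
  fixes k :: "'a::finite" assumes "c \<noteq> 0" shows "det_property (scale_coordinate k c)"
proof -
  define r where "r = norm c"
  have r: "r > 0" using assms by (simp add: r_def)
  define u where "u = c / of_real r"
  have u: "norm u = 1" using r by (simp add: u_def r_def norm_divide)
  have 1: "det_property (scale_coordinate k u)"
  proof -
    have "norm (scale_coordinate k u *v x) = norm x" for x :: "complex^'a"
      unfolding scale_coordinate_mv norm_vec_def L2_set_def
      by (intro arg_cong[of _ _ sqrt] sum.cong) (simp_all add: norm_mult u)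
    then have "\<bar>rdet ((*v) (scale_coordinate k u))\<bar> = 1" by (intro rdet_isometry linear_matrix_vector)
    then show ?thesis by (simp add: det_property_def det_scale_coordinate u)
  qed
  have 2: "det_property (scale_coordinate k (of_real r))"
  proof -
    let ?L = "(*v) (scale_coordinate k (of_real r))" let ?K = "to_real \<circ> ?L \<circ> from_real"
    let ?S = "{axis k 1, axis k \<i>} :: (complex^'a) set"
    have Lb: "?L b = (if b \<in> ?S then r else 1) *\<^sub>R b" if b_Basis: "b \<in> Basis" for b
    proof -
      obtain j w where b: "b = axis j w" "w \<in> {1, \<i>}" using b_Basis unfolding Basis_vec_def Basis_complex_def by blast
      have "b \<in> ?S \<longleftrightarrow> j = k" using b by (auto simp: axis_eq_axis)
      then show ?thesis unfolding scale_coordinate_mv unfolding b(1) vec_eq_iff vector_scaleR_component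
        by (auto simp: axis_def scaleR_conv_of_real[of r "_ :: complex"])
    qed
    have entry: "matrix ?K $ i $ j = (if i = j then if coord i \<in> ?S then r else 1 else 0)" for i j
    proof -
      have "matrix ?K $ i $ j = ?L (from_real (axis j 1)) \<bullet> coord i" by (simp add: matrix_def to_real_def)
      also have "from_real (axis j 1) = (coord j :: complex^'a)"
        by (simp add: from_real_def axis_def if_distrib[of "\<lambda>a. a *\<^sub>R b" for b] cong: if_cong)
      also have "?L (coord j) \<bullet> coord i = (if coord j \<in> ?S then r else 1) * (coord j \<bullet> coord i)"
        by (simp add: Lb[OF coord_Basis])
      finally have *: "matrix ?K $ i $ j = (if coord j \<in> ?S then r else 1) * (coord j \<bullet> coord i)" .
      show ?thesis unfolding * inner_coord by auto
    qed
    have "rdet ?L = (\<Prod>i\<in>UNIV. if coord i \<in> ?S then r else 1)"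
      unfolding rdet_def by (subst det_diagonal) (simp_all add: entry)
    also have "\<dots> = (\<Prod>b\<in>Basis. if b \<in> ?S then r else 1)"
      using prod.reindex_bij_betw[OF bij_coord, of "\<lambda>b. if b \<in> ?S then r else 1"] by simp
    also have "\<dots> = (\<Prod>b\<in>?S. r)"
    proof -
      have "?S \<subseteq> Basis" by (auto simp: Basis_vec_def Basis_complex_def)
      then have "Basis \<inter> {b. b \<in> ?S} = ?S" by blast
      then show ?thesis by (simp add: prod.If_cases)
    qed
    also have "\<dots> = r\<^sup>2" by (simp add: axis_eq_axis power2_eq_square)
    finally show ?thesis using r by (simp add: det_property_def det_scale_coordinate)
  qed
  have "scale_coordinate k (of_real r) ** scale_coordinate k u = scale_coordinate k c"
    by (rule matrix_eq_mvI) (use r in \<open>simp add: matrix_vector_mul_assoc[symmetric] scale_coordinate_mv vec_eq_iff u_def\<close>)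
  then show ?thesis using det_property_mult[OF 2 1] by simp
qed

lemma axis_sum_decomposition: "(\<Sum>j\<in>UNIV. w $ j *s axis j 1) = (w :: complex^'a)"
  by (rule basis_expansion)

text \<open>Gaussian elimination: permutations, shears and coordinate scalings have
  \<open>det_property\<close>, and they reduce an invertible matrix to the identity.
  \<open>K\<close> is the set of columns already reduced to unit vectors. For singular
  \<open>A\<close> a kernel vector makes both sides zero.\<close>

theorem abs_rdet: "\<bar>rdet ((*v) A)\<bar> = (norm (det (A :: complex^'a^'a)))\<^sup>2"
proof (cases "det A = 0")
  case True
  then have "\<not> inj ((*v) A)" by (simp add: det_nz_iff_inj_gen[symmetric] del: det_nz_iff_inj)
  then obtain x where "A *v x = 0" "x \<noteq> 0"
    by (metis matrix_left_invertible_ker matrix_left_invertible_injective)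
  then show ?thesis using True rdet_eq_0[OF linear_matrix_vector] by simp
next
  case False
  have "\<exists>E. det_property E \<and> det E \<noteq> 0 \<and> (\<forall>j\<in>K. (E ** A) *v axis j 1 = axis j 1)" for K :: "'a set"
    using finite[of K]
  proof (induction K)
    case empty
    show ?case using det_property_mat_1 by (intro exI[of _ "mat 1"]) simp
  next
    case (insert k K)
    then obtain E where E: "det_property E" "det E \<noteq> 0" "\<And>j. j \<in> K \<Longrightarrow> (E ** A) *v axis j 1 = axis j 1" by blast
    define w where "w = (E ** A) *v axis k 1"
    \<comment> \<open>The pivot: otherwise the new column would be a combination of unit vectors
      that \<open>E ** A\<close> fixes, and \<open>E ** A\<close> would not be injective.\<close>
    have "\<exists>i. i \<notin> K \<and> w $ i \<noteq> 0"
    proof (rule ccontr)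
      assume *: "\<not> (\<exists>i. i \<notin> K \<and> w $ i \<noteq> 0)"
      then have 0: "w $ j = 0" if "j \<notin> K" for j using that by blast
      define v where "v = (\<Sum>j\<in>K. w $ j *s axis j 1)"
      have "w = v" unfolding v_def using 0
        by (subst axis_sum_decomposition[symmetric], intro sum.mono_neutral_right) auto
      moreover have "(E ** A) *v v = v"
        unfolding v_def vec.linear_sum[OF matrix_vector_mul_linear_gen] vec.linear_scale[OF matrix_vector_mul_linear_gen]
        by (intro sum.cong) (simp_all add: E(3))
      ultimately have "(E ** A) *v (axis k 1 - v) = 0" by (simp add: w_def matrix_vector_mult_diff_distrib)
      moreover have "det (E ** A) \<noteq> 0" using E(2) False by (simp add: det_mul)
      ultimately have "axis k 1 - v = 0"
        by (metis invertible_det_nz invertible_def matrix_vector_mul_assoc matrix_vector_mul_lid matrix_vector_mult_0_right)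
      then have "(axis k 1 - v) $ k = 0" by simp
      moreover have "v $ k = 0" using insert(2) by (auto simp: v_def axis_def intro!: sum.neutral)
      ultimately show False by (simp add: axis_def)
    qed
    then obtain i where i: "i \<notin> K" "w $ i \<noteq> 0" by blast
    define P :: "complex^'a^'a" where "P = (\<chi> a b. if b = Transposition.transpose i k a then 1 else 0)"
    have Pv: "P *v x = (\<chi> a. x $ Transposition.transpose i k a)" for x
      by (simp add: P_def matrix_vector_mult_def vec_eq_iff if_distrib[of "\<lambda>a. a * b" for b] cong: if_cong)
    have "P ** P = mat 1" by (rule matrix_eq_mvI) (simp add: matrix_vector_mul_assoc[symmetric] Pv vec_eq_iff)
    note P = det_property_involution[OF this]
    \<comment> \<open>\<open>c\<close> clears the entries of the permuted column outside position
      \<open>k\<close>, where the pivot has been scaled to \<open>1\<close> by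
      \<open>d\<close>.\<close>
    define c where "c a = (if a = k then 0 else - (P *v w) $ a)" for a
    define S :: "complex^'a^'a" where "S = (\<chi> a b. if b = a then 1 else if b = k then c a else 0)"
    have Sv: "S *v x = (\<chi> a. x $ a + c a * x $ k)" for x
    proof -
      have "(S *v x) $ a = x $ a + c a * x $ k" for a
      proof -
        have "(S *v x) $ a = (\<Sum>b\<in>UNIV. (if b = a then x $ b else 0) + (if b = k then c a * x $ b else 0))"
          unfolding matrix_vector_mult_def S_def by (auto intro!: sum.cong simp: c_def)
        then show ?thesis by (simp add: sum.distrib)
      qed
      then show ?thesis by (simp add: vec_eq_iff)
    qed
    define D :: "complex^'a^'a" where "D = scale_coordinate k (-1)"
    have DD: "D ** D = mat 1"
      by (rule matrix_eq_mvI) (simp add: matrix_vector_mul_assoc[symmetric] D_def scale_coordinate_mv vec_eq_iff)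
    have "(D ** S) ** (D ** S) = mat 1"
      by (rule matrix_eq_mvI) (simp add: matrix_vector_mul_assoc[symmetric] D_def scale_coordinate_mv Sv vec_eq_iff c_def)
    note S = det_property_conjugate_inverse[OF DD this]
    define d where "d = inverse (w $ i)"
    have d: "d \<noteq> 0" using i(2) by (simp add: d_def)
    define F where "F = (S ** scale_coordinate k d) ** P"
    have Fv: "F *v x = S *v (scale_coordinate k d *v (P *v x))" for x
      by (simp add: F_def matrix_vector_mul_assoc matrix_mul_assoc)
    have "det_property F" unfolding F_def
      by (intro det_property_mult S P det_property_scale_coordinate d)
    moreover have "det F \<noteq> 0" unfolding F_def using S P d by (simp add: det_mul det_scale_coordinate)
    moreover have "F *v axis j 1 = axis j 1" if "j \<in> K" for j
    proof -
      have jk: "j \<noteq> k" "j \<noteq> i" using that insert(2) i(1) by auto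
      then have "P *v axis j 1 = axis j 1"
        unfolding Pv by (auto simp: vec_eq_iff axis_def Transposition.transpose_def)
      moreover have "scale_coordinate k d *v axis j 1 = axis j 1"
        unfolding scale_coordinate_mv using jk by (auto simp: vec_eq_iff axis_def)
      moreover have "S *v axis j 1 = axis j 1" unfolding Sv using jk by (auto simp: vec_eq_iff axis_def)
      ultimately show ?thesis by (simp add: Fv)
    qed
    moreover have "F *v w = axis k 1"
    proof -
      have "(P *v w) $ k = w $ i" by (simp add: Pv)
      then show ?thesis unfolding Fv scale_coordinate_mv Sv using i(2)
        by (auto simp: vec_eq_iff axis_def c_def d_def)
    qed
    ultimately show ?case
      using E det_property_mult[of F E]
      by (intro exI[of _ "F ** E"]) (auto simp: det_mul matrix_mul_assoc[symmetric] w_def simp flip: matrix_vector_mul_assoc)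
  qed
  then obtain E where E: "det_property E" "det E \<noteq> 0" "\<And>j. (E ** A) *v axis j 1 = axis j 1" by blast
  have "(E ** A) $ i $ j = axis j 1 $ i" for i j
    using arg_cong[OF E(3)[of j], of "\<lambda>v. v $ i"] unfolding matrix_vector_mult_def[of "E ** A"]
    by (simp add: axis_def[of j] if_distrib[of "\<lambda>a. b * a" for b] cong: if_cong)
  then have "E ** A = mat 1" by (simp add: vec_eq_iff mat_def axis_def eq_commute)
  then have "det_property (E ** A)" by (simp only: det_property_mat_1)
  then have "det_property A" by (rule det_property_cancel[OF E(1) _ E(2)])
  then show ?thesis by (simp add: det_property_def)
qed

section \<open>Change of variables for holomorphic maps\<close>

lemma continuous_on_to_real: "continuous_on S to_real"
  by (rule linear_continuous_on) (simp add: linear_to_real linear_conv_bounded_linear[symmetric])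

lemma continuous_on_from_real: "continuous_on S from_real"
  by (rule linear_continuous_on) (simp add: linear_from_real linear_conv_bounded_linear[symmetric])

text \<open>\<open>to_real\<close> carries the real basis to the standard basis, hence boxes to
  boxes of the same volume, and these determine Lebesgue measure.\<close>

lemma lborel_to_real: "lborel = distr lborel borel (to_real :: complex^'a \<Rightarrow> real^('a bit0))"
proof (rule lborel_eqI)
  fix l u :: "real^('a bit0)"
  assume le: "\<And>b. b \<in> Basis \<Longrightarrow> l \<bullet> b \<le> u \<bullet> b"
  have fr: "from_real y \<bullet> coord i = y $ i" for y :: "real^('a bit0)" and i
    by (metis to_from_real to_real_def vec_lambda_beta)
  have B: "(Basis :: (complex^'a) set) = range coord" using bij_coord by (auto simp: bij_betw_def)
  have "to_real -` box l u = box (from_real l :: complex^'a) (from_real u)"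
    by (auto simp: mem_box_cart mem_box B fr to_real_def)
  moreover have "to_real \<in> (borel :: (complex^'a) measure) \<rightarrow>\<^sub>M borel"
    by (rule borel_measurable_continuous_onI[OF continuous_on_to_real])
  ultimately have "emeasure (distr lborel borel to_real) (box l u) = emeasure lborel (box (from_real l :: complex^'a) (from_real u))"
    by (simp add: emeasure_distr)
  also have "\<dots> = (\<Prod>b\<in>Basis. (from_real u - from_real l :: complex^'a) \<bullet> b)"
  proof (rule emeasure_lborel_box)
    fix b :: "complex^'a" assume "b \<in> Basis"
    then obtain i where "b = coord i" using B by blast
    then show "from_real l \<bullet> b \<le> from_real u \<bullet> b"
      using le[of "axis i 1"] by (simp add: fr inner_axis)
  qed
  also have "\<dots> = (\<Prod>i\<in>UNIV. u $ i - l $ i)"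
    by (simp add: prod.reindex_bij_betw[OF bij_coord, symmetric] inner_diff_left fr)
  also have "\<dots> = (\<Prod>b\<in>Basis. (u - l) \<bullet> b)"
  proof -
    have B': "(Basis :: (real^('a bit0)) set) = range (\<lambda>i. axis i 1)" "inj (\<lambda>i. axis i 1 :: real^('a bit0))"
      by (auto simp: Basis_vec_def inj_on_def axis_eq_axis)
    have "(\<Prod>b\<in>Basis. (u - l) \<bullet> b) = (\<Prod>i\<in>UNIV. (u - l) \<bullet> axis i 1)"
      unfolding B'(1) using prod.reindex[OF B'(2), of "\<lambda>b. (u - l) \<bullet> b"] by (simp only: o_def)
    then show ?thesis by (simp add: inner_axis)
  qed
  finally show "emeasure (distr lborel borel to_real) (box l u) = (\<Prod>b\<in>Basis. (u - l) \<bullet> b)" .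
qed simp

text \<open>Bridge between the Bochner integral used for Bergman spaces and the Henstock-Kurzweil
  integral in which the change of variables theorem is stated.\<close>

lemma integral_to_real:
  fixes f :: "complex^'a \<Rightarrow> real"
  assumes U: "U \<in> sets borel" and f: "(\<lambda>z. indicator U z *\<^sub>R f z) \<in> borel_measurable borel"
  shows "set_integrable lborel U f \<longleftrightarrow> (f \<circ> from_real) absolutely_integrable_on (to_real ` U)" (is ?A)
    and "set_integrable lborel U f \<Longrightarrow> (LINT z:U|lborel. f z) = integral (to_real ` U) (f \<circ> from_real)"
proof -
  let ?g = "\<lambda>z. indicator U z *\<^sub>R f z" and ?F = "\<lambda>x. indicator (to_real ` U) x *\<^sub>R (f \<circ> from_real) x"
  have gF: "?F (to_real z) = ?g z" for z
  proof -
    have "to_real z \<in> to_real ` U \<longleftrightarrow> z \<in> U" by (metis from_to_real image_iff)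
    then show ?thesis by (simp add: indicator_def)
  qed
  have F: "?F = ?g \<circ> from_real"
  proof (rule ext)
    fix x show "?F x = (?g \<circ> from_real) x" using gF[of "from_real x"] unfolding to_from_real o_apply .
  qed
  have mfr: "from_real \<in> borel \<rightarrow>\<^sub>M (borel :: (complex^'a) measure)"
    by (rule borel_measurable_continuous_onI[OF continuous_on_from_real])
  have mtr: "to_real \<in> lborel \<rightarrow>\<^sub>M (borel :: (real^('a bit0)) measure)"
    using borel_measurable_continuous_onI[OF continuous_on_to_real] by simp
  have mF: "?F \<in> borel_measurable borel" unfolding F using measurable_comp[OF mfr f] .
  have "integrable (distr lborel borel to_real) ?F \<longleftrightarrow> integrable lborel ?g"
    unfolding integrable_distr_eq[OF mtr mF] gF ..
  then have "integrable lborel ?F \<longleftrightarrow> integrable lborel ?g"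
    unfolding lborel_to_real[symmetric] .
  moreover have "integrable lborel ?F \<longleftrightarrow> integrable lebesgue ?F"
    using mF by (intro integrable_completion[symmetric]) simp
  ultimately show A: ?A by (simp add: set_integrable_def o_def)
  assume int: "set_integrable lborel U f"
  have "integral\<^sup>L (distr lborel borel to_real) ?F = integral\<^sup>L lborel ?g"
    unfolding integral_distr[OF mtr mF] gF ..
  then have "(LINT z:U|lborel. f z) = integral\<^sup>L lborel ?F"
    unfolding lborel_to_real[symmetric] set_lebesgue_integral_def by simp
  also have "\<dots> = integral\<^sup>L lebesgue ?F"
    using mF by (intro integral_completion[symmetric]) simp
  also have "\<dots> = integral (to_real ` U) (f \<circ> from_real)"
    using A int set_lebesgue_integral_eq_integral(2)[of "to_real ` U" "f \<circ> from_real"]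
    by (simp add: set_lebesgue_integral_def)
  finally show "(LINT z:U|lborel. f z) = integral (to_real ` U) (f \<circ> from_real)" .
qed

lemma change_of_variables_real:
  fixes f :: "complex^'a \<Rightarrow> real" and s :: "complex^'a \<Rightarrow> complex^'a"
  assumes U: "open U" and s: "s ` U = U" "inj_on s U"
    and der: "\<And>z. z \<in> U \<Longrightarrow> (s has_derivative s' z) (at z)"
    and \<rho>: "\<And>z. z \<in> U \<Longrightarrow> \<bar>rdet (s' z)\<bar> = \<rho> z" "continuous_on U \<rho>"
    and f: "continuous_on U f" "set_integrable lborel U f"
  shows "set_integrable lborel U (\<lambda>z. \<rho> z * f (s z))"
    and "(LINT z:U|lborel. \<rho> z * f (s z)) = (LINT z:U|lborel. f z)"
proof -
  let ?S = "to_real ` U" let ?g = "to_real \<circ> s \<circ> from_real"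
  let ?g' = "\<lambda>x. to_real \<circ> s' (from_real x) \<circ> from_real"
  have cs: "continuous_on U s" using der by (meson continuous_at_imp_continuous_on has_derivative_continuous)
  have csf: "continuous_on U (\<lambda>z. f (s z))" using continuous_on_compose2[OF f(1) cs] s(1) by blast
  have cont: "continuous_on U (\<lambda>z. \<rho> z * f (s z))" by (intro continuous_on_mult \<rho>(2) csf)
  have Ub: "U \<in> sets borel" using U by simp
  have S: "?S \<in> sets lebesgue"
  proof -
    have "?S = from_real -` U" by (auto simp: image_iff) (metis to_from_real)
    then have "open ?S" using open_vimage[OF U continuous_on_from_real] by simp
    then show ?thesis by simp
  qed
  have dg: "(?g has_derivative ?g' x) (at x within ?S)" if "x \<in> ?S" for x
  proof -
    have x: "from_real x \<in> U" using that by auto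
    have d: "(from_real has_derivative from_real) (at x within ?S)" "(to_real has_derivative to_real) (at (s (from_real x)))"
      using linear_from_real linear_to_real by (auto intro!: bounded_linear_imp_has_derivative simp: linear_conv_bounded_linear[symmetric])
    have "((\<lambda>x. s (from_real x)) has_derivative (\<lambda>v. s' (from_real x) (from_real v))) (at x within ?S)"
      by (rule has_derivative_compose[OF d(1) der[OF x]])
    then have "((\<lambda>x. to_real (s (from_real x))) has_derivative (\<lambda>v. to_real (s' (from_real x) (from_real v)))) (at x within ?S)"
      using has_derivative_compose d(2) by fast
    then show ?thesis by (simp add: o_def)
  qed
  have inj: "inj_on ?g ?S"
  proof (rule inj_onI)
    fix x y assume *: "x \<in> ?S" "y \<in> ?S" "?g x = ?g y"
    then have "s (from_real x) = s (from_real y)" by (metis comp_apply from_to_real)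
    moreover have "from_real x \<in> U" "from_real y \<in> U" using * by auto
    ultimately have "(from_real x :: complex^'a) = from_real y" using s(2) by (simp add: inj_on_def)
    then show "x = y" by (metis to_from_real)
  qed
  have img: "?g ` ?S = ?S" by (metis (no_types, lifting) comp_apply from_to_real image_cong image_image s(1))
  \<comment> \<open>The change of variables theorem speaks of vector-valued functions, so the scalar
    integrand is wrapped in \<open>real^1\<close>.\<close>
  define F :: "real^('a bit0) \<Rightarrow> real^1" where "F x = vec (f (from_real x))" for x
  define b where "b = (LINT z:U|lborel. f z)"
  have "(f \<circ> from_real) absolutely_integrable_on ?S" "integral ?S (f \<circ> from_real) = b"
    using integral_to_real[OF Ub borel_measurable_continuous_on_indicator[OF Ub f(1)]] f(2) by (simp_all add: b_def)
  then have "F absolutely_integrable_on (?g ` ?S) \<and> integral (?g ` ?S) F = vec b"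
    unfolding img F_def by (simp add: absolutely_integrable_on_1_iff integral_on_1_eq o_def)
  then have "(\<lambda>x. \<bar>det (matrix (?g' x))\<bar> *\<^sub>R F (?g x)) absolutely_integrable_on ?S \<and>
      integral ?S (\<lambda>x. \<bar>det (matrix (?g' x))\<bar> *\<^sub>R F (?g x)) = vec b"
    using has_absolute_integral_change_of_variables[OF S dg inj, of F "vec b"] by blast
  then have *: "(\<lambda>x. \<bar>det (matrix (?g' x))\<bar> * f (s (from_real x))) absolutely_integrable_on ?S"
      "integral ?S (\<lambda>x. \<bar>det (matrix (?g' x))\<bar> * f (s (from_real x))) = b"
    by (simp_all add: F_def absolutely_integrable_on_1_iff integral_on_1_eq)
  have eq: "\<bar>det (matrix (?g' x))\<bar> * f (s (from_real x)) = ((\<lambda>z. \<rho> z * f (s z)) \<circ> from_real) x" if "x \<in> ?S" for x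
  proof -
    have "from_real x \<in> U" using that by auto
    then show ?thesis using \<rho>(1) by (simp add: rdet_def)
  qed
  have "((\<lambda>z. \<rho> z * f (s z)) \<circ> from_real) absolutely_integrable_on ?S"
  proof -
    have "set_integrable lebesgue ?S (\<lambda>x. \<bar>det (matrix (?g' x))\<bar> * f (s (from_real x))) =
        set_integrable lebesgue ?S ((\<lambda>z. \<rho> z * f (s z)) \<circ> from_real)"
      by (rule set_integrable_cong) (rule refl eq; assumption?)+
    with *(1) show ?thesis by simp
  qed
  moreover have "integral ?S ((\<lambda>z. \<rho> z * f (s z)) \<circ> from_real) = b"
    unfolding *(2)[symmetric] by (rule Henstock_Kurzweil_Integration.integral_cong) (rule eq[symmetric])
  ultimately show 1: "set_integrable lborel U (\<lambda>z. \<rho> z * f (s z))"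
      and "(LINT z:U|lborel. \<rho> z * f (s z)) = (LINT z:U|lborel. f z)"
    using integral_to_real[OF Ub borel_measurable_continuous_on_indicator[OF Ub cont]] by (simp_all add: b_def)
qed

lemma change_of_variables_complex:
  fixes f :: "complex^'a \<Rightarrow> complex" and s :: "complex^'a \<Rightarrow> complex^'a"
  assumes U: "open U" and s: "s ` U = U" "inj_on s U"
    and der: "\<And>z. z \<in> U \<Longrightarrow> (s has_derivative s' z) (at z)"
    and \<rho>: "\<And>z. z \<in> U \<Longrightarrow> \<bar>rdet (s' z)\<bar> = \<rho> z" "continuous_on U \<rho>"
    and f: "continuous_on U f" "set_integrable lborel U f"
  shows "set_integrable lborel U (\<lambda>z. \<rho> z * f (s z))"
    and "(LINT z:U|lborel. \<rho> z * f (s z)) = (LINT z:U|lborel. f z)"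
proof -
  have *: "set_integrable lborel U (\<lambda>z. g (f z))" "(LINT z:U|lborel. g (f z)) = g (LINT z:U|lborel. f z)"
    if g: "bounded_linear g" for g :: "complex \<Rightarrow> real" 
  proof -
    have "(\<lambda>z. indicator U z *\<^sub>R g (f z)) = (\<lambda>z. g (indicator U z *\<^sub>R f z))"
      using g by (simp add: linear_simps(5) fun_eq_iff)
    then show "set_integrable lborel U (\<lambda>z. g (f z))" "(LINT z:U|lborel. g (f z)) = g (LINT z:U|lborel. f z)"
      using integrable_bounded_linear[OF g] integral_bounded_linear[OF g] f(2)
      unfolding set_integrable_def set_lebesgue_integral_def by auto
  qed
  note re = *[OF bounded_linear_Re] and im = *[OF bounded_linear_Im]
  have cre: "continuous_on U (\<lambda>z. Re (f z))" "continuous_on U (\<lambda>z. Im (f z))" by (intro continuous_intros f(1))+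
  have cr: "set_integrable lborel U (\<lambda>z. \<rho> z * Re (f (s z)))"
      "(LINT z:U|lborel. \<rho> z * Re (f (s z))) = (LINT z:U|lborel. Re (f z))"
    by (rule change_of_variables_real[OF U s der \<rho> cre(1) re(1)]; assumption)+
  have ci: "set_integrable lborel U (\<lambda>z. \<rho> z * Im (f (s z)))"
      "(LINT z:U|lborel. \<rho> z * Im (f (s z))) = (LINT z:U|lborel. Im (f z))"
    by (rule change_of_variables_real[OF U s der \<rho> cre(2) im(1)]; assumption)+
  have eq: "(\<lambda>z. indicator U z *\<^sub>R (of_real (\<rho> z) * f (s z))) =
     (\<lambda>z. complex_of_real (indicator U z *\<^sub>R (\<rho> z * Re (f (s z)))) + \<i> * complex_of_real (indicator U z *\<^sub>R (\<rho> z * Im (f (s z)))))"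
    by (auto simp: fun_eq_iff complex_eq_iff indicator_def)
  show "set_integrable lborel U (\<lambda>z. \<rho> z * f (s z))"
    using cr(1) ci(1) unfolding set_integrable_def eq by (intro Bochner_Integration.integrable_add integrable_mult_right integrable_of_real)
  have "(LINT z:U|lborel. of_real (\<rho> z) * f (s z)) = of_real (LINT z:U|lborel. \<rho> z * Re (f (s z))) + \<i> * of_real (LINT z:U|lborel. \<rho> z * Im (f (s z)))"
    unfolding set_lebesgue_integral_def eq using cr(1) ci(1) unfolding set_integrable_def
    by (subst Bochner_Integration.integral_add) (auto simp del: of_real_mult real_scaleR_def)
  also have "\<dots> = (LINT z:U|lborel. f z)"
    unfolding cr(2) ci(2) re(2) im(2) by (simp add: complex_eq_iff)
  finally show "(LINT z:U|lborel. \<rho> z * f (s z)) = (LINT z:U|lborel. f z)" .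
qed

section \<open>Partial derivatives of holomorphic functions\<close>

lemma holomorphic_fun_onI:
  assumes "open S" "\<And>z. z \<in> S \<Longrightarrow> (F has_derivative D z) (at z)" "\<And>z c v. z \<in> S \<Longrightarrow> D z (c *s v) = c * D z v"
  shows "holomorphic_fun_on F S"
  using assms unfolding holomorphic_fun_on_def by blast

lemma holomorphic_fun_on_open: "holomorphic_fun_on F S \<Longrightarrow> open S"
  by (simp add: holomorphic_fun_on_def)

lemma holomorphic_fun_onD:
  assumes "holomorphic_fun_on F S" "z \<in> S"
  shows "(F has_derivative frechet_derivative F (at z)) (at z)"
    and "frechet_derivative F (at z) (c *s v) = c * frechet_derivative F (at z) v"
proof -
  obtain D where D: "(F has_derivative D) (at z)" "\<And>c v. D (c *s v) = c * D v"
    using assms by (auto simp: holomorphic_fun_on_def)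
  have "D = frechet_derivative F (at z)" using D(1) by (rule frechet_derivative_at)
  with D show "(F has_derivative frechet_derivative F (at z)) (at z)"
    "frechet_derivative F (at z) (c *s v) = c * frechet_derivative F (at z) v" by auto
qed

lemma holomorphic_fun_on_continuous: assumes "holomorphic_fun_on F S" shows "continuous_on S F"
  using holomorphic_fun_onD(1)[OF assms] by (meson continuous_at_imp_continuous_on has_derivative_continuous)

lemma bounded_linear_smult: "bounded_linear (\<lambda>t::complex. t *s (v::complex^'a))"
proof -
  have "linear (\<lambda>t::complex. t *s v)"
    by (rule linearI) (simp_all add: vec_eq_iff algebra_simps)
  then show ?thesis by (simp add: linear_conv_bounded_linear)
qed

lemma bounded_linear_smult_right: "bounded_linear (\<lambda>v::complex^'a. c *s v)"
proof -
  have "linear (\<lambda>v::complex^'a. c *s v)"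
    by (rule linearI) (simp_all add: vec_eq_iff algebra_simps)
  then show ?thesis by (simp add: linear_conv_bounded_linear)
qed

lemma has_field_derivative_line:
  assumes F: "holomorphic_fun_on F S" "z + t *s v \<in> S"
  shows "((\<lambda>t. F (z + t *s v)) has_field_derivative frechet_derivative F (at (z + t *s v)) v) (at t)"
proof -
  have "((\<lambda>t. z + t *s v) has_derivative (\<lambda>s. s *s v)) (at t)"
    by (auto intro!: derivative_eq_intros bounded_linear_imp_has_derivative bounded_linear_smult)
  then have "((\<lambda>t. F (z + t *s v)) has_derivative (\<lambda>s. frechet_derivative F (at (z + t *s v)) (s *s v))) (at t)"
    using holomorphic_fun_onD(1)[OF F] by (rule has_derivative_compose)
  then show ?thesis unfolding has_field_derivative_def
    by (rule has_derivative_eq_rhs) (simp add: holomorphic_fun_onD(2)[OF F] fun_eq_iff)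
qed

text \<open>Cauchy's formula on the complex line through \<open>z\<close> in direction
  \<open>v\<close>. The definition of holomorphy provides a derivative at each point only; writing
  it as an integral over a fixed interval lets the derivative inherit the regularity of
  \<open>F\<close>.\<close>

lemma cauchy_partial:
  assumes F: "holomorphic_fun_on F S" and r: "0 < r" and S: "\<And>t. norm t \<le> r \<Longrightarrow> z + t *s v \<in> S"
  shows "frechet_derivative F (at z) v = integral {0..1} (\<lambda>t. F (z + circlepath 0 r t *s v) / circlepath 0 r t)"
proof -
  let ?g = "\<lambda>t. F (z + t *s v)"
  have der: "(?g has_field_derivative frechet_derivative F (at (z + t *s v)) v) (at t)" if "norm t \<le> r" for t
    using has_field_derivative_line[OF F] S that by blast
  have cont: "continuous_on (cball 0 r) ?g" 
    by (intro continuous_at_imp_continuous_on ballI DERIV_isCont) (rule der, simp)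
  have hol: "?g holomorphic_on ball 0 r"
    unfolding holomorphic_on_open[OF open_ball]
  proof
    fix x :: complex assume "x \<in> ball 0 r"
    then show "\<exists>f'. (?g has_field_derivative f') (at x)" using der[of x] by auto
  qed
  have "(?g has_field_derivative (1 / (2 * of_real pi * \<i>) * contour_integral (circlepath 0 r) (\<lambda>u. ?g u / (u - 0)\<^sup>2))) (at 0)"
    using Cauchy_derivative_integral_circlepath(2)[OF cont hol, of 0] r by simp
  then have "frechet_derivative F (at z) v = 1 / (2 * of_real pi * \<i>) * contour_integral (circlepath 0 r) (\<lambda>u. ?g u / u\<^sup>2)"
    using der[of 0] r DERIV_unique by fastforce
  also have "contour_integral (circlepath 0 r) (\<lambda>u. ?g u / u\<^sup>2) = integral {0..1} (\<lambda>t. 2 * of_real pi * \<i> * (?g (circlepath 0 r t) / circlepath 0 r t))"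
    unfolding contour_integral_integral
  proof (rule Henstock_Kurzweil_Integration.integral_cong)
    fix t :: real assume t: "t \<in> {0..1}"
    have "circlepath 0 r t \<noteq> 0" using r by (simp add: circlepath)
    moreover have "vector_derivative (circlepath 0 r) (at t) = 2 * of_real pi * \<i> * circlepath 0 r t"
      unfolding vector_derivative_circlepath by (simp add: circlepath)
    ultimately show "?g (circlepath 0 r t) / (circlepath 0 r t)\<^sup>2 * vector_derivative (circlepath 0 r) (at t) =
        2 * of_real pi * \<i> * (?g (circlepath 0 r t) / circlepath 0 r t)"
      by (simp add: power2_eq_square)
  qed
  also have "\<dots> = 2 * of_real pi * \<i> * integral {0..1} (\<lambda>t. ?g (circlepath 0 r t) / circlepath 0 r t)"
    by (rule integral_mult_right)
  finally show ?thesis by simp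
qed

lemma continuous_circlepath: "continuous_on A (circlepath z r)"
  by (simp add: circlepath_def part_circlepath_def) (intro continuous_intros)

lemma small_cball:
  assumes "open S" "z0 \<in> S"
  obtains r where "0 < r" "\<And>z t v. z \<in> ball z0 r \<Longrightarrow> norm t \<le> r \<Longrightarrow> norm v \<le> 1 \<Longrightarrow> z + t *s (v::complex^'a) \<in> S"
proof -
  obtain e where e: "0 < e" "ball z0 e \<subseteq> S" using assms openE by blast
  have "z + t *s v \<in> S" if "z \<in> ball z0 (e/2)" "norm t \<le> e / 2" "norm v \<le> 1" for z v :: "complex^'a" and t
  proof -
    have "norm (t *s v) \<le> e / 2 * 1" unfolding norm_smult using that e(1) by (intro mult_mono) auto
    moreover have "norm (z0 - (z + t *s v)) \<le> norm (z0 - z) + norm (t *s v)"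
      using norm_triangle_ineq4[of "z0 - z" "t *s v"] by (simp add: algebra_simps)
    ultimately have "dist z0 (z + t *s v) < e" using that(1) by (simp add: dist_norm)
    then show ?thesis using e(2) by auto
  qed
  then show ?thesis using that[of "e/2"] e(1) by simp
qed

lemma continuous_directional:
  assumes F: "holomorphic_fun_on F S" and v: "norm v \<le> 1"
  shows "continuous_on S (\<lambda>z. frechet_derivative F (at z) v)"
proof (rule continuous_at_imp_continuous_on, rule ballI)
  fix z0 assume "z0 \<in> S"
  then obtain r where r: "0 < r" "\<And>z t v. z \<in> ball z0 r \<Longrightarrow> norm t \<le> r \<Longrightarrow> norm v \<le> 1 \<Longrightarrow> z + t *s (v::complex^'a) \<in> S"
    using small_cball[OF holomorphic_fun_on_open[OF F]] by blast
  have nz: "circlepath 0 r t \<noteq> 0" "norm (circlepath 0 r t) = r" for t using r(1) by (simp_all add: circlepath norm_mult)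
  have inS: "x + circlepath 0 r t *s v \<in> S" if "x \<in> ball z0 r" for x t
    using r(2)[OF that _ v] nz by simp
  have "continuous_on (ball z0 r \<times> cbox 0 1) (\<lambda>(x, t). F (x + circlepath 0 r t *s v) / circlepath 0 r t)"
    unfolding split_beta
    by (intro continuous_intros continuous_on_compose2[OF holomorphic_fun_on_continuous[OF F]]
        bounded_linear.continuous_on[OF bounded_linear_smult] continuous_on_compose2[OF continuous_circlepath[of UNIV 0 r]])
      (auto simp: nz intro: inS)
  then have "continuous_on (ball z0 r) (\<lambda>x. integral (cbox 0 1) (\<lambda>t. F (x + circlepath 0 r t *s v) / circlepath 0 r t))"
    by (rule integral_continuous_on_param)
  then have "continuous_on (ball z0 r) (\<lambda>z. frechet_derivative F (at z) v)"
    by (rule continuous_on_eq) (use cauchy_partial[OF F r(1), of _ v] r(2) v in \<open>auto simp: cbox_interval\<close>)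
  then show "isCont (\<lambda>z. frechet_derivative F (at z) v) z0"
    using r(1) by (simp add: continuous_on_eq_continuous_at)
qed

text \<open>Differentiation under the integral of \<open>cauchy_partial\<close>;
  \<open>continuous_directional\<close> supplies the continuity of the differentiated integrand. The
  bound on \<open>v\<close> fixes the radius in terms of the base point alone.\<close>

lemma holomorphic_directional:
  fixes F :: "complex^'a \<Rightarrow> complex"
  assumes F: "holomorphic_fun_on F S" and v: "norm v \<le> 1"
  shows "holomorphic_fun_on (\<lambda>z. frechet_derivative F (at z) v) S"
proof -
  define D where "D z = Blinfun (frechet_derivative F (at z))" for z
  have D: "blinfun_apply (D z) = frechet_derivative F (at z)" if "z \<in> S" for z
    unfolding D_def using holomorphic_fun_onD(1)[OF F that] by (intro bounded_linear_Blinfun_apply has_derivative_bounded_linear)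
  have contD: "continuous_on S D"
  proof (rule continuous_on_blinfun_componentwise)
    fix b :: "complex^'a" assume "b \<in> Basis"
    then have "continuous_on S (\<lambda>z. frechet_derivative F (at z) b)" by (intro continuous_directional[OF F]) simp
    then show "continuous_on S (\<lambda>z. blinfun_apply (D z) b)" by (rule continuous_on_eq) (simp add: D)
  qed
  have "\<exists>D'. ((\<lambda>z. frechet_derivative F (at z) v) has_derivative D') (at z0) \<and> (\<forall>c w. D' (c *s w) = c * D' w)" if z0S: "z0 \<in> S" for z0
  proof -
    obtain r where r: "0 < r" "\<And>z t v. z \<in> ball z0 r \<Longrightarrow> norm t \<le> r \<Longrightarrow> norm v \<le> 1 \<Longrightarrow> z + t *s (v::complex^'a) \<in> S"
      using small_cball[OF holomorphic_fun_on_open[OF F] z0S] by blast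
    have nz: "circlepath 0 r t \<noteq> 0" "norm (circlepath 0 r t) = r" for t using r(1) by (simp_all add: circlepath norm_mult)
    have inS: "x + circlepath 0 r t *s v \<in> S" if "x \<in> ball z0 r" for x t
      using r(2)[OF that _ v] nz by simp
    define f where "f x t = F (x + circlepath 0 r t *s v) / circlepath 0 r t" for x t
    define fx where "fx x t = blinfun_mult_right (1 / circlepath 0 r t) o\<^sub>L D (x + circlepath 0 r t *s v)" for x t
    have der: "((\<lambda>x. f x t) has_derivative blinfun_apply (fx x t)) (at x within ball z0 r)" if "x \<in> ball z0 r" for x t
    proof -
      have "((\<lambda>x. x + circlepath 0 r t *s v) has_derivative (\<lambda>w. w)) (at x within ball z0 r)"
        by (auto intro!: derivative_eq_intros)
      from has_derivative_compose[OF this holomorphic_fun_onD(1)[OF F inS[OF that]]]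
      have "((\<lambda>x. F (x + circlepath 0 r t *s v)) has_derivative frechet_derivative F (at (x + circlepath 0 r t *s v))) (at x within ball z0 r)" .
      note d = has_derivative_mult_left[OF this, of "1 / circlepath 0 r t"]
      have "blinfun_apply (fx x t) = (\<lambda>w. frechet_derivative F (at (x + circlepath 0 r t *s v)) w * (1 / circlepath 0 r t))"
        by (simp add: fx_def D[OF inS[OF that]] fun_eq_iff)
      with d show ?thesis by (simp add: f_def)
    qed
    have cfx: "continuous_on (ball z0 r \<times> cbox 0 1) (\<lambda>(x, t). fx x t)"
      unfolding split_beta fx_def
      by (intro continuous_intros continuous_on_compose2[OF contD] bounded_linear.continuous_on[OF bounded_linear_blinfun_mult_right]
          bounded_linear.continuous_on[OF bounded_linear_smult] continuous_on_compose2[OF continuous_circlepath[of UNIV 0 r]])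
        (auto simp: nz intro: inS)
    have int: "f x integrable_on cbox 0 1" if "x \<in> ball z0 r" for x
      unfolding f_def
      by (intro integrable_continuous continuous_intros continuous_on_compose2[OF holomorphic_fun_on_continuous[OF F]]
          bounded_linear.continuous_on[OF bounded_linear_smult] continuous_circlepath)
        (use inS that nz in auto)
    have z0: "z0 \<in> ball z0 r" using r(1) by simp
    have "((\<lambda>x. integral (cbox 0 1) (f x)) has_derivative integral (cbox 0 1) (fx z0)) (at z0 within ball z0 r)"
      by (rule leibniz_rule[OF der int cfx z0 convex_ball])
    then have L: "((\<lambda>x. integral (cbox 0 1) (f x)) has_derivative integral (cbox 0 1) (fx z0)) (at z0)"
      unfolding at_within_open[OF z0 open_ball] .
    have "((\<lambda>z. frechet_derivative F (at z) v) has_derivative integral (cbox 0 1) (fx z0)) (at z0)"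
      by (rule has_derivative_transform_within_open[OF L open_ball z0])
        (use cauchy_partial[OF F r(1), of _ v] r(2) v in \<open>auto simp: cbox_interval f_def[abs_def]\<close>)
    moreover have "blinfun_apply (integral (cbox 0 1) (fx z0)) (c *s w) = c * blinfun_apply (integral (cbox 0 1) (fx z0)) w" for c w
    proof -
      have "continuous_on (cbox 0 1) (\<lambda>t. fx z0 t)"
      proof -
        have "Pair z0 ` cbox 0 1 \<subseteq> ball z0 r \<times> cbox (0::real) 1" using z0 by blast
        from continuous_on_compose2[OF cfx continuous_on_Pair[OF continuous_on_const continuous_on_id] this] show ?thesis
          by simp
      qed
      then have ifx: "fx z0 integrable_on cbox 0 1" by (rule integrable_continuous)
      have "fx z0 t (c *s w) = c * fx z0 t w" for t
        using holomorphic_fun_onD(2)[OF F inS[OF z0]] by (simp add: fx_def D[OF inS[OF z0]])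
      then show ?thesis unfolding blinfun_apply_integral[OF ifx] by simp
    qed
    ultimately show ?thesis by blast
  qed
  then show ?thesis using holomorphic_fun_on_open[OF F] by (simp add: holomorphic_fun_on_def)
qed

lemma holomorphic_fun_on_const: "open S \<Longrightarrow> holomorphic_fun_on (\<lambda>z. c) S"
  by (rule holomorphic_fun_onI[where D = "\<lambda>_ _. 0"]) auto

lemma holomorphic_fun_on_add:
  assumes "holomorphic_fun_on F S" "holomorphic_fun_on G S" shows "holomorphic_fun_on (\<lambda>z. F z + G z) S"
  by (rule holomorphic_fun_onI[OF holomorphic_fun_on_open[OF assms(1)] has_derivative_add[OF holomorphic_fun_onD(1)[OF assms(1)] holomorphic_fun_onD(1)[OF assms(2)]]])
    (simp_all add: holomorphic_fun_onD(2)[OF assms(1)] holomorphic_fun_onD(2)[OF assms(2)] algebra_simps)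

lemma holomorphic_fun_on_mult:
  assumes "holomorphic_fun_on F S" "holomorphic_fun_on G S" shows "holomorphic_fun_on (\<lambda>z. F z * G z) S"
  by (rule holomorphic_fun_onI[OF holomorphic_fun_on_open[OF assms(1)] has_derivative_mult[OF holomorphic_fun_onD(1)[OF assms(1)] holomorphic_fun_onD(1)[OF assms(2)]]])
    (simp_all add: holomorphic_fun_onD(2)[OF assms(1)] holomorphic_fun_onD(2)[OF assms(2)] algebra_simps)

lemma holomorphic_fun_on_sum:
  assumes "open S" "\<And>i. i \<in> I \<Longrightarrow> holomorphic_fun_on (F i) S" shows "holomorphic_fun_on (\<lambda>z. \<Sum>i\<in>I. F i z) S"
  using assms(2) by (induction I rule: infinite_finite_induct) (auto intro: holomorphic_fun_on_const holomorphic_fun_on_add assms(1))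

lemma holomorphic_fun_on_prod:
  assumes "open S" "\<And>i. i \<in> I \<Longrightarrow> holomorphic_fun_on (F i) S" shows "holomorphic_fun_on (\<lambda>z. \<Prod>i\<in>I. F i z) S"
  using assms(2) by (induction I rule: infinite_finite_induct) (auto intro: holomorphic_fun_on_const holomorphic_fun_on_mult assms(1))

lemma holomorphic_fun_on_det:
  fixes A :: "complex^'b \<Rightarrow> complex^'a^'a"
  assumes "open S" "\<And>i j. holomorphic_fun_on (\<lambda>z. A z $ i $ j) S"
  shows "holomorphic_fun_on (\<lambda>z. det (A z)) S"
  unfolding det_def by (intro holomorphic_fun_on_sum holomorphic_fun_on_mult holomorphic_fun_on_prod holomorphic_fun_on_const assms)

section \<open>Holomorphic maps\<close>

lemma holomorphic_map_on_open: "holomorphic_map_on f S \<Longrightarrow> open S"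
  by (auto simp: holomorphic_map_on_def dest: holomorphic_fun_on_open)

lemma has_derivative_cjacobian:
  fixes f :: "complex^'a \<Rightarrow> complex^'b"
  assumes f: "holomorphic_map_on f S" and z: "z \<in> S"
  shows "(f has_derivative (\<lambda>v. cjacobian f z *v v)) (at z)"
proof -
  have fi: "holomorphic_fun_on (\<lambda>z. f z $ i) S" for i using f by (simp add: holomorphic_map_on_def)
  let ?D = "\<lambda>i. frechet_derivative (\<lambda>z. f z $ i) (at z)"
  have "(f has_derivative (\<lambda>v. \<chi> i. ?D i v)) (at z)"
  proof (subst has_derivative_componentwise_within, rule ballI)
    fix b :: "complex^'b" assume "b \<in> Basis"
    then obtain i u where b: "b = axis i u" by (auto simp: Basis_vec_def)
    have "((\<lambda>x. f x $ i \<bullet> u) has_derivative (\<lambda>v. ?D i v \<bullet> u)) (at z)"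
      by (intro has_derivative_inner_left holomorphic_fun_onD(1)[OF fi z])
    then show "((\<lambda>x. f x \<bullet> b) has_derivative (\<lambda>v. (\<chi> i. ?D i v) \<bullet> b)) (at z)"
      by (simp add: b inner_axis)
  qed
  moreover have "(\<chi> i. ?D i v) = cjacobian f z *v v" for v
  proof -
    have "?D i v = (\<Sum>j\<in>UNIV. cjacobian f z $ i $ j * v $ j)" for i
    proof -
      have e: "?D i (axis j 1) = cjacobian f z $ i $ j" for j
        using DERIV_imp_deriv[OF has_field_derivative_line[OF fi, of z 0 "axis j 1"]] z by (simp add: cjacobian_def)
      have "?D i v = ?D i (\<Sum>j\<in>UNIV. v $ j *s axis j 1)" by (simp add: basis_expansion)
      also have "\<dots> = (\<Sum>j\<in>UNIV. v $ j * ?D i (axis j 1))"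
        using linear_sum[OF has_derivative_linear[OF holomorphic_fun_onD(1)[OF fi z]], of i "\<lambda>j. v $ j *s axis j 1" UNIV]
        by (simp add: holomorphic_fun_onD(2)[OF fi z])
      finally show ?thesis by (simp add: e mult.commute)
    qed
    then show ?thesis by (simp add: matrix_vector_mult_def vec_eq_iff)
  qed
  ultimately show ?thesis by simp
qed

lemma cjacobian_entry_holomorphic:
  assumes "holomorphic_map_on f S" shows "holomorphic_fun_on (\<lambda>z. cjacobian f z $ i $ j) S"
proof -
  have fi: "holomorphic_fun_on (\<lambda>z. f z $ i) S" using assms by (simp add: holomorphic_map_on_def)
  have *: "holomorphic_fun_on (\<lambda>z. frechet_derivative (\<lambda>z. f z $ i) (at z) (axis j 1)) S"
    by (rule holomorphic_directional[OF fi]) simp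
  have eq: "frechet_derivative (\<lambda>z. f z $ i) (at z) (axis j 1) = cjacobian f z $ i $ j" if "z \<in> S" for z
    using DERIV_imp_deriv[OF has_field_derivative_line[OF fi, of z 0 "axis j 1"]] that by (simp add: cjacobian_def)
  show ?thesis
  proof (rule holomorphic_fun_onI[OF holomorphic_fun_on_open[OF fi]])
    fix z assume z: "z \<in> S"
    show "((\<lambda>z. cjacobian f z $ i $ j) has_derivative
        frechet_derivative (\<lambda>z. frechet_derivative (\<lambda>z. f z $ i) (at z) (axis j 1)) (at z)) (at z)"
      by (rule has_derivative_transform_within_open[OF holomorphic_fun_onD(1)[OF * z] holomorphic_fun_on_open[OF fi] z eq])
  qed (rule holomorphic_fun_onD(2)[OF *])
qed

lemma holomorphic_fun_on_compose:
  fixes f :: "complex^'a \<Rightarrow> complex^'b"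
  assumes f: "holomorphic_map_on f S" "f ` S \<subseteq> T" and F: "holomorphic_fun_on F T"
  shows "holomorphic_fun_on (\<lambda>z. F (f z)) S"
proof (rule holomorphic_fun_onI[OF holomorphic_map_on_open[OF f(1)]])
  fix z assume z: "z \<in> S"
  then have fz: "f z \<in> T" using f(2) by blast
  show "((\<lambda>z. F (f z)) has_derivative (\<lambda>v. frechet_derivative F (at (f z)) (cjacobian f z *v v))) (at z)"
    by (rule has_derivative_compose[OF has_derivative_cjacobian[OF f(1) z] holomorphic_fun_onD(1)[OF F fz]])
  show "frechet_derivative F (at (f z)) (cjacobian f z *v (c *s v)) = c * frechet_derivative F (at (f z)) (cjacobian f z *v v)" for c v
    by (simp add: holomorphic_fun_onD(2)[OF F fz] vec.linear_scale[OF matrix_vector_mul_linear_gen])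
qed

section \<open>Transformation of the Bergman kernel under an involution\<close>

lemma set_borel_measurable_continuous:
  fixes f :: "complex^'a \<Rightarrow> 'b::real_normed_vector"
  assumes "open U" "continuous_on U f" shows "(\<lambda>z. indicator U z *\<^sub>R f z) \<in> borel_measurable lborel"
  using borel_measurable_continuous_on_indicator[of U f] assms by simp

lemma set_integrable_dominated:
  fixes f :: "complex^'a \<Rightarrow> 'b::{banach,second_countable_topology}" and g :: "complex^'a \<Rightarrow> real"
  assumes "open U" "continuous_on U f" "set_integrable lborel U g" "\<And>z. z \<in> U \<Longrightarrow> norm (f z) \<le> g z"
  shows "set_integrable lborel U f"
  using assms(3) unfolding set_integrable_def
proof (rule Bochner_Integration.integrable_bound)
  show "AE x in lborel. norm (indicator U x *\<^sub>R f x) \<le> norm (indicator U x *\<^sub>R g x)"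
    using assms(4) by (intro always_eventually allI) (auto simp: indicator_def intro: order_trans[OF _ abs_ge_self])
qed (rule set_borel_measurable_continuous[OF assms(1,2)])

lemma bergman_spaceD:
  assumes "F \<in> bergman_space U"
  shows "holomorphic_fun_on F U" "open U" "continuous_on U F" "set_integrable lborel U (\<lambda>z. (norm (F z))\<^sup>2)"
  using assms holomorphic_fun_on_open holomorphic_fun_on_continuous by (auto simp: bergman_space_def)

lemma bergman_product_integrable:
  assumes "F \<in> bergman_space U" "G \<in> bergman_space U"
  shows "set_integrable lborel U (\<lambda>z. F z * cnj (G z))"
proof (rule set_integrable_dominated[OF bergman_spaceD(2)[OF assms(1)]])
  show "continuous_on U (\<lambda>z. F z * cnj (G z))"
    using assms bergman_spaceD(3) by (intro continuous_intros) auto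
  show "set_integrable lborel U (\<lambda>z. (norm (F z))\<^sup>2 + (norm (G z))\<^sup>2)"
    using assms bergman_spaceD(4) by (intro set_integral_add) auto
  show "norm (F z * cnj (G z)) \<le> (norm (F z))\<^sup>2 + (norm (G z))\<^sup>2" for z
  proof -
    have "2 * (norm (F z) * norm (G z)) \<le> (norm (F z))\<^sup>2 + (norm (G z))\<^sup>2"
      using sum_squares_bound[of "norm (F z)" "norm (G z)"] by (simp add: mult.assoc)
    then show ?thesis unfolding norm_mult complex_mod_cnj
      using mult_nonneg_nonneg[OF norm_ge_zero norm_ge_zero, of "F z" "G z"] by linarith
  qed
qed

lemma bergman_space_lincomb:
  assumes "F \<in> bergman_space U" "G \<in> bergman_space U" shows "(\<lambda>z. F z + c * G z) \<in> bergman_space U"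
proof -
  have hol: "holomorphic_fun_on (\<lambda>z. F z + c * G z) U"
    using assms bergman_spaceD by (intro holomorphic_fun_on_add holomorphic_fun_on_mult holomorphic_fun_on_const) auto
  have "set_integrable lborel U (\<lambda>z. (norm (F z + c * G z))\<^sup>2)"
  proof (rule set_integrable_dominated[OF bergman_spaceD(2)[OF assms(1)]])
    show "continuous_on U (\<lambda>z. (norm (F z + c * G z))\<^sup>2)"
      using assms bergman_spaceD(3) by (intro continuous_intros) auto
    show "set_integrable lborel U (\<lambda>z. 2 * (norm (F z))\<^sup>2 + 2 * (norm c)\<^sup>2 * (norm (G z))\<^sup>2)"
      using assms bergman_spaceD(4) by (intro set_integral_add set_integrable_mult_right) auto
    show "norm ((norm (F z + c * G z))\<^sup>2) \<le> 2 * (norm (F z))\<^sup>2 + 2 * (norm c)\<^sup>2 * (norm (G z))\<^sup>2" for z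
    proof -
      have "(norm (F z + c * G z))\<^sup>2 \<le> (norm (F z) + norm (c * G z))\<^sup>2"
        by (intro power_mono norm_triangle_ineq) simp
      also have "\<dots> \<le> 2 * (norm (F z))\<^sup>2 + 2 * (norm (c * G z))\<^sup>2"
        using sum_squares_bound[of "norm (F z)" "norm (c * G z)"] by (simp add: power2_sum)
      finally show ?thesis by (simp add: norm_mult power_mult_distrib)
    qed
  qed
  with hol show ?thesis by (simp add: bergman_space_def)
qed

text \<open>A vanishing integral of \<open>|F|^2\<close> gives \<open>F = 0\<close> almost
  everywhere; by continuity a point with \<open>F \<noteq> 0\<close> would come with a nonempty open
  set of such points, which is not negligible.\<close>

lemma bergman_norm_zero:
  assumes F: "F \<in> bergman_space U" and 0: "(LINT z:U|lborel. F z * cnj (F z)) = 0" and z0: "z0 \<in> U"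
  shows "F z0 = 0"
proof (rule ccontr)
  assume nz: "F z0 \<noteq> 0"
  note FD = bergman_spaceD[OF F]
  let ?g = "\<lambda>z. indicator U z *\<^sub>R (norm (F z))\<^sup>2"
  have int: "integrable lborel ?g" using FD(4) unfolding set_integrable_def .
  have "complex_of_real (integral\<^sup>L lborel ?g) = (LINT z|lborel. complex_of_real (?g z))"
    by (rule integral_of_real[OF int, symmetric])
  also have "\<dots> = (LINT z:U|lborel. F z * cnj (F z))"
    unfolding set_lebesgue_integral_def
    by (intro Bochner_Integration.integral_cong) (auto simp: indicator_def complex_norm_square simp flip: of_real_power)
  finally have "integral\<^sup>L lborel ?g = 0" using 0 by simp
  then have ae: "AE z in lborel. ?g z = 0"
    using integral_nonneg_eq_0_iff_AE[OF int] by simp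
  have "open {z \<in> U. F z \<in> - {0}}"
    using continuous_open_preimage[OF FD(3,2) open_Compl[OF closed_singleton], of 0] by (simp add: Int_def vimage_def)
  moreover have "z0 \<in> {z \<in> U. F z \<in> - {0}}" using nz z0 by simp
  ultimately have nn: "\<not> negligible {z \<in> U. F z \<in> - {0}}" using open_not_negligible by blast
  have sub: "{z \<in> U. F z \<in> - {0}} \<subseteq> {z \<in> space lborel. ?g z \<noteq> 0}" by (auto simp: indicator_def)
  have "{z \<in> space lborel. ?g z \<noteq> 0} \<in> null_sets lborel" (is "?N \<in> _")
  proof -
    have "?g \<in> borel_measurable lborel"
      by (rule set_borel_measurable_continuous[OF FD(2) continuous_on_power[OF continuous_on_norm[OF FD(3)]]])
    then have "?g -` (- {0}) \<inter> space lborel \<in> sets lborel" by (rule measurable_sets) simp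
    then have "{z \<in> space lborel. \<not> ?g z = 0} \<in> sets lborel" by (simp add: vimage_def)
    from AE_iff_null[OF this] ae show ?thesis by simp
  qed
  then have "negligible ?N" unfolding negligible_iff_null_sets by (rule null_sets_completionI)
  then have "negligible {z \<in> U. F z \<in> - {0}}" using sub by (rule negligible_subset)
  with nn show False by simp
qed

text \<open>\<open>K w w\<close> is the squared norm of \<open>K _ w\<close>. If it were zero,
  \<open>K _ w\<close> would vanish and could not reproduce the constant \<open>1\<close>, which is
  square integrable because \<open>U\<close> is bounded.\<close>

lemma bergman_kernel_diagonal:
  assumes K: "is_bergman_kernel U K" and w: "w \<in> U" and bdd: "bounded U" "open U"
  shows "K w w \<noteq> 0"
proof
  assume 0: "K w w = 0"
  have k: "(\<lambda>z. K z w) \<in> bergman_space U"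
    and rep: "\<And>F. F \<in> bergman_space U \<Longrightarrow> F w = (LINT z:U|lborel. F z * cnj (K z w))"
    using K w by (auto simp: is_bergman_kernel_def)
  have "(LINT z:U|lborel. K z w * cnj (K z w)) = 0" using rep[OF k] 0 by simp
  then have k0: "K z w = 0" if "z \<in> U" for z using bergman_norm_zero[OF k _ that] by simp
  have "(\<lambda>z. 1) \<in> bergman_space U"
    using bdd(2) emeasure_bounded_finite[OF bdd(1)] unfolding bergman_space_def
    by (auto intro!: holomorphic_fun_on_const integrable_real_indicator simp: set_integrable_def)
  from rep[OF this] have "1 = (LINT z:U|lborel. cnj (K z w))" by simp
  also have "\<dots> = 0" unfolding set_lebesgue_integral_def
    by (intro integral_eq_zero_AE always_eventually) (auto simp: indicator_def k0)
  finally show False by simp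
qed

text \<open>With \<open>J\<close> the complex Jacobian determinant of \<open>s\<close>, the map
  \<open>T F = (F \<circ> s) J\<close> is a unitary involution of the Bergman space. Both
  \<open>T (K _ w)\<close> and \<open>cnj (J w) K _ (s w)\<close> therefore represent the functional
  \<open>F \<mapsto> T F w\<close>, and their difference \<open>u\<close> has norm zero.\<close>

theorem bergman_involution:
  fixes s :: "complex^'a \<Rightarrow> complex^'a"
  assumes K: "is_bergman_kernel U K" and s: "holomorphic_map_on s U" "s ` U \<subseteq> U" "\<And>z. z \<in> U \<Longrightarrow> s (s z) = z"
  obtains J where "\<And>z. z \<in> U \<Longrightarrow> J z \<noteq> 0" "\<And>z w. z \<in> U \<Longrightarrow> w \<in> U \<Longrightarrow> K (s z) w * J z = cnj (J w) * K z (s w)"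
proof -
  define J where "J z = det (cjacobian s z)" for z
  have openU: "open U" by (rule holomorphic_map_on_open[OF s(1)])
  have sU: "s z \<in> U" if "z \<in> U" for z using s(2) that by blast
  have img: "s ` U = U"
  proof
    show "U \<subseteq> s ` U" using s(3) sU by (metis image_eqI subsetI)
  qed (rule s(2))
  have inj: "inj_on s U" by (metis inj_onI s(3))
  note der = has_derivative_cjacobian[OF s(1)]
  have JJ: "J (s z) * J z = 1" if z: "z \<in> U" for z
  proof -
    have "((\<lambda>z. s (s z)) has_derivative (\<lambda>v. cjacobian s (s z) *v (cjacobian s z *v v))) (at z)"
      by (rule has_derivative_compose[OF der[OF z] der[OF sU[OF z]]])
    moreover have "((\<lambda>z. s (s z)) has_derivative (\<lambda>v. v)) (at z)"
      by (rule has_derivative_transform_within_open[OF has_derivative_ident openU z]) (simp add: s(3))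
    ultimately have "(\<lambda>v. cjacobian s (s z) *v (cjacobian s z *v v)) = (\<lambda>v. v)" by (rule has_derivative_unique)
    then have "(cjacobian s (s z) ** cjacobian s z) *v v = mat 1 *v v" for v
      by (simp add: fun_eq_iff flip: matrix_vector_mul_assoc)
    then have "cjacobian s (s z) ** cjacobian s z = mat 1" by (simp add: matrix_eq)
    then show ?thesis unfolding J_def by (metis det_mul det_I)
  qed
  have holJ: "holomorphic_fun_on J U"
    unfolding J_def by (intro holomorphic_fun_on_det openU cjacobian_entry_holomorphic s(1))
  define \<rho> where "\<rho> z = (norm (J z))\<^sup>2" for z
  have rho: "\<bar>rdet (\<lambda>v. cjacobian s z *v v)\<bar> = \<rho> z" for z unfolding \<rho>_def J_def by (rule abs_rdet)
  have crho: "continuous_on U \<rho>" unfolding \<rho>_def by (intro continuous_intros holomorphic_fun_on_continuous[OF holJ])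
  have rho_J: "complex_of_real (\<rho> z) = J z * cnj (J z)" for z by (simp add: \<rho>_def complex_norm_square del: of_real_power)
  define T where "T F z = F (s z) * J z" for F z
  have T: "T F \<in> bergman_space U" if F: "F \<in> bergman_space U" for F
  proof -
    note FD = bergman_spaceD[OF F]
    have "holomorphic_fun_on (T F) U" unfolding T_def
      by (intro holomorphic_fun_on_mult holomorphic_fun_on_compose[OF s(1,2)] FD(1) holJ)
    moreover have "set_integrable lborel U (\<lambda>z. \<rho> z * (norm (F (s z)))\<^sup>2)"
      by (rule change_of_variables_real(1)[OF openU img inj der rho crho])
        (use FD in \<open>auto intro!: continuous_intros\<close>)
    then have "set_integrable lborel U (\<lambda>z. (norm (T F z))\<^sup>2)"
      by (simp add: T_def \<rho>_def norm_mult power_mult_distrib mult.commute)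
    ultimately show ?thesis by (simp add: bergman_space_def)
  qed
  have T_int: "(LINT z:U|lborel. T F z * cnj (T G z)) = (LINT z:U|lborel. F z * cnj (G z))"
    if F: "F \<in> bergman_space U" and G: "G \<in> bergman_space U" for F G
  proof -
    have "(LINT z:U|lborel. \<rho> z * (F (s z) * cnj (G (s z)))) = (LINT z:U|lborel. F z * cnj (G z))"
      by (rule change_of_variables_complex(2)[OF openU img inj der rho crho _ bergman_product_integrable[OF F G]])
        (use bergman_spaceD[OF F] bergman_spaceD[OF G] in \<open>auto intro!: continuous_intros\<close>)
    moreover have "\<rho> z * (F (s z) * cnj (G (s z))) = T F z * cnj (T G z)" for z
      by (simp add: T_def rho_J)
    ultimately show ?thesis by simp
  qed
  have TT: "T (T F) z = F z" if "z \<in> U" for F z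
    using JJ[OF that] s(3)[OF that] by (simp add: T_def mult.assoc)
  have k: "(\<lambda>z. K z w) \<in> bergman_space U" if "w \<in> U" for w
    using K that by (auto simp: is_bergman_kernel_def)
  have rep: "(LINT z:U|lborel. F z * cnj (K z w)) = F w" if "w \<in> U" "F \<in> bergman_space U" for F w
    using K that by (auto simp: is_bergman_kernel_def)
  have "K (s z) w * J z = cnj (J w) * K z (s w)" if z: "z \<in> U" and w: "w \<in> U" for z w
  proof -
    let ?kw = "\<lambda>z. K z w" and ?ks = "\<lambda>z. K z (s w)"
    define u where "u z = T ?kw z + (- cnj (J w)) * ?ks z" for z
    have u: "u \<in> bergman_space U" unfolding u_def
      by (intro bergman_space_lincomb T k w sU)
    have 1: "(LINT z:U|lborel. u z * cnj (T ?kw z)) = T u w"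
    proof -
      have "(LINT z:U|lborel. u z * cnj (T ?kw z)) = (LINT z:U|lborel. T (T u) z * cnj (T ?kw z))"
        by (rule set_lebesgue_integral_cong) (use openU in \<open>auto simp: TT\<close>)
      also have "\<dots> = (LINT z:U|lborel. T u z * cnj (?kw z))" by (rule T_int[OF T[OF u] k[OF w]])
      also have "\<dots> = T u w" by (rule rep[OF w T[OF u]])
      finally show ?thesis .
    qed
    have 2: "(LINT z:U|lborel. u z * cnj (?ks z)) = u (s w)" by (rule rep[OF sU[OF w] u])
    have "(LINT z:U|lborel. u z * cnj (u z)) =
        (LINT z:U|lborel. u z * cnj (T ?kw z) + (- J w) * (u z * cnj (?ks z)))"
      by (intro set_lebesgue_integral_cong) (use openU in \<open>auto simp: u_def algebra_simps\<close>)
    also have "\<dots> = (LINT z:U|lborel. u z * cnj (T ?kw z)) + (LINT z:U|lborel. (- J w) * (u z * cnj (?ks z)))"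
      by (intro set_integral_add set_integrable_mult_right bergman_product_integrable u T k w sU) 
    also have "\<dots> = T u w - J w * u (s w)" unfolding set_integral_mult_right 1 2 by simp
    also have "\<dots> = 0" by (simp add: T_def)
    finally have "u z = 0" by (intro bergman_norm_zero[OF u _ z])
    then show ?thesis by (simp add: u_def T_def)
  qed
  moreover have "J z \<noteq> 0" if "z \<in> U" for z using JJ[OF that] by auto
  ultimately show ?thesis using that by blast
qed

section \<open>The derivative of a symmetry at its fixed point\<close>

lemma norm_matrix_vector_le:
  "norm (A *v (x::complex^'a)) \<le> (\<Sum>i\<in>UNIV. \<Sum>j\<in>UNIV. norm (A $ i $ j)) * norm x" for A :: "complex^'a^'b"
proof -
  have "norm (A *v x) \<le> (\<Sum>i\<in>UNIV. norm ((A *v x) $ i))" unfolding norm_vec_def by (intro L2_set_le_sum) simp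
  also have "\<dots> \<le> (\<Sum>i\<in>UNIV. \<Sum>j\<in>UNIV. norm (A $ i $ j) * norm x)"
  proof (rule sum_mono)
    fix i
    have "norm ((A *v x) $ i) \<le> (\<Sum>j\<in>UNIV. norm (A $ i $ j * x $ j))"
      unfolding matrix_vector_mult_def by (simp add: norm_sum)
    also have "\<dots> \<le> (\<Sum>j\<in>UNIV. norm (A $ i $ j) * norm x)"
      by (intro sum_mono) (simp add: norm_mult mult_left_mono Finite_Cartesian_Product.norm_nth_le)
    finally show "norm ((A *v x) $ i) \<le> (\<Sum>j\<in>UNIV. norm (A $ i $ j) * norm x)" .
  qed
  finally show ?thesis by (simp add: sum_distrib_right)
qed

lemma matrix_minus_mv: "(A - B) *v x = A *v x - B *v (x::complex^'a)"
  by (simp add: matrix_vector_mult_def vec_eq_iff algebra_simps sum_subtractf)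

text \<open>The map \<open>\<psi>\<close> below linearizes the involution near \<open>p\<close>: it conjugates \<open>s\<close> to its derivative \<open>L\<close>.
  A fixed vector of \<open>L\<close> would yield fixed points of \<open>s\<close> accumulating at \<open>p\<close>.\<close>

lemma symmetry_derivative:
  fixes s :: "complex^'a \<Rightarrow> complex^'a"
  assumes s: "holomorphic_map_on s U" "s ` U \<subseteq> U" "\<And>z. z \<in> U \<Longrightarrow> s (s z) = z"
    and p: "p \<in> U" "s p = p"
    and isolated: "open V" "p \<in> V" "\<And>z. z \<in> V \<inter> U \<Longrightarrow> s z = z \<Longrightarrow> z = p"
  shows "cjacobian s p *v v = - v"
proof -
  have openU: "open U" by (rule holomorphic_map_on_open[OF s(1)])
  define L where "L = cjacobian s p"
  note der = has_derivative_cjacobian[OF s(1)]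
  have LL: "L *v (L *v v) = v" for v
  proof -
    have "((\<lambda>z. s (s z)) has_derivative (\<lambda>v. cjacobian s (s p) *v (cjacobian s p *v v))) (at p)"
      by (rule has_derivative_compose[OF der[OF p(1)] der]) (simp add: p)
    moreover have "((\<lambda>z. s (s z)) has_derivative (\<lambda>v. v)) (at p)"
      by (rule has_derivative_transform_within_open[OF has_derivative_ident openU p(1)]) (simp add: s(3))
    ultimately have "(\<lambda>v. cjacobian s (s p) *v (cjacobian s p *v v)) = (\<lambda>v. v)" by (rule has_derivative_unique)
    from fun_cong[OF this, of v] show ?thesis by (simp add: p(2) L_def)
  qed
  have "L *v v = v \<Longrightarrow> v = 0" for v
  proof (rule ccontr)
    assume v: "L *v v = v" "v \<noteq> 0"
    define \<psi> where "\<psi> z = (z - p) + L *v (s z - p)" for z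
    \<comment> \<open>\<open>L\<close> is an involution, so the derivative of \<open>\<psi>\<close>
      at \<open>p\<close> is \<open>2\<close>. Hence \<open>f\<close> has small derivative near
      \<open>p\<close>, and the bound \<open>1 < 2\<close> makes \<open>\<psi>\<close> injective
      there.\<close>
    define f where "f z = \<psi> z - 2 *\<^sub>R z" for z
    define A where "A z = L ** cjacobian s z - mat 1" for z
    have d\<psi>: "(\<psi> has_derivative (\<lambda>w. w + L *v (cjacobian s z *v w))) (at z)" if "z \<in> U" for z
      unfolding \<psi>_def
      by (rule derivative_eq_intros der[OF that] bounded_linear.has_derivative[OF linear_matrix_vector[THEN linear_conv_bounded_linear[THEN iffD1]]] | simp)+
    have df: "(f has_derivative (\<lambda>w. A z *v w)) (at z)" if "z \<in> U" for z
    proof -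
      have "(f has_derivative (\<lambda>w. (w + L *v (cjacobian s z *v w)) - 2 *\<^sub>R w)) (at z)"
        unfolding f_def by (intro has_derivative_diff d\<psi>[OF that] has_derivative_scaleR_right has_derivative_ident)
      moreover have "(w + L *v (cjacobian s z *v w)) - 2 *\<^sub>R w = A z *v w" for w
        by (simp add: A_def matrix_minus_mv scaleR_2 flip: matrix_vector_mul_assoc)
      ultimately show ?thesis by simp
    qed
    define N where "N z = (\<Sum>i\<in>UNIV. \<Sum>j\<in>UNIV. norm (A z $ i $ j))" for z
    have "continuous_on U (\<lambda>z. A z $ i $ j)" for i j
      unfolding A_def matrix_matrix_mult_def
      by (auto intro!: continuous_intros holomorphic_fun_on_continuous[OF cjacobian_entry_holomorphic[OF s(1)]])
    then have "continuous_on U N" unfolding N_def by (intro continuous_on_sum continuous_on_norm)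
    then have "isCont N p" using openU p(1) by (simp add: continuous_on_eq_continuous_at)
    moreover have "N p = 0"
    proof -
      have "A p *v w = 0 *v w" for w by (simp add: A_def matrix_minus_mv flip: matrix_vector_mul_assoc L_def) (simp add: LL)
      then have "A p = 0" by (simp add: matrix_eq)
      then show ?thesis by (simp add: N_def)
    qed
    ultimately obtain e1 where e1: "0 < e1" "\<And>z. dist z p < e1 \<Longrightarrow> dist (N z) 0 < 1"
      unfolding continuous_at_eps_delta by (metis zero_less_one)
    obtain e2 where e2: "0 < e2" "ball p e2 \<subseteq> U \<inter> V"
      using openU isolated(1,2) p(1) by (meson Int_iff open_Int openE)
    define e where "e = min e1 e2"
    have e: "0 < e" "ball p e \<subseteq> U" "ball p e \<subseteq> V" using e1(1) e2 by (auto simp: e_def)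
    have inj: "x = y" if "x \<in> ball p e" "y \<in> ball p e" "\<psi> x = \<psi> y" for x y
    proof -
      have "norm (f x - f y) \<le> 1 * norm (x - y)"
      proof (rule differentiable_bound[OF convex_ball _ _ that(1,2)])
        fix z assume z: "z \<in> ball p e"
        then show "(f has_derivative (\<lambda>w. A z *v w)) (at z within ball p e)"
          using df e(2) by (blast intro: has_derivative_at_withinI)
        have "N z \<le> 1" using e1(2)[of z] z by (simp add: e_def dist_commute)
        then show "onorm (\<lambda>w. A z *v w) \<le> 1"
        proof (intro onorm_bound)
          fix w
          have "norm (A z *v w) \<le> N z * norm w" unfolding N_def by (rule norm_matrix_vector_le)
          also have "\<dots> \<le> 1 * norm w" using \<open>N z \<le> 1\<close> by (intro mult_right_mono) auto
          finally show "norm (A z *v w) \<le> 1 * norm w" .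
        qed simp
      qed
      moreover have "f x - f y = - (2 *\<^sub>R (x - y))" using that(3) by (simp add: f_def algebra_simps)
      ultimately have "2 * norm (x - y) \<le> norm (x - y)" by simp
      then show ?thesis by simp
    qed
    obtain e3 where e3: "0 < e3" "e3 \<le> e" "\<And>z. dist z p < e3 \<Longrightarrow> s z \<in> ball p e"
    proof -
      have "isCont s p" using der[OF p(1)] by (rule has_derivative_continuous)
      then obtain d where "0 < d" "\<And>z. dist z p < d \<Longrightarrow> dist (s z) (s p) < e"
        unfolding continuous_at_eps_delta using e(1) by metis
      then show ?thesis using that[of "min d e"] e(1) by (simp add: p(2) dist_commute)
    qed
    \<comment> \<open>Openness of \<open>\<psi>\<close> at \<open>p\<close> writes every small
      vector fixed by \<open>L\<close> as \<open>\<psi> z\<close> with \<open>z\<close> close to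
      \<open>p\<close>.\<close>
    have "\<psi> p \<in> interior (\<psi> ` ball p e3)"
    proof (rule sussmann_open_mapping[OF openU _ p(1) d\<psi>[OF p(1)], of "\<lambda>w. w /\<^sub>R 2"])
      show "continuous_on U \<psi>" using d\<psi> by (meson continuous_at_imp_continuous_on has_derivative_continuous)
      show "ball p e3 \<subseteq> U" using e(2) e3(2) by auto
      show "p \<in> interior (ball p e3)" using e3(1) by simp
      show "(\<lambda>w. w + L *v (cjacobian s p *v w)) \<circ> (\<lambda>w. w /\<^sub>R 2) = id"
        by (simp add: fun_eq_iff LL flip: L_def scaleR_2)
    qed (rule bounded_linear_scaleR_right)
    moreover have "\<psi> p = 0" by (simp add: \<psi>_def p(2))
    ultimately obtain \<delta> where \<delta>: "0 < \<delta>" "ball 0 \<delta> \<subseteq> \<psi> ` ball p e3"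
      using mem_interior by metis
    define w where "w = (\<delta> / 2 / norm v) *\<^sub>R v"
    have w: "w \<noteq> 0" "w \<in> ball 0 \<delta>" "L *v w = w"
      using v \<delta>(1) by (simp_all add: w_def linear_cmul[OF linear_matrix_vector])
    then obtain z where z: "z \<in> ball p e3" "\<psi> z = w" using \<delta>(2) by (metis imageE subsetD)
    then have zU: "z \<in> U" "z \<in> V" "z \<in> ball p e" using e e3(2) by auto
    have "\<psi> (s z) = L *v \<psi> z"
      by (simp add: \<psi>_def s(3)[OF zU(1)] matrix_vector_right_distrib LL)
    then have "\<psi> (s z) = \<psi> z" using z(2) w(3) by simp
    then have "s z = z" using inj e3(3) z(1) zU(3) by (simp add: dist_commute)
    then have "z = p" using isolated(3) zU by blast
    then show False using z(2) w(1) \<open>\<psi> p = 0\<close> by simp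
  qed
  moreover have "L *v (L *v v + v) = L *v v + v" by (simp add: matrix_vector_right_distrib LL add.commute)
  ultimately have "L *v v + v = 0" by blast
  then show ?thesis unfolding L_def by (simp add: eq_neg_iff_add_eq_0)
qed

section \<open>Bounded symmetric domains with polynomial kernel\<close>

text \<open>The remainder depends only on a common bound \<open>R\<close> of the coefficients, which
  makes the later estimates uniform in \<open>z\<close>. The condition \<open>4 R t \<le> 1\<close>
  keeps the denominator at least \<open>1/2\<close>; the \<open>12\<close> is the \<open>6\<close>
  that bounds the remaining numerator times the resulting \<open>2\<close>.\<close>

lemma quotient_expansion:
  fixes n0 n1 n2 h1 h2 :: complex and t R :: real
  assumes R: "1 \<le> R" "norm n0 \<le> R" "norm n1 \<le> R" "norm n2 \<le> R" "norm h1 \<le> R" "norm h2 \<le> R"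
    and t: "0 \<le> t" "4 * R * t \<le> 1"
  defines "H \<equiv> 1 + t * h1 + t\<^sup>2 * h2"
  shows "1 / 2 \<le> norm H"
    and "norm ((n0 + t * n1 + t\<^sup>2 * n2) / H - (n0 + t * (n1 - n0 * h1))) \<le> 12 * R ^ 3 * t\<^sup>2"
proof -
  have Rt: "R * t \<le> 1 / 4" using t by simp
  have t1: "t \<le> 1" using t mult_right_mono[OF R(1) t(1)] by simp
  have t2: "t\<^sup>2 \<le> t" using t(1) t1 by (simp add: power2_eq_square mult_left_le)
  have "norm (t * h1 + t\<^sup>2 * h2) \<le> t * R + t\<^sup>2 * R"
    using R t(1) by (intro norm_triangle_le add_mono) (auto simp: norm_mult norm_power intro!: mult_left_mono)
  also have "\<dots> \<le> t * R + t * R" using t2 R(1) by (intro add_mono mult_right_mono) auto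
  finally have "norm (t * h1 + t\<^sup>2 * h2) \<le> 1 / 2" using Rt by (simp add: mult.commute)
  moreover have "1 \<le> norm H + norm (t * h1 + t\<^sup>2 * h2)"
    using norm_triangle_ineq4[of H "t * h1 + t\<^sup>2 * h2"] by (simp add: H_def)
  ultimately show H: "1 / 2 \<le> norm H" by linarith
  then have H0: "H \<noteq> 0" by auto
  define q where "q = n1 - n0 * h1"
  define e where "e = n2 - h1 * q - h2 * (n0 + t * q)"
  have "(n0 + t * n1 + t\<^sup>2 * n2) - H * (n0 + t * q) = t\<^sup>2 * e"
    by (simp add: H_def q_def e_def algebra_simps power2_eq_square)
  then have eq: "(n0 + t * n1 + t\<^sup>2 * n2) / H - (n0 + t * q) = t\<^sup>2 * e / H"
    using H0 by (simp add: field_simps)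
  have RR: "R \<le> R\<^sup>2" "R\<^sup>2 \<le> R ^ 3" using R(1) by (simp_all add: power_increasing[of 1 2 R, simplified] power_increasing)
  have q: "norm q \<le> 2 * R\<^sup>2"
  proof -
    have "norm q \<le> R + R * R" unfolding q_def
      using R by (intro norm_triangle_le_diff add_mono) (auto simp: norm_mult intro!: mult_mono)
    then show ?thesis using RR by (simp add: power2_eq_square)
  qed
  have n: "norm (n0 + t * q) \<le> 2 * R\<^sup>2"
  proof -
    have "t * norm q \<le> t * (2 * R\<^sup>2)" using q t(1) by (rule mult_left_mono)
    also have "\<dots> = 2 * (R * t) * R" by (simp add: power2_eq_square)
    also have "\<dots> \<le> 2 * (1 / 4) * R" using Rt R(1) by (intro mult_right_mono mult_left_mono) auto
    finally have "norm (n0 + t * q) \<le> R + R"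
      using R t(1) by (intro norm_triangle_le) (auto simp: norm_mult)
    then show ?thesis using RR by simp
  qed
  have "norm e \<le> R + R * (2 * R\<^sup>2) + R * (2 * R\<^sup>2)"
    unfolding e_def
    using R q n by (intro norm_triangle_le_diff add_mono) (auto simp: norm_mult intro!: mult_mono)
  moreover have "R * (2 * R\<^sup>2) = 2 * R ^ 3" by (simp add: power2_eq_square power3_eq_cube)
  ultimately have "norm e \<le> 6 * R ^ 3" using RR R(1) by linarith
  then have "norm (t\<^sup>2 * e / H) \<le> t\<^sup>2 * (6 * R ^ 3) / (1 / 2)"
    unfolding norm_divide norm_mult norm_power norm_of_real
    using H R(1) t(1) by (intro frac_le mult_mono) auto
  then show "norm ((n0 + t * n1 + t\<^sup>2 * n2) / H - (n0 + t * (n1 - n0 * h1))) \<le> 12 * R ^ 3 * t\<^sup>2"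
    unfolding eq[unfolded q_def] by (simp add: mult_ac)
qed

context polynomial_kernel begin

lemma has_derivative_h: "((\<lambda>p. h (fst p) (snd p)) has_derivative (\<lambda>u. hz z w (fst u) + cnj (hz w z (snd u)))) (at (z, w))"
proof -
  have G1: "((\<lambda>p. G l (fst p)) has_derivative (\<lambda>u. fd (G l) z (fst u))) (at (z, w))"
    and G2: "((\<lambda>p. cnj (G l (snd p))) has_derivative (\<lambda>u. cnj (fd (G l) w (snd u)))) (at (z, w))" if "l < M" for l
    using has_derivative_compose[OF has_derivative_fst[OF has_derivative_ident] has_derivative_fd[OF twice_holomorphic_G[OF that], of "fst (z, w)"]]
      has_derivative_compose[OF has_derivative_snd[OF has_derivative_ident] has_derivative_fd[OF twice_holomorphic_G[OF that], of "snd (z, w)"]]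
    by (auto intro: has_derivative_cnj)
  have T: "((\<lambda>p. (-1) ^ d l * G l (fst p) * cnj (G l (snd p))) has_derivative
      (\<lambda>u. (-1) ^ d l * (G l z * cnj (fd (G l) w (snd u)) + fd (G l) z (fst u) * cnj (G l w)))) (at (z, w))" if "l < M" for l
    using has_derivative_mult_right[OF has_derivative_mult[OF G1[OF that] G2[OF that]], of "(-1) ^ d l"] by (simp add: mult.assoc)
  have c1: "((\<lambda>p. fst p $ j) has_derivative (\<lambda>u. fst u $ j)) (at (z, w))"
    and c2: "((\<lambda>p. cnj (snd p $ j)) has_derivative (\<lambda>u. cnj (snd u $ j))) (at (z, w))" for j
    by (intro has_derivative_cnj bounded_linear.has_derivative[OF bounded_linear_vec_nth] has_derivative_fst has_derivative_snd has_derivative_ident)+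
  have "((\<lambda>p. hip (fst p) (snd p)) has_derivative (\<lambda>u. hip z (snd u) + hip (fst u) w)) (at (z, w))"
    unfolding hip_def sum.distrib[symmetric] using has_derivative_mult[OF c1 c2] by (intro has_derivative_sum) simp
  note hip = this
  have "((\<lambda>p. \<Sum>l<M. (-1) ^ d l * G l (fst p) * cnj (G l (snd p))) has_derivative
      (\<lambda>u. \<Sum>l<M. (-1) ^ d l * (G l z * cnj (fd (G l) w (snd u)) + fd (G l) z (fst u) * cnj (G l w)))) (at (z, w))"
    by (intro has_derivative_sum T) simp
  from has_derivative_add[OF has_derivative_diff[OF has_derivative_const hip] this, of 1]
  have "((\<lambda>p. h (fst p) (snd p)) has_derivative (\<lambda>u. 0 - (hip z (snd u) + hip (fst u) w) +
      (\<Sum>l<M. (-1) ^ d l * (G l z * cnj (fd (G l) w (snd u)) + fd (G l) z (fst u) * cnj (G l w))))) (at (z, w))"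
    by (simp add: h_eq)
  then show ?thesis
    by (rule has_derivative_eq_rhs) (simp add: hz_def fun_eq_iff sum.distrib cnj_hip algebra_simps)
qed

lemma has_vector_derivative_h:
  assumes "(\<gamma> has_vector_derivative u) (at t within S)" "(\<eta> has_vector_derivative v) (at t within S)"
  shows "((\<lambda>t. h (\<gamma> t) (\<eta> t)) has_vector_derivative hz (\<gamma> t) (\<eta> t) u + cnj (hz (\<eta> t) (\<gamma> t) v)) (at t within S)"
proof -
  have "((\<lambda>t. (\<gamma> t, \<eta> t)) has_derivative (\<lambda>x. (x *\<^sub>R u, x *\<^sub>R v))) (at t within S)"
    using assms unfolding has_vector_derivative_def by (rule has_derivative_Pair)
  from has_derivative_compose[OF this has_derivative_h]
  have "((\<lambda>t. h (\<gamma> t) (\<eta> t)) has_derivative (\<lambda>x. hz (\<gamma> t) (\<eta> t) (x *\<^sub>R u) + cnj (hz (\<eta> t) (\<gamma> t) (x *\<^sub>R v)))) (at t within S)"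
    by simp
  then show ?thesis unfolding has_vector_derivative_def
    by (rule has_derivative_eq_rhs)
      (simp add: fun_eq_iff scaleR_vec_complex hz_scale scaleR_conv_of_real algebra_simps)
qed

lemma hz_0: "hz 0 w u = - hip u w" "hz z 0 u = 0"
  using fd_0 G_0 by (simp_all add: hz_def)

lemma h_minus: "h (- z) (- w) = h z w"
proof -
  have "G l (- z) = (-1) ^ d l * G l z" if "l < M" for l z
    using homogeneous_poly_scale[OF hom[OF that], of "-1" z] by (simp add: vector_sneg_minus1[symmetric])
  then have "G l (- z) * cnj (G l (- w)) = G l z * cnj (G l w)" if "l < M" for l
    using that by (simp add: mult_ac power_mult_distrib[symmetric] flip: mult.assoc)
  then show ?thesis by (simp add: h_eq hip_minus_left hip_minus_right mult.assoc)
qed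

lemma trip_minus: "trip (- z) a (- z) = trip z a z"
proof -
  have "trip (- x) a y = - trip x a y" for x y using trip_scale_left[of "-1" x a y] by (simp add: vector_sneg_minus1[symmetric])
  then show ?thesis by (metis minus_minus trip_sym)
qed

lemma trip_diff: "trip y a y - trip z a z = trip (y - z) a y + trip z a (y - z)"
proof -
  have "trip y a y = trip (y - z) a y + trip z a y" by (metis diff_add_cancel trip_add_left)
  moreover have "trip z a y = trip z a (y - z) + trip z a z" by (metis diff_add_cancel trip_add_left trip_sym)
  ultimately show ?thesis by simp
qed

end

text \<open>The derivatives of the powers share the nonzero factor \<open>m * P 0 ^ (m - 1)\<close>.
  They are one-sided because the transvections are controlled for \<open>t \<ge> 0\<close>
  only.\<close>

lemma power_derivative_cancel:
  fixes P Q :: "real \<Rightarrow> complex"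
  assumes m: "1 \<le> m" and \<delta>: "0 < \<delta>"
    and P: "(P has_vector_derivative P') (at 0 within {0..\<delta>})" and Q: "(Q has_vector_derivative Q') (at 0 within {0..\<delta>})"
    and eq: "\<And>t. 0 \<le> t \<Longrightarrow> t \<le> \<delta> \<Longrightarrow> P t ^ m = Q t ^ m" and 0: "P 0 = Q 0" "P 0 \<noteq> 0"
  shows "P' = Q'"
proof -
  have pw: "((\<lambda>t. f t ^ m) has_vector_derivative f' * (of_nat m * f 0 ^ (m - 1))) (at 0 within {0..\<delta>})"
    if "(f has_vector_derivative f') (at 0 within {0..\<delta>})" for f :: "real \<Rightarrow> complex" and f'
  proof -
    have "((\<lambda>x. x ^ m) has_field_derivative of_nat m * f 0 ^ (m - 1)) (at (f 0))"
      by (auto intro!: derivative_eq_intros)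
    from field_vector_diff_chain_within[OF that has_field_derivative_at_within[OF this]] show ?thesis by (simp add: o_def)
  qed
  have "((\<lambda>t. P t ^ m) has_vector_derivative Q' * (of_nat m * Q 0 ^ (m - 1))) (at 0 within {0..\<delta>})"
    using has_vector_derivative_transform[OF _ _ pw[OF Q], of "\<lambda>t. P t ^ m"] eq \<delta> by simp
  then have "P' * (of_nat m * P 0 ^ (m - 1)) = Q' * (of_nat m * Q 0 ^ (m - 1))"
    using vector_derivative_unique_within_closed_interval[OF \<delta>, of 0, unfolded cbox_interval, OF _ pw[OF P]] \<delta> by simp
  then show ?thesis using 0 m by simp
qed

section \<open>Symmetries of the domain in Bergman's representative coordinates\<close>

locale hc_domain = polynomial_kernel M d G h
  for M d and G :: "nat \<Rightarrow> complex^'N \<Rightarrow> complex" and h +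
  fixes \<Omega> :: "(complex^'N) set" and c :: real and m :: nat
  assumes open_\<Omega>: "open \<Omega>" and connected_\<Omega>: "connected \<Omega>" and bounded_\<Omega>: "bounded \<Omega>"
    and zero_in_\<Omega>: "0 \<in> \<Omega>" and minus_in_\<Omega>: "\<And>z. z \<in> \<Omega> \<Longrightarrow> - z \<in> \<Omega>"
    and symmetric: "\<And>p. p \<in> \<Omega> \<Longrightarrow> \<exists>s. holomorphic_map_on s \<Omega> \<and> s ` \<Omega> \<subseteq> \<Omega> \<and> (\<forall>z\<in>\<Omega>. s (s z) = z) \<and> s p = p \<and>
        (\<exists>V. open V \<and> p \<in> V \<and> (\<forall>z\<in>V \<inter> \<Omega>. s z = z \<longrightarrow> z = p))"
    and cm: "0 < c" "1 \<le> m"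
    and kernel: "is_bergman_kernel \<Omega> (\<lambda>z \<xi>. complex_of_real c * h z \<xi> powi (- int m))"
begin

lemma h_diag: assumes "z \<in> \<Omega>" shows "h z z \<noteq> 0"
  using bergman_kernel_diagonal[OF kernel assms bounded_\<Omega> open_\<Omega>] cm by (auto simp: power_int_0_left_if)

definition symmetry_at :: "complex^'N \<Rightarrow> complex^'N \<Rightarrow> complex^'N" where
  "symmetry_at p = (SOME s. holomorphic_map_on s \<Omega> \<and> s ` \<Omega> \<subseteq> \<Omega> \<and> (\<forall>z\<in>\<Omega>. s (s z) = z) \<and> s p = p \<and>
        (\<exists>V. open V \<and> p \<in> V \<and> (\<forall>z\<in>V \<inter> \<Omega>. s z = z \<longrightarrow> z = p)))"

text \<open>The derivative of \<open>log h z p\<close> in the conjugate of \<open>p\<close>. As with Bergman's representative coordinates, the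
  symmetry at \<open>p\<close> acts on it, up to an additive constant, as \<open>-1\<close>.\<close>

definition "bergman_coord p z v = cnj (hz p z v) / h z p"

context
  fixes p assumes p: "p \<in> \<Omega>"
begin

abbreviation "s \<equiv> symmetry_at p"

lemma symmetry_at:
  "holomorphic_map_on s \<Omega>" "z \<in> \<Omega> \<Longrightarrow> s z \<in> \<Omega>" "z \<in> \<Omega> \<Longrightarrow> s (s z) = z" "s p = p" "cjacobian s p *v v = - v"
proof -
  have *: "holomorphic_map_on s \<Omega> \<and> s ` \<Omega> \<subseteq> \<Omega> \<and> (\<forall>z\<in>\<Omega>. s (s z) = z) \<and> s p = p \<and>
        (\<exists>V. open V \<and> p \<in> V \<and> (\<forall>z\<in>V \<inter> \<Omega>. s z = z \<longrightarrow> z = p))"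
    using someI_ex[OF symmetric[OF p]] by (simp add: symmetry_at_def)
  then obtain V where V: "open V" "p \<in> V" "\<forall>z\<in>V \<inter> \<Omega>. s z = z \<longrightarrow> z = p" by (elim conjE exE)
  note 1 = *[THEN conjunct2, THEN conjunct1] *[THEN conjunct2, THEN conjunct2, THEN conjunct1]
  show 2: "holomorphic_map_on s \<Omega>" "s p = p"
    by (fact *[THEN conjunct1] *[THEN conjunct2, THEN conjunct2, THEN conjunct2, THEN conjunct1])+
  show "z \<in> \<Omega> \<Longrightarrow> s z \<in> \<Omega>" using 1(1) by (rule subsetD[OF _ imageI])
  show "z \<in> \<Omega> \<Longrightarrow> s (s z) = z" using 1(2) by (rule bspec)
  show "cjacobian s p *v v = - v"
    by (rule symmetry_derivative[OF 2(1) 1(1) bspec[OF 1(2)] p 2(2) V(1,2) mp[OF bspec[OF V(3)]]])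
qed

text \<open>The transformation law is taken at \<open>(z, w)\<close>, \<open>(z, p)\<close>,
  \<open>(p, w)\<close> and \<open>(p, p)\<close>; as \<open>p\<close> is fixed, the Jacobian
  factors cancel from the combination. The power \<open>m\<close> remains because the kernel is a
  multiple of \<open>h\<close> to the power \<open>- m\<close>.\<close>

lemma symmetry_law:
  assumes z: "z \<in> \<Omega>" and w: "w \<in> \<Omega>"
  shows "(h (s z) (s w) * (h z p * h p w)) ^ m = (h z w * (h (s z) p * h p (s w))) ^ m"
proof -
  obtain J where J: "\<And>z. z \<in> \<Omega> \<Longrightarrow> J z \<noteq> 0"
    "\<And>z w. z \<in> \<Omega> \<Longrightarrow> w \<in> \<Omega> \<Longrightarrow> c * h (s z) w powi (- int m) * J z = cnj (J w) * (c * h z (s w) powi (- int m))"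
    using bergman_involution[OF kernel symmetry_at(1) _ symmetry_at(3)] symmetry_at(2) by (metis image_subsetI)
  define j where "j w = cnj (J (s w))" for w
  have j0: "j w \<noteq> 0" if "w \<in> \<Omega>" for w using J(1) symmetry_at(2)[OF that] by (simp add: j_def)
  have law: "h (s z) (s w) ^ m * j w = J z * h z w ^ m" if "z \<in> \<Omega>" "w \<in> \<Omega>" for z w
  proof -
    have "c * h (s z) (s w) powi (- int m) * J z = j w * (c * h z w powi (- int m))"
      using J(2)[OF that(1) symmetry_at(2)[OF that(2)]] symmetry_at(3)[OF that(2)] by (simp add: j_def)
    then have e: "inverse (h (s z) (s w) ^ m) * J z = j w * inverse (h z w ^ m)"
      using cm(1) by (simp add: power_int_minus mult_ac)
    show ?thesis
    proof (cases "h z w = 0 \<or> h (s z) (s w) = 0")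
      \<comment> \<open>As \<open>inverse 0 = 0\<close>, the law itself shows that one of the two
        values of \<open>h\<close> vanishes only together with the other.\<close>
      case True
      then have "h z w = 0" "h (s z) (s w) = 0" using e J(1)[OF that(1)] j0[OF that(2)] cm(2) by (auto simp: power_0_left)
      then show ?thesis using cm(2) by (simp add: power_0_left)
    next
      case False
      then show ?thesis using e by (simp add: field_simps)
    qed
  qed
  have sp: "s p = p" by (rule symmetry_at(4))
  have 1: "h (s z) p ^ m * j p = J z * h z p ^ m" using law[OF z p] sp by simp
  have 2: "h p (s w) ^ m * j w = J p * h p w ^ m" using law[OF p w] sp by simp
  have 3: "j p = J p" using law[OF p p] sp h_diag[OF p] by simp
  have cancel: "x * (u * v) * (a * b) = y * (q * r) * (a * b)"
    if "x * a = A * y" "q * b = A * u" "r * a = B * v" "b = B" for x y u v q r a b A B :: complex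
    using that by algebra
  have "(h (s z) (s w) * (h z p * h p w)) ^ m * (j w * j p) = (h z w * (h (s z) p * h p (s w))) ^ m * (j w * j p)"
    unfolding power_mult_distrib by (rule cancel[OF law[OF z w] 1 2 3])
  then show ?thesis using j0 p w by simp
qed

text \<open>Derivative of \<open>symmetry_law\<close> in \<open>w\<close> at \<open>w = p\<close> in
  direction \<open>v\<close>, where the symmetry has derivative \<open>-1\<close>.\<close>

lemma bergman_coord_symmetry:
  assumes z: "z \<in> \<Omega>" and nz: "h z p \<noteq> 0" "h (s z) p \<noteq> 0"
  shows "bergman_coord p (s z) v + bergman_coord p z v = 2 * bergman_coord p p v"
proof -
  obtain e where e: "0 < e" "ball p e \<subseteq> \<Omega>" using open_\<Omega> p openE by blast
  define \<delta> where "\<delta> = e / 2 / (norm v + 1)"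
  have v1: "0 < norm v + 1" by (simp add: add_nonneg_pos)
  have \<delta>: "0 < \<delta>" using e(1) v1 by (simp add: \<delta>_def)
  have in\<Omega>: "p + t *\<^sub>R v \<in> \<Omega>" if "0 \<le> t" "t \<le> \<delta>" for t
  proof -
    have "norm (t *\<^sub>R v) \<le> \<delta> * (norm v + 1)" unfolding norm_scaleR using that by (intro mult_mono) auto
    also have "\<delta> * (norm v + 1) = e / 2" using v1 unfolding \<delta>_def by (metis less_irrefl nonzero_eq_divide_eq)
    also have "\<dots> < e" using e(1) by simp
    finally show ?thesis using e(2) by (auto simp: dist_norm)
  qed
  let ?A = "at (0::real) within {0..\<delta>}"
  have d: "((\<lambda>t. p + t *\<^sub>R v) has_vector_derivative v) ?A" 
    by (auto intro!: derivative_eq_intros)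
  have ds: "((\<lambda>t. s (p + t *\<^sub>R v)) has_vector_derivative - v) ?A"
  proof -
    have "(s has_derivative (\<lambda>v. - v)) (at (p + 0 *\<^sub>R v))"
      using has_derivative_cjacobian[OF symmetry_at(1) p] by (simp add: symmetry_at(5))
    from has_derivative_compose[OF d[unfolded has_vector_derivative_def] this]
    show ?thesis by (simp add: has_vector_derivative_def)
  qed
  note const = has_vector_derivative_const
  define N where "N z = cnj (hz p z v)" for z
  have Nm: "cnj (hz p z (- v)) = - N z" for z unfolding N_def using hz_scale[of p z "-1" v] by (simp add: vector_sneg_minus1[symmetric])
  have z0: "hz x y 0 = 0" for x y using hz_scale[of x y 0 0] by simp
  have D: "((\<lambda>t. h x (p + t *\<^sub>R v)) has_vector_derivative N x) ?A" for x
    using has_vector_derivative_h[OF const d, of x] by (simp add: z0 N_def)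
  have Ds: "((\<lambda>t. h x (s (p + t *\<^sub>R v))) has_vector_derivative - N x) ?A" for x
    using has_vector_derivative_h[OF const ds, of x] by (simp add: z0 Nm symmetry_at(4))
  have "h (s z) p * (h z p * N p) + (- N (s z)) * (h z p * h p p) =
      h z p * (h (s z) p * (- N p)) + N z * (h (s z) p * h p p)"
  proof (rule power_derivative_cancel[OF cm(2) \<delta>])
    show "((\<lambda>t. h (s z) (s (p + t *\<^sub>R v)) * (h z p * h p (p + t *\<^sub>R v))) has_vector_derivative
        h (s z) p * (h z p * N p) + (- N (s z)) * (h z p * h p p)) ?A"
      using has_vector_derivative_mult[OF Ds has_vector_derivative_mult_right[OF D]] by (simp add: symmetry_at(4))
    show "((\<lambda>t. h z (p + t *\<^sub>R v) * (h (s z) p * h p (s (p + t *\<^sub>R v)))) has_vector_derivative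
        h z p * (h (s z) p * (- N p)) + N z * (h (s z) p * h p p)) ?A"
      using has_vector_derivative_mult[OF D has_vector_derivative_mult_right[OF Ds]] by (simp add: symmetry_at(4))
  qed (use symmetry_law[OF z in\<Omega>] nz h_diag[OF p] in \<open>auto simp: symmetry_at(4)\<close>)
  then have "2 * N p * (h (s z) p * h z p) = (N (s z) * h z p + N z * h (s z) p) * h p p" by algebra
  then show ?thesis using nz h_diag[OF p] by (simp add: bergman_coord_def N_def[symmetric] field_simps)
qed

end

end

lemma norm_vec_le_card:
  fixes x :: "complex^'a"
  assumes "\<And>i. norm (x $ i) \<le> C" shows "norm x \<le> real CARD('a) * C"
proof -
  have "norm x \<le> (\<Sum>i\<in>UNIV. norm (x $ i))" unfolding norm_vec_def by (rule L2_set_le_sum) simp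
  also have "\<dots> \<le> (\<Sum>i\<in>(UNIV :: 'a set). C)" by (intro sum_mono assms)
  finally show ?thesis by simp
qed

text \<open>Bookkeeping for \<open>transvection_expansion\<close>: \<open>b\<close>,
  \<open>b'\<close>, \<open>b''\<close> are the coordinates of \<open>y\<close>, \<open>- z\<close>
  and \<open>t a\<close>, and each of the three brackets on the right is the error of a first-order
  expansion.\<close>

lemma transvection_identity:
  fixes y z :: "'a::real_vector"
  assumes "b + b' = 2 *\<^sub>R b''"
  shows "y - z - (2 * t) *\<^sub>R (a - T) = (b + y + t *\<^sub>R T') + (b' + - z + t *\<^sub>R T) - 2 *\<^sub>R (b'' + t *\<^sub>R a + t *\<^sub>R t\<^sup>2 *\<^sub>R T'')
    + (2 * t ^ 3) *\<^sub>R T'' - t *\<^sub>R (T' - T)"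
proof -
  have "b = 2 *\<^sub>R b'' - b'" using assms by (simp add: algebra_simps)
  then show ?thesis by (simp add: algebra_simps power2_eq_square power3_eq_cube flip: scaleR_add_left)
qed

section \<open>Expansion of the kernel along a ray\<close>

context polynomial_kernel begin

lemma hz_zero: "hz z w 0 = 0"
  using hz_scale[of z w 0 0] by simp

text \<open>The coefficient of \<open>t\<close> and the cofactors of \<open>t^2\<close> when the
  second point is \<open>t a\<close>. A term of degree \<open>d\<close> enters the derivative of
  \<open>h\<close> with \<open>t^(d - 1)\<close>; for \<open>d = 2\<close> this is the linear part,
  so that the truncated exponent \<open>d - 3\<close> is kept for \<open>d \<ge> 3\<close>.\<close>

definition "coord_lin a z v = (\<Sum>l<M. if d l = 2 then G l z * cnj (fd (G l) a v) else 0)"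
definition "coord_rest t a z v = (\<Sum>l<M. if d l = 2 then 0 else (-1) ^ d l * of_real t ^ (d l - 3) * (G l z * cnj (fd (G l) a v)))"
definition "kernel_rest t a z = (\<Sum>l<M. (-1) ^ d l * of_real t ^ (d l - 2) * (G l z * cnj (G l a)))"

lemma hz_ray: "cnj (hz (t *\<^sub>R a) z v) = - hip z v + t * coord_lin a z v + t\<^sup>2 * coord_rest t a z v"
proof -
  have "cnj (hz (t *\<^sub>R a) z v) = - hip z v + (\<Sum>l<M. (-1) ^ d l * cnj (fd (G l) (t *\<^sub>R a) v) * G l z)"
    by (simp add: hz_def cnj_hip)
  also have "(\<Sum>l<M. (-1) ^ d l * cnj (fd (G l) (t *\<^sub>R a) v) * G l z) =
      (\<Sum>l<M. t * (if d l = 2 then G l z * cnj (fd (G l) a v) else 0) +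
        t\<^sup>2 * (if d l = 2 then 0 else (-1) ^ d l * of_real t ^ (d l - 3) * (G l z * cnj (fd (G l) a v))))"
  proof (rule sum.cong[OF refl])
    fix l assume l: "l \<in> {..<M}"
    then obtain n where n: "d l = Suc (Suc n)" using degree_Suc[of l] by auto
    have "fd (G l) (t *\<^sub>R a) v = of_real t ^ Suc n * fd (G l) a v"
      unfolding scaleR_vec_complex using fd_homogeneous_Suc[of "Suc n" "G l"] hom[of l] l n by simp
    then show "(-1) ^ d l * cnj (fd (G l) (t *\<^sub>R a) v) * G l z = t * (if d l = 2 then G l z * cnj (fd (G l) a v) else 0) +
        t\<^sup>2 * (if d l = 2 then 0 else (-1) ^ d l * of_real t ^ (d l - 3) * (G l z * cnj (fd (G l) a v)))"
      using n by (cases n) (simp_all add: power2_eq_square mult_ac)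
  qed
  finally show ?thesis by (simp add: sum.distrib sum_distrib_left coord_lin_def coord_rest_def add.assoc)
qed

lemma h_ray: "h z (t *\<^sub>R a) = 1 + t * (- hip z a) + t\<^sup>2 * kernel_rest t a z"
proof -
  have "(\<Sum>l<M. (-1) ^ d l * G l z * cnj (G l (t *\<^sub>R a))) = (\<Sum>l<M. t\<^sup>2 * ((-1) ^ d l * of_real t ^ (d l - 2) * (G l z * cnj (G l a))))"
  proof (rule sum.cong[OF refl])
    fix l assume l: "l \<in> {..<M}"
    then obtain n where n: "d l = Suc (Suc n)" using degree_Suc[of l] by auto
    show "(-1) ^ d l * G l z * cnj (G l (t *\<^sub>R a)) = t\<^sup>2 * ((-1) ^ d l * of_real t ^ (d l - 2) * (G l z * cnj (G l a)))"
      unfolding scaleR_vec_complex using homogeneous_poly_scale[OF hom[of l], of t a] l n by (simp add: power2_eq_square mult_ac)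
  qed
  then show ?thesis unfolding h_eq scaleR_vec_complex by (simp add: kernel_rest_def hip_scale_right sum_distrib_left)
qed

text \<open>The left side is the coefficient of \<open>t\<close> in the quotient defining
  \<open>bergman_coord (t *\<^sub>R a) z v\<close>. This is how the triple product enters the
  symmetries.\<close>

lemma coord_lin: "coord_lin a z v - (- hip z v) * (- hip z a) = - hip (trip z a z) v"
proof -
  have "coord_lin a z v = (\<Sum>l\<in>Q2. G l z * cnj (fd (G l) a v))"
    unfolding coord_lin_def Q2_def by (simp add: sum.If_cases Int_def)
  moreover have "(\<Sum>l\<in>Q2. fd (G l) z z * cnj (fd (G l) a v)) = 2 * (\<Sum>l\<in>Q2. G l z * cnj (fd (G l) a v))"
    unfolding sum_distrib_left by (rule sum.cong) (simp_all add: fd_Q2 mult.assoc)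
  ultimately have "2 * hip (trip z a z) v = 2 * (hip z a * hip z v) - 2 * coord_lin a z v"
    using hip_trip[of z a z v] by simp
  then show ?thesis by algebra
qed

lemma coord_rest_bound:
  assumes "0 \<le> t" "t \<le> 1" "\<And>l. l < M \<Longrightarrow> norm (G l z) \<le> B" "0 \<le> B"
  shows "norm (coord_lin a z v) \<le> (\<Sum>l<M. B * norm (fd (G l) a v))" "norm (coord_rest t a z v) \<le> (\<Sum>l<M. B * norm (fd (G l) a v))"
    "norm (kernel_rest t a z) \<le> (\<Sum>l<M. B * norm (G l a))"
proof -
  have p: "norm ((-1 :: complex) ^ m * of_real t ^ n * (x * cnj y)) \<le> B * norm y" if "norm x \<le> B" for m n x y
  proof -
    have "norm ((-1 :: complex) ^ m * of_real t ^ n * (x * cnj y)) = t ^ n * (norm x * norm y)"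
      using assms(1) by (simp add: norm_mult norm_power)
    also have "\<dots> \<le> 1 * (B * norm y)"
      using assms that by (intro mult_mono power_le_one) auto
    finally show ?thesis by simp
  qed
  show "norm (coord_lin a z v) \<le> (\<Sum>l<M. B * norm (fd (G l) a v))" unfolding coord_lin_def
    using assms by (intro sum_norm_le) (auto simp: norm_mult intro!: mult_right_mono)
  show "norm (coord_rest t a z v) \<le> (\<Sum>l<M. B * norm (fd (G l) a v))" unfolding coord_rest_def
    using assms p by (intro sum_norm_le) (auto split: if_split simp del: norm_mult)
  show "norm (kernel_rest t a z) \<le> (\<Sum>l<M. B * norm (G l a))" unfolding kernel_rest_def
    using assms p by (intro sum_norm_le) auto
qed

end

section \<open>Transvections and the invariance of the kernel\<close>

context hc_domain begin

lemma bounds: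
  obtains B where "1 \<le> B" "\<And>z. z \<in> \<Omega> \<Longrightarrow> norm z \<le> B" "\<And>z l. z \<in> \<Omega> \<Longrightarrow> l < M \<Longrightarrow> norm (G l z) \<le> B"
proof -
  obtain B0 where B0: "\<And>z. z \<in> \<Omega> \<Longrightarrow> norm z \<le> B0" using bounded_\<Omega> by (auto simp: bounded_iff)
  have "\<exists>b. \<forall>z\<in>\<Omega>. norm (G l z) \<le> b" if "l < M" for l
  proof -
    have "compact (G l ` closure \<Omega>)"
      using bounded_\<Omega> continuous_on_twice_holomorphic[OF twice_holomorphic_G[OF that]] by (intro compact_continuous_image) auto
    then have "bounded (G l ` closure \<Omega>)" by (rule compact_imp_bounded)
    then obtain b where "\<forall>x\<in>G l ` closure \<Omega>. norm x \<le> b" by (auto simp: bounded_iff)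
    then show ?thesis using closure_subset[of \<Omega>] by blast
  qed
  then obtain b where b: "\<And>l z. l < M \<Longrightarrow> z \<in> \<Omega> \<Longrightarrow> norm (G l z) \<le> b l" by metis
  define B where "B = 1 + \<bar>B0\<bar> + (\<Sum>l<M. \<bar>b l\<bar>)"
  have S: "0 \<le> (\<Sum>l<M. \<bar>b l\<bar>)" by (rule sum_nonneg) simp
  show ?thesis
  proof (rule that[of B])
    show "1 \<le> B" using S by (simp add: B_def)
    show "norm z \<le> B" if "z \<in> \<Omega>" for z using S B0[OF that] unfolding B_def by linarith
    show "norm (G l z) \<le> B" if "z \<in> \<Omega>" "l < M" for z l
    proof -
      have "\<bar>b l\<bar> \<le> (\<Sum>l<M. \<bar>b l\<bar>)" using that by (intro member_le_sum) auto
      then show ?thesis using b[OF that(2,1)] unfolding B_def by linarith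
    qed
  qed
qed

text \<open>One constant \<open>R\<close> bounds all coefficients on the bounded domain, so
  \<open>quotient_expansion\<close> applies uniformly: the coordinates of \<open>z\<close> at
  \<open>t a\<close> are \<open>- z - t {z a z}\<close> up to an error quadratic in
  \<open>t\<close>.\<close>

lemma bergman_coord_expansion:
  obtains C \<delta> where "0 \<le> C" "0 < \<delta>"
    "\<And>z t. z \<in> \<Omega> \<Longrightarrow> 0 \<le> t \<Longrightarrow> t \<le> \<delta> \<Longrightarrow> h z (t *\<^sub>R a) \<noteq> 0"
    "\<And>z t i. z \<in> \<Omega> \<Longrightarrow> 0 \<le> t \<Longrightarrow> t \<le> \<delta> \<Longrightarrow>
      norm (bergman_coord (t *\<^sub>R a) z (axis i 1) + z $ i + t * trip z a z $ i) \<le> C * t\<^sup>2"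
proof -
  obtain B where B: "1 \<le> B" "\<And>z. z \<in> \<Omega> \<Longrightarrow> norm z \<le> B" "\<And>z l. z \<in> \<Omega> \<Longrightarrow> l < M \<Longrightarrow> norm (G l z) \<le> B" by (rule bounds) blast
  define s where "s v = (\<Sum>l<M. B * norm (fd (G l) a v))" for v
  define R where "R = B * (1 + (\<Sum>i\<in>UNIV. norm (a $ i))) + (\<Sum>l<M. B * norm (G l a)) + (\<Sum>i\<in>UNIV. s (axis i 1))"
  have n0: "0 \<le> (\<Sum>i\<in>UNIV. norm (a $ i))" "0 \<le> (\<Sum>l<M. B * norm (G l a))" "0 \<le> s v" "0 \<le> (\<Sum>i\<in>UNIV. s (axis i 1))" for v
    unfolding s_def using B(1) by (auto intro!: sum_nonneg)
  have Ba: "0 \<le> B * (\<Sum>i\<in>UNIV. norm (a $ i))" using B(1) n0 by simp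
  have R: "1 \<le> R" "B \<le> R" "B * (\<Sum>i\<in>UNIV. norm (a $ i)) \<le> R" "(\<Sum>l<M. B * norm (G l a)) \<le> R"
    using n0(1,2,4) B(1) Ba unfolding R_def distrib_left mult_1_right by linarith+
  have Rs: "s (axis i 1) \<le> R" for i
  proof -
    have "s (axis i 1) \<le> (\<Sum>i\<in>UNIV. s (axis i 1))" using n0 by (intro member_le_sum) auto
    then show ?thesis using n0(2) Ba B(1) unfolding R_def distrib_left by linarith
  qed
  have ev: "1 / 2 \<le> norm (h z (t *\<^sub>R a))"
    "norm (bergman_coord (t *\<^sub>R a) z (axis i 1) + z $ i + t * trip z a z $ i) \<le> 12 * R ^ 3 * t\<^sup>2"
    if z: "z \<in> \<Omega>" and t: "0 \<le> t" "t \<le> 1 / (4 * R)" for z t i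
  proof -
    have t4: "4 * R * t \<le> 1" using t(2) R(1) by (simp add: field_simps)
    moreover have "t \<le> 4 * R * t" using R(1) t(1) by (simp add: mult_le_cancel_right1)
    ultimately have t1: "t \<le> 1" by linarith
    note cr = coord_rest_bound[OF t(1) t1 B(3)[OF z], of a, folded s_def]
    have e1: "norm (- hip z (axis i 1)) \<le> R"
      using B(2)[OF z] Finite_Cartesian_Product.norm_nth_le[of z i] R(2) by (simp add: hip_axis)
    have "norm (hip z a) \<le> (\<Sum>i\<in>UNIV. B * norm (a $ i))" unfolding hip_def
      using order_trans[OF Finite_Cartesian_Product.norm_nth_le B(2)[OF z]] by (intro sum_norm_le) (auto simp: norm_mult intro!: mult_right_mono)
    then have e2: "norm (- hip z a) \<le> R" using R(3) by (simp add: sum_distrib_left)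
    have e3: "norm (coord_lin a z (axis i 1)) \<le> R" "norm (coord_rest t a z (axis i 1)) \<le> R" "norm (kernel_rest t a z) \<le> R"
      using cr(1)[of "axis i 1"] cr(2)[of "axis i 1"] cr(3) Rs[of i] R(4) B(1) by auto
    note q = quotient_expansion[OF R(1) e1 e3(1,2) e2 e3(3) t(1) t4, unfolded of_real_power]
    show "1 / 2 \<le> norm (h z (t *\<^sub>R a))" using q(1) by (simp only: h_ray)
    have eq: "bergman_coord (t *\<^sub>R a) z (axis i 1) + z $ i + t * trip z a z $ i =
      cnj (hz (t *\<^sub>R a) z (axis i 1)) / h z (t *\<^sub>R a) - (- hip z (axis i 1) + t * (coord_lin a z (axis i 1) - (- hip z (axis i 1)) * (- hip z a)))"
      unfolding coord_lin by (simp add: bergman_coord_def hip_axis)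
    show "norm (bergman_coord (t *\<^sub>R a) z (axis i 1) + z $ i + t * trip z a z $ i) \<le> 12 * R ^ 3 * t\<^sup>2"
      using q(2) unfolding eq hz_ray h_ray .
  qed
  show ?thesis
  proof (rule that[of "12 * R ^ 3" "1 / (4 * R)"])
    show "h z (t *\<^sub>R a) \<noteq> 0" if "z \<in> \<Omega>" "0 \<le> t" "t \<le> 1 / (4 * R)" for z t
      using ev(1)[OF that] by auto
  qed (use R(1) ev(2) in auto)
qed

text \<open>By \<open>bergman_coord_symmetry\<close> the coordinates of the image \<open>y\<close>
  and of \<open>- z\<close> add up to twice those of \<open>t a\<close>. Inserting their expansions
  gives \<open>y - z = 2 t (a - {z a z}) - t ({y a y} - {z a z})\<close> up to order
  \<open>t^2\<close>.\<close>

lemma transvection_expansion: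
  obtains C \<delta> where "0 < \<delta>" "\<And>t. 0 \<le> t \<Longrightarrow> t \<le> \<delta> \<Longrightarrow> t *\<^sub>R a \<in> \<Omega>"
    "\<And>z t. z \<in> \<Omega> \<Longrightarrow> 0 \<le> t \<Longrightarrow> t \<le> \<delta> \<Longrightarrow>
      norm (symmetry_at (t *\<^sub>R a) (- z) - z - (2 * t) *\<^sub>R quad_field a z) \<le> C * t\<^sup>2"
proof -
  obtain C \<delta>1 where C: "0 \<le> C" "0 < \<delta>1"
    "\<And>z t. z \<in> \<Omega> \<Longrightarrow> 0 \<le> t \<Longrightarrow> t \<le> \<delta>1 \<Longrightarrow> h z (t *\<^sub>R a) \<noteq> 0"
    "\<And>z t i. z \<in> \<Omega> \<Longrightarrow> 0 \<le> t \<Longrightarrow> t \<le> \<delta>1 \<Longrightarrow>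
      norm (bergman_coord (t *\<^sub>R a) z (axis i 1) + z $ i + t * trip z a z $ i) \<le> C * t\<^sup>2"
    by (rule bergman_coord_expansion) blast
  obtain e where e: "0 < e" "ball 0 e \<subseteq> \<Omega>" using open_\<Omega> zero_in_\<Omega> openE by blast
  obtain B where B: "1 \<le> B" "\<And>z. z \<in> \<Omega> \<Longrightarrow> norm z \<le> B" "\<And>z l. z \<in> \<Omega> \<Longrightarrow> l < M \<Longrightarrow> norm (G l z) \<le> B" by (rule bounds) blast
  obtain K where K: "0 < K" "\<And>x y. norm (trip x a y) \<le> norm x * norm y * K" by (rule trip_bound) blast
  define \<delta> where "\<delta> = min 1 (min \<delta>1 (e / 2 / (norm a + 1)))"
  have a1: "0 < norm a + 1" by (simp add: add_nonneg_pos)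
  have \<delta>: "0 < \<delta>" "\<delta> \<le> 1" "\<delta> \<le> \<delta>1" using e(1) a1 C(2) by (auto simp: \<delta>_def)
  have in\<Omega>: "t *\<^sub>R a \<in> \<Omega>" if "0 \<le> t" "t \<le> \<delta>" for t
  proof -
    have "norm (t *\<^sub>R a) \<le> e / 2 / (norm a + 1) * (norm a + 1)"
      unfolding norm_scaleR using that a1 e(1) by (intro mult_mono) (auto simp: \<delta>_def)
    also have "\<dots> = e / 2" using a1 by (metis less_irrefl nonzero_eq_divide_eq)
    also have "\<dots> < e" using e(1) by simp
    finally show ?thesis using e(2) by auto
  qed
  define n where "n = real CARD('N)"
  define T where "T z = trip z a z" for z
  \<comment> \<open>Four copies of the bound on \<open>E\<close>, for \<open>y\<close>,
    \<open>- z\<close> and twice \<open>t a\<close>, and the cubic term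
    \<open>2 t^3 T a\<close>.\<close>
  define C1 where "C1 = 4 * n * C + 2 * norm (T a)"
  have T: "norm (T z) \<le> K * B\<^sup>2" if "z \<in> \<Omega>" for z
  proof -
    have "norm (T z) \<le> norm z * norm z * K" unfolding T_def by (rule K)
    also have "\<dots> \<le> B * B * K" using B(1) B(2)[OF that] K(1) by (intro mult_mono) auto
    finally show ?thesis by (simp add: power2_eq_square mult_ac)
  qed
  define C2 where "C2 = C1 + 2 * norm a + 2 * (K * B\<^sup>2) + 2 * (K * B\<^sup>2)"
  have n: "0 \<le> n" by (simp add: n_def)
  have C1: "0 \<le> C1" using C(1) n by (simp add: C1_def)
  show ?thesis
  proof (rule that[of \<delta> "C1 + C2 * (2 * B * K)"])
    fix z t assume z: "z \<in> \<Omega>" and t: "0 \<le> t" "t \<le> \<delta>"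
    define y where "y = symmetry_at (t *\<^sub>R a) (- z)"
    define E where "E x = (\<chi> i. bergman_coord (t *\<^sub>R a) x (axis i 1)) + x + t *\<^sub>R T x" for x
    have y: "y \<in> \<Omega>" unfolding y_def using in\<Omega>[OF t] minus_in_\<Omega>[OF z] by (rule symmetry_at(2))
    have E: "norm (E x) \<le> n * (C * t\<^sup>2)" if "x \<in> \<Omega>" for x
      unfolding n_def
    proof (rule norm_vec_le_card)
      fix i
      have "E x $ i = bergman_coord (t *\<^sub>R a) x (axis i 1) + x $ i + t * trip x a x $ i"
        by (simp only: E_def T_def vector_add_component vec_lambda_beta vector_scaleR_component scaleR_conv_of_real[where 'a = complex])
      then show "norm (E x $ i) \<le> C * t\<^sup>2" using C(4)[OF that t(1) order_trans[OF t(2) \<delta>(3)], of i] by (simp only:)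
    qed
    have Tm: "T (- z) = T z" by (simp add: T_def trip_minus)
    have Tt: "T (t *\<^sub>R a) = t\<^sup>2 *\<^sub>R T a" unfolding T_def scaleR_vec_complex
      by (simp only: trip_scale_left trip_sym[of a a "of_real t *s a"] vector_smult_assoc power2_eq_square of_real_mult)
    have "bergman_coord (t *\<^sub>R a) y v + bergman_coord (t *\<^sub>R a) (- z) v = 2 * bergman_coord (t *\<^sub>R a) (t *\<^sub>R a) v" for v
      unfolding y_def using C(3)[OF minus_in_\<Omega>[OF z] t(1)] C(3)[OF y t(1)] t(2) \<delta>(3)
      by (intro bergman_coord_symmetry in\<Omega>[OF t] minus_in_\<Omega>[OF z]) (auto simp: y_def)
    then have "(\<chi> i. bergman_coord (t *\<^sub>R a) y (axis i 1)) + (\<chi> i. bergman_coord (t *\<^sub>R a) (- z) (axis i 1)) =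
       2 *\<^sub>R (\<chi> i. bergman_coord (t *\<^sub>R a) (t *\<^sub>R a) (axis i 1))"
      by (simp only: vec_eq_iff vector_add_component vector_scaleR_component vec_lambda_beta scaleR_conv_of_real[where 'a = complex] of_real_numeral simp_thms)
    then have main: "y - z - (2 * t) *\<^sub>R quad_field a z = E y + E (- z) - 2 *\<^sub>R E (t *\<^sub>R a) + (2 * t ^ 3) *\<^sub>R T a - t *\<^sub>R (T y - T z)"
      unfolding E_def Tm Tt quad_field_def T_def[of z, symmetric] by (rule transvection_identity)
    show "norm (symmetry_at (t *\<^sub>R a) (- z) - z - (2 * t) *\<^sub>R quad_field a z) \<le> (C1 + C2 * (2 * B * K)) * t\<^sup>2"
    proof -
      have t1: "t \<le> 1" using t(2) \<delta>(2) by linarith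
      have t2: "t\<^sup>2 \<le> t" "t ^ 3 \<le> t\<^sup>2" using t(1) t1 by (simp_all add: power2_eq_square power3_eq_cube mult_left_le mult_mono)
      have "norm (E y + E (- z) - 2 *\<^sub>R E (t *\<^sub>R a)) \<le> n * (C * t\<^sup>2) + n * (C * t\<^sup>2) + 2 * (n * (C * t\<^sup>2))"
        using E[OF y] E[OF minus_in_\<Omega>[OF z]] E[OF in\<Omega>[OF t]] by (intro norm_triangle_le_diff norm_triangle_le add_mono) simp_all
      moreover have "norm ((2 * t ^ 3) *\<^sub>R T a) \<le> 2 * t\<^sup>2 * norm (T a)"
        unfolding norm_scaleR using t2 t(1) by (intro mult_right_mono) auto
      ultimately have "norm (E y + E (- z) - 2 *\<^sub>R E (t *\<^sub>R a) + (2 * t ^ 3) *\<^sub>R T a) \<le>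
          n * (C * t\<^sup>2) + n * (C * t\<^sup>2) + 2 * (n * (C * t\<^sup>2)) + 2 * t\<^sup>2 * norm (T a)"
        by (intro norm_triangle_le add_mono)
      also have "\<dots> = C1 * t\<^sup>2" by (simp add: C1_def algebra_simps)
      finally have EE: "norm (E y + E (- z) - 2 *\<^sub>R E (t *\<^sub>R a) + (2 * t ^ 3) *\<^sub>R T a) \<le> C1 * t\<^sup>2" .
      have m1: "norm (y - z - (2 * t) *\<^sub>R quad_field a z) \<le> C1 * t\<^sup>2 + t * norm (T y - T z)"
        unfolding main using EE t(1) by (intro norm_triangle_le_diff add_mono) simp_all
      \<comment> \<open>Bootstrap: boundedness of \<open>T\<close> first gives \<open>y - z\<close>
        of order \<open>t\<close>; then \<open>T y - T z\<close> is of order \<open>t\<close> too,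
        and its contribution drops to order \<open>t^2\<close>.\<close>
      have "norm (T y - T z) \<le> 2 * (K * B\<^sup>2)"
        using norm_triangle_ineq4[of "T y" "T z"] T[OF y] T[OF z] by linarith
      then have "t * norm (T y - T z) \<le> t * (2 * (K * B\<^sup>2))" using t(1) by (rule mult_left_mono)
      moreover have "C1 * t\<^sup>2 \<le> C1 * t" using C1 t2 by (intro mult_left_mono)
      moreover have "norm ((2 * t) *\<^sub>R quad_field a z) \<le> (2 * t) * (norm a + K * B\<^sup>2)"
        unfolding norm_scaleR quad_field_def T_def[symmetric]
        using t(1) T[OF z] by (intro mult_mono norm_triangle_le_diff add_left_mono) auto
      ultimately have "norm ((y - z - (2 * t) *\<^sub>R quad_field a z) + (2 * t) *\<^sub>R quad_field a z) \<le> C2 * t"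
        using m1 by (intro order_trans[OF norm_triangle_ineq]) (simp add: C2_def algebra_simps)
      then have yz: "norm (y - z) \<le> C2 * t" by simp
      have "norm (T y - T z) \<le> norm (y - z) * norm y * K + norm z * norm (y - z) * K"
        unfolding T_def trip_diff by (intro norm_triangle_le add_mono K)
      also have "\<dots> \<le> norm (y - z) * B * K + B * norm (y - z) * K"
        using K(1) B(2)[OF y] B(2)[OF z] by (intro add_mono mult_right_mono mult_left_mono) auto
      also have "\<dots> = norm (y - z) * (2 * B * K)" by (simp add: algebra_simps)
      also have "\<dots> \<le> (C2 * t) * (2 * B * K)" using yz K(1) B(1) by (intro mult_right_mono) auto
      finally have "t * norm (T y - T z) \<le> t * ((C2 * t) * (2 * B * K))" using t(1) by (rule mult_left_mono)
      then show ?thesis using m1 unfolding y_def[symmetric] by (simp add: algebra_simps power2_eq_square)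
    qed
  qed (use \<delta> in\<Omega> in auto)
qed

text \<open>At \<open>t = 0\<close> the error bound identifies the symmetry at the origin with
  \<open>z \<mapsto> - z\<close>; divided by \<open>t\<close> it yields the derivative.\<close>

lemma transvection_derivative:
  assumes z: "z \<in> \<Omega>"
    and \<delta>: "0 < \<delta>" "\<And>t. 0 \<le> t \<Longrightarrow> t \<le> \<delta> \<Longrightarrow>
      norm (symmetry_at (t *\<^sub>R a) (- z) - z - (2 * t) *\<^sub>R quad_field a z) \<le> C * t\<^sup>2"
  shows "symmetry_at 0 (- z) = z"
    and "((\<lambda>t. symmetry_at (t *\<^sub>R a) (- z)) has_vector_derivative 2 *\<^sub>R quad_field a z) (at 0 within {0..\<delta>})"
proof -
  show 0: "symmetry_at 0 (- z) = z" using \<delta>(2)[of 0] \<delta>(1) by simp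
  have "((\<lambda>t. norm (symmetry_at (t *\<^sub>R a) (- z) - z - t *\<^sub>R 2 *\<^sub>R quad_field a z) / norm t) \<longlongrightarrow> 0) (at 0 within {0..\<delta>})"
  proof (rule Lim_null_comparison)
    show "\<forall>\<^sub>F t in at 0 within {0..\<delta>}. norm (norm (symmetry_at (t *\<^sub>R a) (- z) - z - t *\<^sub>R 2 *\<^sub>R quad_field a z) / norm t) \<le> C * t"
      unfolding eventually_at_filter
    proof (intro always_eventually allI impI)
      fix t assume "t \<noteq> 0" "t \<in> {0..\<delta>}"
      then have t: "0 < t" "t \<le> \<delta>" by auto
      have "norm (symmetry_at (t *\<^sub>R a) (- z) - z - t *\<^sub>R 2 *\<^sub>R quad_field a z) \<le> C * t * t"
        using \<delta>(2)[of t] t by (simp add: power2_eq_square mult_ac)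
      then show "norm (norm (symmetry_at (t *\<^sub>R a) (- z) - z - t *\<^sub>R 2 *\<^sub>R quad_field a z) / norm t) \<le> C * t"
        using t by (simp add: divide_le_eq)
    qed
    have "((\<lambda>t. C * t) \<longlongrightarrow> C * 0) (at 0 within {0..\<delta>})" by (intro tendsto_intros)
    then show "((\<lambda>t. C * t) \<longlongrightarrow> 0) (at 0 within {0..\<delta>})" by simp
  qed
  then show "((\<lambda>t. symmetry_at (t *\<^sub>R a) (- z)) has_vector_derivative 2 *\<^sub>R quad_field a z) (at 0 within {0..\<delta>})"
    unfolding has_vector_derivative_def has_derivative_iff_norm
    using 0 by (simp add: bounded_linear_scaleR_left del: scaleR_scaleR)
qed

text \<open>Derivative at \<open>t = 0\<close> of \<open>symmetry_law\<close> with moving centre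
  \<open>t a\<close> at the points \<open>- z\<close> and \<open>- w\<close>. The factors containing
  the centre equal \<open>1\<close> at \<open>t = 0\<close>, and their derivatives produce the
  multiplier \<open>- (hip z a + hip a w)\<close>.\<close>

lemma star:
  assumes z: "z \<in> \<Omega>" and w: "w \<in> \<Omega>" and nz: "h z w \<noteq> 0"
  shows "hz z w (quad_field a z) + cnj (hz w z (quad_field a w)) = - (hip z a + hip a w) * h z w"
proof -
  obtain C \<delta> where \<delta>: "0 < \<delta>" "\<And>t. 0 \<le> t \<Longrightarrow> t \<le> \<delta> \<Longrightarrow> t *\<^sub>R a \<in> \<Omega>"
    "\<And>z t. z \<in> \<Omega> \<Longrightarrow> 0 \<le> t \<Longrightarrow> t \<le> \<delta> \<Longrightarrow>
      norm (symmetry_at (t *\<^sub>R a) (- z) - z - (2 * t) *\<^sub>R quad_field a z) \<le> C * t\<^sup>2"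
    by (rule transvection_expansion) blast
  define \<gamma> where "\<gamma> z t = symmetry_at (t *\<^sub>R a) (- z)" for z t
  let ?A = "at (0::real) within {0..\<delta>}"
  have \<gamma>: "\<gamma> z 0 = z" "(\<gamma> z has_vector_derivative 2 *\<^sub>R quad_field a z) ?A" if "z \<in> \<Omega>" for z
    using transvection_derivative[OF that \<delta>(1) \<delta>(3)[OF that]] unfolding \<gamma>_def by auto
  have p: "((\<lambda>t. t *\<^sub>R a) has_vector_derivative a) ?A"
    unfolding has_vector_derivative_def by (simp add: bounded_linear_imp_has_derivative bounded_linear_scaleR_left)
  note const = has_vector_derivative_const
  define A' where "A' = hz z w (2 *\<^sub>R quad_field a z) + cnj (hz w z (2 *\<^sub>R quad_field a w))"
  have A: "((\<lambda>t. h (\<gamma> z t) (\<gamma> w t)) has_vector_derivative A') ?A"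
    using has_vector_derivative_h[OF \<gamma>(2)[OF z] \<gamma>(2)[OF w]] by (simp add: A'_def \<gamma>(1) z w)
  have B1: "((\<lambda>t. h (- z) (t *\<^sub>R a)) has_vector_derivative hip z a) ?A"
    using has_vector_derivative_h[OF const p, of "- z"] by (simp add: hz_0 hz_zero cnj_hip hip_minus_left hip_minus_right)
  have B2: "((\<lambda>t. h (t *\<^sub>R a) (- w)) has_vector_derivative hip a w) ?A"
    using has_vector_derivative_h[OF p const, of "- w"] by (simp add: hz_0 hz_zero hip_minus_right)
  have C1: "((\<lambda>t. h (\<gamma> z t) (t *\<^sub>R a)) has_vector_derivative - hip z a) ?A"
    using has_vector_derivative_h[OF \<gamma>(2)[OF z] p] by (simp add: hz_0 \<gamma>(1) z cnj_hip)
  have C2: "((\<lambda>t. h (t *\<^sub>R a) (\<gamma> w t)) has_vector_derivative - hip a w) ?A"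
    using has_vector_derivative_h[OF p \<gamma>(2)[OF w]] by (simp add: hz_0 \<gamma>(1) w)
  have "h z w * (1 * hip a w + hip z a * 1) + A' * (1 * 1) = h z w * (1 * (- hip a w) + (- hip z a) * 1) + 0 * (1 * 1)"
  proof (rule power_derivative_cancel[OF cm(2) \<delta>(1)])
    show "((\<lambda>t. h (\<gamma> z t) (\<gamma> w t) * (h (- z) (t *\<^sub>R a) * h (t *\<^sub>R a) (- w))) has_vector_derivative
        h z w * (1 * hip a w + hip z a * 1) + A' * (1 * 1)) ?A"
      using has_vector_derivative_mult[OF A has_vector_derivative_mult[OF B1 B2]] by (simp add: h_0 \<gamma>(1) z w)
    show "((\<lambda>t. h z w * (h (\<gamma> z t) (t *\<^sub>R a) * h (t *\<^sub>R a) (\<gamma> w t))) has_vector_derivative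
        h z w * (1 * (- hip a w) + (- hip z a) * 1) + 0 * (1 * 1)) ?A"
      using has_vector_derivative_mult[OF const[of "h z w"] has_vector_derivative_mult[OF C1 C2]] by (simp add: h_0 \<gamma>(1) z w)
    show "(h (\<gamma> z t) (\<gamma> w t) * (h (- z) (t *\<^sub>R a) * h (t *\<^sub>R a) (- w))) ^ m =
        (h z w * (h (\<gamma> z t) (t *\<^sub>R a) * h (t *\<^sub>R a) (\<gamma> w t))) ^ m" if "0 \<le> t" "t \<le> \<delta>" for t
      using symmetry_law[OF \<delta>(2)[OF that] minus_in_\<Omega>[OF z] minus_in_\<Omega>[OF w]] by (simp only: \<gamma>_def h_minus)
  qed (use nz in \<open>simp_all add: h_0 \<gamma>(1) z w\<close>)
  then have "A' = - 2 * ((hip z a + hip a w) * h z w)" by algebra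
  moreover have "A' = 2 * (hz z w (quad_field a z) + cnj (hz w z (quad_field a w)))"
    unfolding A'_def scaleR_vec_complex by (simp add: hz_scale)
  ultimately show ?thesis by algebra
qed

end

sublocale hc_domain \<subseteq> transvection_domain M d G h \<Omega>
proof unfold_locales
  fix a
  obtain C \<delta> where \<delta>: "0 < \<delta>" "\<And>t. 0 \<le> t \<Longrightarrow> t \<le> \<delta> \<Longrightarrow> t *\<^sub>R a \<in> \<Omega>"
    "\<And>z t. z \<in> \<Omega> \<Longrightarrow> 0 \<le> t \<Longrightarrow> t \<le> \<delta> \<Longrightarrow>
      norm (symmetry_at (t *\<^sub>R a) (- z) - z - (2 * t) *\<^sub>R quad_field a z) \<le> C * t\<^sup>2"
    by (rule transvection_expansion) blast
  have "\<exists>g. continuous_on \<Omega> g \<and> g ` \<Omega> \<subseteq> \<Omega> \<and> (\<forall>z\<in>\<Omega>. norm (g z - z - (2 * t) *\<^sub>R quad_field a z) \<le> C * t\<^sup>2)"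
    if t: "0 < t" "t < \<delta>" for t
  proof (intro exI conjI ballI)
    have p: "t *\<^sub>R a \<in> \<Omega>" using \<delta>(2) t by simp
    show "(\<lambda>z. symmetry_at (t *\<^sub>R a) (- z)) ` \<Omega> \<subseteq> \<Omega>"
      using symmetry_at(2)[OF p minus_in_\<Omega>] by blast
    have "continuous_on \<Omega> (\<lambda>z. symmetry_at (t *\<^sub>R a) z $ i)" for i
      using symmetry_at(1)[OF p] by (auto simp: holomorphic_map_on_def intro: holomorphic_fun_on_continuous)
    from continuous_on_vec_lambda[of \<Omega> "\<lambda>i z. symmetry_at (t *\<^sub>R a) z $ i", OF this] have "continuous_on \<Omega> (symmetry_at (t *\<^sub>R a))" by simp
    then show "continuous_on \<Omega> (\<lambda>z. symmetry_at (t *\<^sub>R a) (- z))"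
      by (rule continuous_on_compose2) (auto intro!: continuous_intros minus_in_\<Omega>)
    show "norm (symmetry_at (t *\<^sub>R a) (- z) - z - (2 * t) *\<^sub>R quad_field a z) \<le> C * t\<^sup>2" if "z \<in> \<Omega>" for z
      using \<delta>(3)[OF that] t by simp
  qed
  then show "\<exists>C \<delta>. 0 < \<delta> \<and> (\<forall>t. 0 < t \<and> t < \<delta> \<longrightarrow>
      (\<exists>g. continuous_on \<Omega> g \<and> g ` \<Omega> \<subseteq> \<Omega> \<and>
         (\<forall>z\<in>\<Omega>. norm (g z - z - (2 * t) *\<^sub>R quad_field a z) \<le> C * t\<^sup>2)))"
    using \<delta>(1) by blast
qed (fact star open_\<Omega> connected_\<Omega> zero_in_\<Omega> h_diag)+

lemma bounded_linear_hip_left: "bounded_linear (\<lambda>z. hip z w)"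
  unfolding hip_def
  by (intro bounded_linear_sum bounded_linear_compose[OF bounded_linear_mult_left] bounded_linear_vec_nth)

section \<open>The metric of a polynomial kernel\<close>

context polynomial_kernel begin

text \<open>The mixed second derivative of \<open>h\<close>, along \<open>u\<close> in the first
  argument and along \<open>v\<close> in the conjugate of the second.\<close>

definition hzz :: "complex^'N \<Rightarrow> complex^'N \<Rightarrow> complex^'N \<Rightarrow> complex^'N \<Rightarrow> complex" where
  "hzz z w u v = - hip u v + (\<Sum>l<M. (-1) ^ d l * fd (G l) z u * cnj (fd (G l) w v))"

lemma hzz_scale: "hzz z w (c *s u) v = c * hzz z w u v"
  by (simp add: hzz_def hip_scale_left fd_scale[OF twice_holomorphic_G] algebra_simps sum_distrib_left cong: sum.cong_simp)

lemma hzz_sum_left: "(\<Sum>i\<in>UNIV. u $ i * hzz z w (axis i 1) v) = hzz z w u v"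
proof -
  have "(\<Sum>i\<in>UNIV. u $ i * hzz z w (axis i 1) v) =
    - (\<Sum>i\<in>UNIV. u $ i * hip (axis i 1) v) + (\<Sum>i\<in>UNIV. \<Sum>l<M. u $ i * ((-1) ^ d l * fd (G l) z (axis i 1) * cnj (fd (G l) w v)))"
    by (simp add: hzz_def algebra_simps sum.distrib sum_subtractf sum_distrib_left)
  also have "(\<Sum>i\<in>UNIV. \<Sum>l<M. u $ i * ((-1) ^ d l * fd (G l) z (axis i 1) * cnj (fd (G l) w v))) =
      (\<Sum>l<M. (-1) ^ d l * (\<Sum>i\<in>UNIV. u $ i * fd (G l) z (axis i 1)) * cnj (fd (G l) w v))"
    by (subst sum.swap) (simp add: sum_distrib_left sum_distrib_right mult_ac)
  also have "(\<Sum>i\<in>UNIV. u $ i * hip (axis i 1) v) = hip u v"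
    by (simp add: hip_axis_left hip_def[of u])
  finally show ?thesis unfolding hzz_def by (simp add: fd_basis[OF twice_holomorphic_G, symmetric] cong: sum.cong_simp)
qed

lemma hzz_cnj: "cnj (hzz z w u v) = hzz w z v u"
  by (simp add: hzz_def cnj_hip mult_ac)

lemma hzz_sum_right: "(\<Sum>j\<in>UNIV. cnj (v $ j) * hzz z w u (axis j 1)) = hzz z w u v"
proof -
  have "cnj (\<Sum>j\<in>UNIV. cnj (v $ j) * hzz z w u (axis j 1)) = (\<Sum>j\<in>UNIV. v $ j * hzz w z (axis j 1) u)"
    by (simp add: hzz_cnj)
  then have "cnj (\<Sum>j\<in>UNIV. cnj (v $ j) * hzz z w u (axis j 1)) = cnj (hzz z w u v)"
    by (simp add: hzz_sum_left hzz_cnj)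
  then show ?thesis by (simp only: complex_cnj_cancel_iff)
qed

lemma hz_sum: "(\<Sum>i\<in>UNIV. u $ i * hz z w (axis i 1)) = hz z w u"
proof -
  have "(\<Sum>i\<in>UNIV. u $ i * hz z w (axis i 1)) =
    - (\<Sum>i\<in>UNIV. u $ i * hip (axis i 1) w) + (\<Sum>i\<in>UNIV. \<Sum>l<M. u $ i * ((-1) ^ d l * fd (G l) z (axis i 1) * cnj (G l w)))"
    by (simp add: hz_def algebra_simps sum.distrib sum_subtractf sum_distrib_left)
  also have "(\<Sum>i\<in>UNIV. \<Sum>l<M. u $ i * ((-1) ^ d l * fd (G l) z (axis i 1) * cnj (G l w))) =
      (\<Sum>l<M. (-1) ^ d l * (\<Sum>i\<in>UNIV. u $ i * fd (G l) z (axis i 1)) * cnj (G l w))"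
    by (subst sum.swap) (simp add: sum_distrib_left sum_distrib_right mult_ac)
  also have "(\<Sum>i\<in>UNIV. u $ i * hip (axis i 1) w) = hip u w"
    by (simp add: hip_axis_left hip_def[of u])
  finally show ?thesis unfolding hz_def by (simp add: fd_basis[OF twice_holomorphic_G, symmetric] cong: sum.cong_simp)
qed

lemma h_diag_real: "h x x = of_real (Re (h x x))"
  using h_cnj[of x x] by (simp add: complex_eq_iff)

lemma potential_derivative:
  assumes "0 < Re (h x x)"
  shows "((\<lambda>t. complex_of_real (ln (Re (h (x + t *\<^sub>R v) (x + t *\<^sub>R v))))) has_vector_derivative
    (hz x x v + cnj (hz x x v)) / h x x) (at 0)"
proof -
  have d: "((\<lambda>t. x + t *\<^sub>R v) has_vector_derivative v) (at 0)"
    unfolding has_vector_derivative_def by (auto intro!: derivative_eq_intros)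
  have "((\<lambda>t. h (x + t *\<^sub>R v) (x + t *\<^sub>R v)) has_vector_derivative hz x x v + cnj (hz x x v)) (at 0)"
    using has_vector_derivative_h[OF d d] by simp
  then have "((\<lambda>t. Re (h (x + t *\<^sub>R v) (x + t *\<^sub>R v))) has_real_derivative Re (hz x x v + cnj (hz x x v))) (at 0)"
    unfolding has_real_derivative_iff_has_vector_derivative by (rule bounded_linear.has_vector_derivative[OF bounded_linear_Re])
  from DERIV_chain'[OF this DERIV_ln_divide] assms
  have "((\<lambda>t. ln (Re (h (x + t *\<^sub>R v) (x + t *\<^sub>R v)))) has_real_derivative 1 / Re (h x x) * Re (hz x x v + cnj (hz x x v))) (at 0)"
    by simp
  then have "((\<lambda>t. complex_of_real (ln (Re (h (x + t *\<^sub>R v) (x + t *\<^sub>R v))))) has_vector_derivative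
      of_real (1 / Re (h x x) * Re (hz x x v + cnj (hz x x v)))) (at 0)"
    unfolding has_real_derivative_iff_has_vector_derivative by (rule bounded_linear.has_vector_derivative[OF bounded_linear_of_real])
  moreover have "complex_of_real (1 / Re (h x x) * Re (hz x x v + cnj (hz x x v))) = (hz x x v + cnj (hz x x v)) / h x x"
    by (subst (2) h_diag_real) (simp add: complex_add_cnj)
  ultimately show ?thesis by simp
qed

lemma line_smult: "z + complex_of_real t *s v = z + t *\<^sub>R v" "z + (\<i> * complex_of_real t) *s v = z + t *\<^sub>R (\<i> *s v)"
  unfolding scaleR_vec_complex by (simp_all add: vector_smult_assoc mult.commute)

lemma dzbar_potential:
  assumes "0 < Re (h x x)"
  shows "dzbar j (\<lambda>x. complex_of_real (ln (Re (h x x)))) x = cnj (hz x x (axis j 1)) / h x x"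
  unfolding dzbar_def line_smult vector_derivative_at[OF potential_derivative[OF assms]]
  by (simp add: hz_scale add_divide_distrib[symmetric] algebra_simps)

text \<open>\<open>S\<close> collects the second derivatives in the conjugate variables alone. Its
  conjugate homogeneity is what makes \<open>dz\<close> annihilate it.\<close>

lemma hz_derivative:
  obtains S where "\<And>v. ((\<lambda>t. cnj (hz (z + t *\<^sub>R v) (z + t *\<^sub>R v) e)) has_vector_derivative hzz z z v e + S v) (at 0)"
    "\<And>c v. S (c *s v) = cnj c * S v"
proof -
  have "\<forall>l\<in>{..<M}. \<exists>D. ((\<lambda>z. fd (G l) z e) has_derivative D) (at z) \<and> (\<forall>c v. D (c *s v) = c * D v)"
  proof
    fix l assume "l \<in> {..<M}" then have l: "l < M" by simp
    obtain P'' where P: "\<And>z v. ((\<lambda>z. fd (G l) z v) has_derivative P'' z v) (at z)" "\<And>z v w. P'' z v w = P'' z w v"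
      using second_derivative_symmetric[OF twice_holomorphic_G[OF l]] by blast
    have "P'' z (c *s v) = (\<lambda>w. c * P'' z v w)" for c v
      using P(1)[of "c *s v" z] has_derivative_mult_right[OF P(1)[of v z], of c] has_derivative_unique
      by (simp add: fd_scale[OF twice_holomorphic_G[OF l]])
    then have "P'' z e (c *s v) = c * P'' z e v" for c v using P(2) by metis
    then show "\<exists>D. ((\<lambda>z. fd (G l) z e) has_derivative D) (at z) \<and> (\<forall>c v. D (c *s v) = c * D v)" using P(1) by blast
  qed
  from bchoice[OF this] obtain D where D: "\<And>l. l < M \<Longrightarrow> ((\<lambda>z. fd (G l) z e) has_derivative D l) (at z)"
    "\<And>l c v. l < M \<Longrightarrow> D l (c *s v) = c * D l v" by blast
  define S where "S v = (\<Sum>l<M. (-1) ^ d l * G l z * cnj (D l v))" for v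
  have line: "((\<lambda>t. z + t *\<^sub>R v) has_derivative (\<lambda>t. t *\<^sub>R v)) (at 0)" for v
    by (auto intro!: derivative_eq_intros)
  have "((\<lambda>t. cnj (hz (z + t *\<^sub>R v) (z + t *\<^sub>R v) e)) has_vector_derivative hzz z z v e + S v) (at 0)" for v
  proof -
    have g: "((\<lambda>t. G l (z + t *\<^sub>R v)) has_vector_derivative fd (G l) z v) (at 0)"
      and g': "((\<lambda>t. cnj (fd (G l) (z + t *\<^sub>R v) e)) has_vector_derivative cnj (D l v)) (at 0)" if l: "l < M" for l
    proof -
      have "((\<lambda>t. G l (z + t *\<^sub>R v)) has_derivative (\<lambda>t. fd (G l) z (t *\<^sub>R v))) (at 0)"
        using has_derivative_compose[OF line] has_derivative_fd[OF twice_holomorphic_G[OF l], of z] by simp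
      then show "((\<lambda>t. G l (z + t *\<^sub>R v)) has_vector_derivative fd (G l) z v) (at 0)"
        unfolding has_vector_derivative_def scaleR_vec_complex fd_scale[OF twice_holomorphic_G[OF l]] scaleR_conv_of_real .
      have "((\<lambda>t. fd (G l) (z + t *\<^sub>R v) e) has_derivative (\<lambda>t. D l (t *\<^sub>R v))) (at 0)"
        using has_derivative_compose[OF line] D(1)[OF l] by simp
      then have "((\<lambda>t. fd (G l) (z + t *\<^sub>R v) e) has_vector_derivative D l v) (at 0)"
        unfolding has_vector_derivative_def scaleR_vec_complex D(2)[OF l] scaleR_conv_of_real .
      then show "((\<lambda>t. cnj (fd (G l) (z + t *\<^sub>R v) e)) has_vector_derivative cnj (D l v)) (at 0)"
        by (rule has_vector_derivative_cnj)
    qed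
    have "((\<lambda>t. z + t *\<^sub>R v) has_vector_derivative v) (at 0)" using line by (simp only: has_vector_derivative_def)
    from bounded_linear.has_vector_derivative[OF bounded_linear_hip_left this, of e]
    have "((\<lambda>t. hip (z + t *\<^sub>R v) e) has_vector_derivative hip v e) (at 0)" .
    moreover have "((\<lambda>t. \<Sum>l<M. (-1) ^ d l * (G l (z + t *\<^sub>R v) * cnj (fd (G l) (z + t *\<^sub>R v) e))) has_vector_derivative
        (\<Sum>l<M. (-1) ^ d l * (G l z * cnj (D l v) + fd (G l) z v * cnj (fd (G l) z e)))) (at 0)"
      using has_vector_derivative_mult_right[OF has_vector_derivative_mult[OF g g']]
      by (intro has_vector_derivative_sum) simp
    ultimately have "((\<lambda>t. - hip (z + t *\<^sub>R v) e + (\<Sum>l<M. (-1) ^ d l * (G l (z + t *\<^sub>R v) * cnj (fd (G l) (z + t *\<^sub>R v) e)))) has_vector_derivative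
        - hip v e + (\<Sum>l<M. (-1) ^ d l * (G l z * cnj (D l v) + fd (G l) z v * cnj (fd (G l) z e)))) (at 0)"
      by (intro has_vector_derivative_add has_vector_derivative_minus)
    moreover have "cnj (hz x x e) = - hip x e + (\<Sum>l<M. (-1) ^ d l * (G l x * cnj (fd (G l) x e)))" for x
      by (simp add: hz_def cnj_hip mult_ac)
    moreover have "hzz z z v e + S v = - hip v e + (\<Sum>l<M. (-1) ^ d l * (G l z * cnj (D l v) + fd (G l) z v * cnj (fd (G l) z e)))"
      by (simp add: hzz_def S_def distrib_left sum.distrib mult.assoc)
    ultimately show ?thesis by (simp only:)
  qed
  moreover have "S (c *s v) = cnj c * S v" for c v
    unfolding S_def sum_distrib_left by (intro sum.cong refl) (simp add: D(2) mult_ac)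
  ultimately show ?thesis by (rule that)
qed

lemma dz_quotient:
  assumes S: "open S" "z \<in> S" "\<And>x. x \<in> S \<Longrightarrow> 0 < Re (h x x)"
  shows "dz i (dzbar j (\<lambda>x. complex_of_real (ln (Re (h x x))))) z =
    (hzz z z (axis i 1) (axis j 1) * h z z - cnj (hz z z (axis j 1)) * hz z z (axis i 1)) / (h z z)\<^sup>2"
proof -
  let ?e = "axis j 1 :: complex^'N"
  obtain T where T: "\<And>v. ((\<lambda>t. cnj (hz (z + t *\<^sub>R v) (z + t *\<^sub>R v) ?e)) has_vector_derivative hzz z z v ?e + T v) (at 0)"
    "\<And>c v. T (c *s v) = cnj c * T v" by (rule hz_derivative) blast
  have nz: "h z z \<noteq> 0" using S by fastforce
  have "((\<lambda>t. dzbar j (\<lambda>x. complex_of_real (ln (Re (h x x)))) (z + t *\<^sub>R v)) has_vector_derivative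
      ((hzz z z v ?e + T v) * h z z - cnj (hz z z ?e) * (hz z z v + cnj (hz z z v))) / (h z z)\<^sup>2) (at 0)" for v
  proof (rule has_vector_derivative_transform_within_open)
    have d: "((\<lambda>t. z + t *\<^sub>R v) has_vector_derivative v) (at 0)"
      unfolding has_vector_derivative_def by (auto intro!: derivative_eq_intros)
    have "((\<lambda>t. h (z + t *\<^sub>R v) (z + t *\<^sub>R v)) has_vector_derivative hz z z v + cnj (hz z z v)) (at 0)"
      using has_vector_derivative_h[OF d d] by simp
    then have "((\<lambda>t. inverse (h (z + t *\<^sub>R v) (z + t *\<^sub>R v))) has_vector_derivative
        (hz z z v + cnj (hz z z v)) * - (inverse (h z z ^ Suc (Suc 0)))) (at 0)"
      using field_vector_diff_chain_at[of _ _ 0 inverse] DERIV_inverse[OF nz, of UNIV] by (fastforce simp: o_def)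
    from has_vector_derivative_mult[OF T(1)[of v] this] nz
    show "((\<lambda>t. cnj (hz (z + t *\<^sub>R v) (z + t *\<^sub>R v) ?e) * inverse (h (z + t *\<^sub>R v) (z + t *\<^sub>R v))) has_vector_derivative
      ((hzz z z v ?e + T v) * h z z - cnj (hz z z ?e) * (hz z z v + cnj (hz z z v))) / (h z z)\<^sup>2) (at 0)"
      by (elim has_vector_derivative_eq_rhs) (simp add: field_simps power2_eq_square)
    show "open ((\<lambda>t. z + t *\<^sub>R v) -` S)" by (intro open_vimage S) (intro continuous_intros)
    show "0 \<in> (\<lambda>t. z + t *\<^sub>R v) -` S" using S by simp
    show "cnj (hz (z + y *\<^sub>R v) (z + y *\<^sub>R v) ?e) * inverse (h (z + y *\<^sub>R v) (z + y *\<^sub>R v)) =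
        dzbar j (\<lambda>x. complex_of_real (ln (Re (h x x)))) (z + y *\<^sub>R v)" if "y \<in> (\<lambda>t. z + t *\<^sub>R v) -` S" for y
      using dzbar_potential[OF S(3)] that by (simp add: divide_inverse)
  qed
  note D = vector_derivative_at[OF this]
  show ?thesis unfolding dz_def line_smult D
    unfolding hzz_scale hz_scale T(2) diff_divide_distrib[symmetric] times_divide_eq_right divide_divide_eq_left mult.commute[of _ 2]
    using nz by (simp add: field_simps)
qed

lemma metric_pairing_metric_of:
  assumes S: "open S" "z \<in> S" "\<And>x. x \<in> S \<Longrightarrow> 0 < Re (h x x)"
  shows "metric_pairing (metric_of h z) u v = - (hzz z z u v * h z z - hz z z u * cnj (hz z z v)) / (h z z)\<^sup>2"
proof -
  have "metric_pairing (metric_of h z) u v = (\<Sum>i\<in>UNIV. \<Sum>j\<in>UNIV. u $ i * (- (h z z / (h z z)\<^sup>2) * (cnj (v $ j) * hzz z z (axis i 1) (axis j 1)))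
     + (u $ i * hz z z (axis i 1)) * (cnj (v $ j * hz z z (axis j 1)) * (1 / (h z z)\<^sup>2)))"
    unfolding metric_pairing_def metric_of_def
    by (intro sum.cong refl) (simp add: dz_quotient[OF S] diff_divide_distrib algebra_simps)
  also have "\<dots> = (\<Sum>i\<in>UNIV. u $ i * hzz z z (axis i 1) v) * - (h z z / (h z z)\<^sup>2) + hz z z u * (cnj (hz z z v) * (1 / (h z z)\<^sup>2))"
    unfolding sum.distrib sum_distrib_left[symmetric] hzz_sum_right sum_distrib_right[symmetric] hz_sum cnj_sum[symmetric]
    by (simp add: sum_distrib_left sum_distrib_right mult_ac)
  also have "\<dots> = - (hzz z z u v * h z z - hz z z u * cnj (hz z z v)) / (h z z)\<^sup>2"
    unfolding hzz_sum_left by (simp add: diff_divide_distrib)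
  finally show ?thesis .
qed

end

section \<open>Polarization of the isometry equation\<close>

text \<open>Holomorphy in two variables tested on pairs of one-variable functions: closure under
  sums and products then comes from the one-variable rules, and \<open>polarization\<close>
  substitutes \<open>x + \<i> * y\<close> and \<open>x - \<i> * y\<close> with one of
  \<open>x\<close>, \<open>y\<close> held fixed.\<close>

definition jointly_holomorphic :: "real \<Rightarrow> (complex \<Rightarrow> complex \<Rightarrow> complex) \<Rightarrow> bool" where
  "jointly_holomorphic \<rho> n \<longleftrightarrow> (\<forall>\<phi> \<psi> U. open U \<and> \<phi> holomorphic_on U \<and> \<psi> holomorphic_on U \<and> \<phi> ` U \<subseteq> ball 0 \<rho> \<and> \<psi> ` U \<subseteq> ball 0 \<rho> \<longrightarrow>
     (\<lambda>x. n (\<phi> x) (\<psi> x)) holomorphic_on U)"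

named_theorems jointly_holomorphic

lemma jointly_holomorphic_const [jointly_holomorphic]: "jointly_holomorphic \<rho> (\<lambda>s t. c)"
  by (simp add: jointly_holomorphic_def)

lemma jointly_holomorphic_fst:
  assumes "\<alpha> holomorphic_on ball 0 \<rho>" shows "jointly_holomorphic \<rho> (\<lambda>s t. \<alpha> s)"
  unfolding jointly_holomorphic_def
  by (intro allI impI) (rule holomorphic_on_compose_gen[OF _ assms, unfolded o_def]; blast)

lemma jointly_holomorphic_snd:
  assumes "\<alpha> holomorphic_on ball 0 \<rho>" shows "jointly_holomorphic \<rho> (\<lambda>s t. \<alpha> t)"
  unfolding jointly_holomorphic_def
  by (intro allI impI) (rule holomorphic_on_compose_gen[OF _ assms, unfolded o_def]; blast)

text \<open>Two conjugations make the antiholomorphic slot of the kernel holomorphic in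
  \<open>t\<close>; on the diagonal \<open>t = cnj s\<close> the original expression
  returns.\<close>

lemma jointly_holomorphic_cnj:
  assumes "\<alpha> holomorphic_on ball 0 \<rho>" shows "jointly_holomorphic \<rho> (\<lambda>s t. cnj (\<alpha> (cnj t)))"
proof (rule jointly_holomorphic_snd)
  have "cnj ` ball 0 \<rho> \<subseteq> ball 0 \<rho>" by auto
  then have "\<alpha> holomorphic_on cnj ` ball 0 \<rho>" by (rule holomorphic_on_subset[OF assms])
  from holomorphic_on_compose_cnj_cnj[OF this] show "(\<lambda>t. cnj (\<alpha> (cnj t))) holomorphic_on ball 0 \<rho>" by (simp add: o_def)
qed

lemma jointly_holomorphicI:
  assumes "\<And>\<phi> \<psi> U. open U \<Longrightarrow> \<phi> holomorphic_on U \<Longrightarrow> \<psi> holomorphic_on U \<Longrightarrow> \<phi> ` U \<subseteq> ball 0 \<rho> \<Longrightarrow> \<psi> ` U \<subseteq> ball 0 \<rho> \<Longrightarrow>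
     (\<lambda>x. n (\<phi> x) (\<psi> x)) holomorphic_on U"
  shows "jointly_holomorphic \<rho> n"
  unfolding jointly_holomorphic_def by (intro allI impI, elim conjE) (rule assms; assumption)

lemma jointly_holomorphicD:
  assumes "jointly_holomorphic \<rho> n" "open U" "\<phi> holomorphic_on U" "\<psi> holomorphic_on U" "\<phi> ` U \<subseteq> ball 0 \<rho>" "\<psi> ` U \<subseteq> ball 0 \<rho>"
  shows "(\<lambda>x. n (\<phi> x) (\<psi> x)) holomorphic_on U"
  using assms(2-) by (intro assms(1)[unfolded jointly_holomorphic_def, rule_format] conjI)

lemma jointly_holomorphic_ops [jointly_holomorphic]:
  assumes "jointly_holomorphic \<rho> n"
  shows "jointly_holomorphic \<rho> (\<lambda>s t. - n s t)" "jointly_holomorphic \<rho> (\<lambda>s t. n s t ^ k)"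
    and "jointly_holomorphic \<rho> n' \<Longrightarrow> jointly_holomorphic \<rho> (\<lambda>s t. n s t + n' s t)"
    and "jointly_holomorphic \<rho> n' \<Longrightarrow> jointly_holomorphic \<rho> (\<lambda>s t. n s t - n' s t)"
    and "jointly_holomorphic \<rho> n' \<Longrightarrow> jointly_holomorphic \<rho> (\<lambda>s t. n s t * n' s t)"
  by (rule jointly_holomorphicI;
      intro holomorphic_on_add holomorphic_on_diff holomorphic_on_mult holomorphic_on_minus holomorphic_on_power
        jointly_holomorphicD[OF assms] jointly_holomorphicD[of \<rho> n']; assumption)+

lemma jointly_holomorphic_sum [jointly_holomorphic]:
  assumes "\<And>i. i \<in> I \<Longrightarrow> jointly_holomorphic \<rho> (n i)"
  shows "jointly_holomorphic \<rho> (\<lambda>s t. \<Sum>i\<in>I. n i s t)"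
  using assms by (induction I rule: infinite_finite_induct) (auto intro: jointly_holomorphic_const jointly_holomorphic_ops)

lemma vanishes_on_reals:
  assumes "g holomorphic_on ball 0 r" "0 < r" "\<And>x. \<bar>x\<bar> < r \<Longrightarrow> g (of_real x) = 0" "w \<in> ball 0 r"
  shows "g w = 0"
proof (rule analytic_continuation[OF assms(1)])
  let ?U = "complex_of_real ` {x. \<bar>x\<bar> < r}"
  show "?U \<subseteq> ball 0 r" by auto
  show "0 islimpt ?U" unfolding islimpt_approachable
  proof (intro allI impI)
    fix e :: real assume "0 < e"
    then have r: "0 < min e r / 2" "min e r / 2 < r" "min e r / 2 < e" using assms(2) by auto
    then have "complex_of_real (min e r / 2) \<in> ?U" by (intro imageI) simp
    moreover have "complex_of_real x \<noteq> 0" "dist (complex_of_real x) 0 < e" if "0 < x" "x < e" for x using that by auto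
    ultimately have "complex_of_real (min e r / 2) \<in> ?U" "complex_of_real (min e r / 2) \<noteq> 0" "dist (complex_of_real (min e r / 2)) 0 < e"
      using r by blast+
    then show "\<exists>x'\<in>?U. x' \<noteq> 0 \<and> dist x' 0 < e" by blast
  qed
qed (use assms in auto)

text \<open>Write \<open>s = x + \<i> y\<close>, \<open>t = x - \<i> y\<close>: the hypothesis says that \<open>n\<close> vanishes for real \<open>x\<close> and \<open>y\<close>.\<close>

lemma polarization:
  assumes n: "jointly_holomorphic \<rho> n" and z: "\<And>s. norm s < \<rho> \<Longrightarrow> n s (cnj s) = 0" and s: "norm s < \<rho>"
  shows "n s 0 = 0"
proof -
  have \<rho>: "0 < \<rho> / 2" using s norm_ge_zero[of s] by linarith
  have in_ball: "x + \<i> * y \<in> ball 0 \<rho>" "x - \<i> * y \<in> ball 0 \<rho>" if "norm x < \<rho> / 2" "norm y < \<rho> / 2" for x y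
    using norm_triangle_ineq[of x "\<i> * y"] norm_triangle_ineq4[of x "\<i> * y"] that by (auto simp: norm_mult)
  have hol: "(\<lambda>x. n (x + \<i> * y) (x - \<i> * y)) holomorphic_on ball 0 (\<rho> / 2)"
    "(\<lambda>x. n (y + \<i> * x) (y - \<i> * x)) holomorphic_on ball 0 (\<rho> / 2)" if "norm y < \<rho> / 2" for y
    using that in_ball by (auto intro!: n[unfolded jointly_holomorphic_def, rule_format] holomorphic_intros)
  have 1: "n (x + \<i> * of_real y) (x - \<i> * of_real y) = 0" if x: "norm x < \<rho> / 2" and y: "\<bar>y\<bar> < \<rho> / 2" for x y
  proof (rule vanishes_on_reals[OF hol(1) \<rho>, of "of_real y"])
    fix r :: real assume "\<bar>r\<bar> < \<rho> / 2"
    then show "n (of_real r + \<i> * of_real y) (of_real r - \<i> * of_real y) = 0"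
      using z[of "of_real r + \<i> * of_real y"] in_ball(1)[of "of_real r" "of_real y"] y by simp
  qed (use x y in auto)
  have "n (s / 2 + \<i> * (s / (2 * \<i>))) (s / 2 - \<i> * (s / (2 * \<i>))) = 0"
  proof (rule vanishes_on_reals[OF hol(2) \<rho>])
    show "n (s / 2 + \<i> * of_real y) (s / 2 - \<i> * of_real y) = 0" if "\<bar>y\<bar> < \<rho> / 2" for y
      using 1[of "s / 2" y] that s by (simp add: norm_divide)
  qed (use s in \<open>auto simp: norm_divide norm_mult\<close>)
  then show ?thesis by simp
qed

lemma polynomial_kernel_h_ball: "polynomial_kernel 0 d G h_ball"
  by unfold_locales (simp_all add: h_ball_def hip_def)

lemma metric_pairing_h_ball:
  fixes z :: "complex^'n"
  assumes "z \<in> ball 0 1"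
  shows "metric_pairing (metric_of h_ball z) u v = (hip u v * (1 - hip z z) + hip u z * hip z v) / (1 - hip z z)\<^sup>2"
proof -
  interpret b: polynomial_kernel 0 "\<lambda>_. 2" "\<lambda>_ _. 0" "h_ball :: complex^'n \<Rightarrow> _" by (rule polynomial_kernel_h_ball)
  have pos: "0 < Re (h_ball x x)" if "x \<in> ball 0 1" for x :: "complex^'n"
    using that by (simp add: b.h_eq hip_self power_less_one_iff abs_square_less_1)
  show ?thesis
    using b.metric_pairing_metric_of[OF open_ball assms pos, of u v]
    by (simp add: b.h_eq b.hz_def b.hzz_def cnj_hip)
qed

lemma holomorphic_on_line:
  assumes F: "holomorphic_fun_on F S" and S: "\<And>s. norm s < \<rho> \<Longrightarrow> s *s v \<in> S"
  shows "(\<lambda>s. F (s *s v)) holomorphic_on ball 0 \<rho>"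
  unfolding holomorphic_on_open[OF open_ball]
  using has_field_derivative_line[OF F, of 0 _ v] S by fastforce

lemma holomorphic_directional_chain:
  assumes f: "holomorphic_map_on f S" and P: "twice_holomorphic P"
  shows "holomorphic_fun_on (\<lambda>z. fd P (f z) (cjacobian f z *v u)) S"
proof -
  have oS: "open S" by (rule holomorphic_map_on_open[OF f])
  have e: "holomorphic_fun_on (\<lambda>z. fd P (f z) (axis i 1)) S" for i
    by (rule holomorphic_fun_on_compose[OF f subset_UNIV], rule holomorphic_directional)
      (use P has_derivative_fd[OF P] fd_scale[OF P] in \<open>auto intro: holomorphic_fun_onI[where D = "fd P"]\<close>)
  have "fd P (f z) (cjacobian f z *v u) = (\<Sum>i\<in>UNIV. (\<Sum>j\<in>UNIV. cjacobian f z $ i $ j * u $ j) * fd P (f z) (axis i 1))" for z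
  proof -
    show ?thesis using fd_basis[OF P, of "f z" "cjacobian f z *v u"] by (simp add: matrix_vector_mult_def)
  qed
  then show ?thesis
    by (simp only:) (intro holomorphic_fun_on_sum holomorphic_fun_on_mult holomorphic_fun_on_const oS e cjacobian_entry_holomorphic[OF f])
qed

context polynomial_kernel begin

lemma hzz_0: "hzz z 0 u v = - hip u v"
  using fd_0 by (simp add: hzz_def)

lemma cnj_hz: "cnj (hz w z v) = - hip z v + (\<Sum>l<M. (-1) ^ d l * (G l z * cnj (fd (G l) w v)))"
  by (simp add: hz_def cnj_hip mult_ac)

end

context hc_domain begin

text \<open>\<open>h z z\<close> is real, equals \<open>1\<close> at the origin and has no zero on
  the connected domain.\<close>

lemma h_diag_pos: assumes "z \<in> \<Omega>" shows "0 < Re (h z z)"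
proof (rule ccontr)
  assume neg: "\<not> 0 < Re (h z z)"
  have "continuous_on \<Omega> (\<lambda>x. h x x)"
    using continuous_on_compose2[OF continuous_h[of UNIV], of \<Omega> "\<lambda>x. (x, x)"] by (simp add: continuous_on_Pair)
  then have "connected ((\<lambda>x. Re (h x x)) ` \<Omega>)"
    by (intro connected_continuous_image connected_\<Omega> continuous_on_Re)
  moreover have "Re (h z z) \<in> (\<lambda>x. Re (h x x)) ` \<Omega>" "1 \<in> (\<lambda>x. Re (h x x)) ` \<Omega>"
    using assms zero_in_\<Omega> by (auto intro: image_eqI[of _ _ 0])
  ultimately have "0 \<in> (\<lambda>x. Re (h x x)) ` \<Omega>"
    by (rule connectedD_interval) (use neg in auto)
  then obtain x where "x \<in> \<Omega>" "Re (h x x) = 0" by auto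
  then show False using h_diag h_diag_real[of x] by simp
qed

text \<open>The polarization takes place in one parameter, on the disk
  \<open>s \<mapsto> s *s \<zeta>\<close>, with the conjugate of \<open>s\<close> replaced by an
  independent \<open>t\<close>. At \<open>t = 0\<close> the second point of the kernel is the
  origin, where \<open>h\<close> is \<open>1\<close> and its derivative in the first argument is
  \<open>0\<close>.\<close>

lemma isometric_adjoint:
  fixes f :: "complex^'n \<Rightarrow> complex^'N"
  assumes f: "holomorphic_map_on f (ball 0 1)" "f ` ball 0 1 \<subseteq> \<Omega>" "f 0 = 0"
    and iso: "isometric_on f (ball 0 1) k (metric_of h_ball) (metric_of h)" and \<zeta>: "\<zeta> \<in> ball 0 1"
  shows "hip (f \<zeta>) (cjacobian f 0 *v v) = k * hip \<zeta> v"
proof -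
  define J where "J z = cjacobian f z" for z
  \<comment> \<open>Larger than \<open>1\<close>, so that \<open>s = 1\<close> is an interior point,
    with \<open>\<rho> * norm \<zeta> < 1\<close> to stay inside the ball.\<close>
  define \<rho> where "\<rho> = 2 / (1 + norm \<zeta>)"
  have n1: "0 < 1 + norm \<zeta>" by (simp add: add_pos_nonneg)
  have \<rho>: "1 < \<rho>" "\<rho> * norm \<zeta> < 1" using \<zeta> n1 by (auto simp: \<rho>_def divide_simps)
  have inb: "s *s \<zeta> \<in> ball 0 1" if "norm s < \<rho>" for s
  proof -
    have "norm (s *s \<zeta>) \<le> \<rho> * norm \<zeta>" unfolding norm_smult using that by (intro mult_right_mono) auto
    then show ?thesis using \<rho>(2) by simp
  qed
  note line = holomorphic_on_line[OF _ inb]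
  have hf: "holomorphic_fun_on (\<lambda>z. f z $ j) (ball 0 1)" for j using f(1) by (simp add: holomorphic_map_on_def)
  have hJ: "holomorphic_fun_on (\<lambda>z. (J z *v u) $ j) (ball 0 1)" for j u
    unfolding matrix_vector_mult_def J_def
    by simp (intro holomorphic_fun_on_sum holomorphic_fun_on_mult holomorphic_fun_on_const cjacobian_entry_holomorphic[OF f(1)] open_ball)
  have hG: "holomorphic_fun_on (\<lambda>z. G l (f z)) (ball 0 1)" if "l < M" for l
    by (rule holomorphic_fun_on_compose[OF f(1) subset_UNIV], rule holomorphic_fun_onI[OF open_UNIV has_derivative_fd[OF twice_holomorphic_G[OF that]]])
      (rule fd_scale[OF twice_holomorphic_G[OF that]])
  have hdG: "holomorphic_fun_on (\<lambda>z. fd (G l) (f z) (J z *v u)) (ball 0 1)" if "l < M" for l u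
    unfolding J_def by (rule holomorphic_directional_chain[OF f(1) twice_holomorphic_G[OF that]])
  define H where "H s t = h (f (s *s \<zeta>)) (f (cnj t *s \<zeta>))" for s t
  define P where "P s t = cnj (hz (f (cnj t *s \<zeta>)) (f (s *s \<zeta>)) (J (cnj t *s \<zeta>) *v v))" for s t
  define Hs where "Hs s t = hz (f (s *s \<zeta>)) (f (cnj t *s \<zeta>)) (J (s *s \<zeta>) *v \<zeta>)" for s t
  define Ps where "Ps s t = hzz (f (s *s \<zeta>)) (f (cnj t *s \<zeta>)) (J (s *s \<zeta>) *v \<zeta>) (J (cnj t *s \<zeta>) *v v)" for s t
  note jh = jointly_holomorphic jointly_holomorphic_fst[OF line] jointly_holomorphic_cnj[OF line] hf hJ hG hdG
  have H: "jointly_holomorphic \<rho> H" unfolding H_def h_eq hip_def by (intro jh) auto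
  have P: "jointly_holomorphic \<rho> P" unfolding P_def cnj_hz hip_def by (intro jh) auto
  have Hs: "jointly_holomorphic \<rho> Hs" unfolding Hs_def hz_def hip_def by (intro jh) auto
  have Ps: "jointly_holomorphic \<rho> Ps" unfolding Ps_def hzz_def hip_def by (intro jh) auto
  \<comment> \<open>The isometry equation for the directions \<open>\<zeta>\<close> and
    \<open>v\<close> with its denominators cleared, so that it is holomorphic in \<open>s\<close>
    and \<open>t\<close> wherever \<open>f\<close> is defined.\<close>
  define n where "n s t = (Ps s t * H s t - P s t * Hs s t) * (1 - s * t * hip \<zeta> \<zeta>)\<^sup>2 + k * hip \<zeta> v * (H s t)\<^sup>2" for s t
  have hn: "jointly_holomorphic \<rho> n" unfolding n_def
    by (intro jointly_holomorphic H P Hs Ps jointly_holomorphic_fst[of "\<lambda>s. s"] jointly_holomorphic_snd[of "\<lambda>s. s"] holomorphic_on_ident)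
  have diag: "n s (cnj s) = 0" if s: "norm s < \<rho>" for s
  proof -
    let ?w = "s *s \<zeta>" and ?q = "1 - s * cnj s * hip \<zeta> \<zeta>"
    have w: "?w \<in> ball 0 1" by (rule inb[OF s])
    then have f\<Omega>: "f ?w \<in> \<Omega>" using f(2) by blast
    have hw: "hip ?w ?w = s * cnj s * hip \<zeta> \<zeta>" by (simp add: hip_scale_left hip_scale_right)
    have "(norm ?w)\<^sup>2 < 1" using w by (simp add: abs_square_less_1)
    then have "complex_of_real 1 \<noteq> of_real ((norm ?w)\<^sup>2)" unfolding of_real_eq_iff by linarith
    then have q: "?q \<noteq> 0" unfolding hw[symmetric] hip_self[of ?w] of_real_1 right_minus_eq .
    have Hne: "H s (cnj s) \<noteq> 0" unfolding H_def complex_cnj_cnj by (rule h_diag[OF f\<Omega>])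
    have "metric_pairing (metric_of h (f ?w)) (J ?w *v \<zeta>) (J ?w *v v) = k * metric_pairing (metric_of h_ball ?w) \<zeta> v"
      using iso[unfolded isometric_on_def, rule_format, OF w, of \<zeta> v] by (simp only: J_def)
    moreover have "metric_pairing (metric_of h (f ?w)) (J ?w *v \<zeta>) (J ?w *v v) =
        - (Ps s (cnj s) * H s (cnj s) - Hs s (cnj s) * P s (cnj s)) / (H s (cnj s))\<^sup>2"
      unfolding H_def P_def Hs_def Ps_def complex_cnj_cnj by (rule metric_pairing_metric_of[OF open_\<Omega> f\<Omega> h_diag_pos])
    ultimately have "- (Ps s (cnj s) * H s (cnj s) - Hs s (cnj s) * P s (cnj s)) / (H s (cnj s))\<^sup>2 =
        k * ((hip \<zeta> v * ?q + hip \<zeta> ?w * hip ?w v) / ?q\<^sup>2)"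
      by (simp only: metric_pairing_h_ball[OF w] hw)
    moreover have "hip \<zeta> v * ?q + hip \<zeta> ?w * hip ?w v = hip \<zeta> v"
      by (simp add: hip_scale_left hip_scale_right algebra_simps)
    ultimately have "- (Ps s (cnj s) * H s (cnj s) - Hs s (cnj s) * P s (cnj s)) * ?q\<^sup>2 = k * hip \<zeta> v * (H s (cnj s))\<^sup>2"
      using q Hne by (simp add: frac_eq_eq)
    then show ?thesis unfolding n_def by (simp add: algebra_simps)
  qed
  have "hip (J (s *s \<zeta>) *v \<zeta>) (J 0 *v v) = k * hip \<zeta> v" if "norm s < \<rho>" for s
  proof -
    have "n s 0 = 0" by (rule polarization[OF hn diag that])
    moreover have "H s 0 = 1" "Hs s 0 = 0" "Ps s 0 = - hip (J (s *s \<zeta>) *v \<zeta>) (J 0 *v v)"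
      using f(3) by (simp_all add: H_def Hs_def Ps_def hzz_0 hz_0)
    ultimately show ?thesis by (simp add: n_def)
  qed
  note key = this
  \<comment> \<open>\<open>key\<close> says that the derivative of this function vanishes; comparing
    its values at \<open>0\<close> and \<open>1\<close> is the integration.\<close>
  let ?g = "\<lambda>s. hip (f (s *s \<zeta>)) (J 0 *v v) - s * (k * hip \<zeta> v)"
  have "(?g has_field_derivative 0) (at s within ball 0 \<rho>)" if "s \<in> ball 0 \<rho>" for s
  proof -
    have s: "norm s < \<rho>" using that by simp
    have "((\<lambda>s. s *s \<zeta>) has_derivative (\<lambda>t. t *s \<zeta>)) (at s)"
      by (rule bounded_linear_imp_has_derivative[OF bounded_linear_smult])
    from has_derivative_compose[OF this has_derivative_cjacobian[OF f(1) inb[OF s]]]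
    have "((\<lambda>s. f (s *s \<zeta>)) has_derivative (\<lambda>t. J (s *s \<zeta>) *v (t *s \<zeta>))) (at s)" by (simp add: J_def)
    from bounded_linear.has_derivative[OF bounded_linear_hip_left this]
    have "((\<lambda>s. hip (f (s *s \<zeta>)) (J 0 *v v)) has_derivative (\<lambda>t. k * hip \<zeta> v * t)) (at s)"
      by (rule has_derivative_eq_rhs) (simp add: vec.scale hip_scale_left key[OF s] fun_eq_iff)
    then have "((\<lambda>s. hip (f (s *s \<zeta>)) (J 0 *v v)) has_field_derivative k * hip \<zeta> v) (at s)"
      by (simp add: has_field_derivative_def)
    from DERIV_diff[OF this DERIV_cmult_right[OF DERIV_ident, of "k * hip \<zeta> v"]]
    have "(?g has_field_derivative 0) (at s)" by simp
    then show ?thesis by (rule has_field_derivative_at_within)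
  qed
  from has_field_derivative_zero_constant[OF convex_ball this]
  obtain c where c: "\<And>s. s \<in> ball 0 \<rho> \<Longrightarrow> ?g s = c" by blast
  have "?g 1 = ?g 0" using c[of 1] c[of 0] \<rho>(1) by simp
  then show ?thesis by (simp add: f(3) J_def)
qed

end

section \<open>The adjoint of the Jacobian and the global section\<close>

lemma hip_conj_transpose: "hip (conj_transpose A *v z) v = hip z (A *v v)"
proof -
  have "hip (conj_transpose A *v z) v = (\<Sum>j\<in>UNIV. \<Sum>i\<in>UNIV. cnj (A $ i $ j) * z $ i * cnj (v $ j))"
    by (simp add: hip_def matrix_vector_mult_def conj_transpose_def sum_distrib_right)
  also have "\<dots> = (\<Sum>i\<in>UNIV. \<Sum>j\<in>UNIV. cnj (A $ i $ j) * z $ i * cnj (v $ j))" by (rule sum.swap)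
  also have "\<dots> = hip z (A *v v)"
    by (simp add: hip_def matrix_vector_mult_def sum_distrib_left mult_ac)
  finally show ?thesis .
qed

lemma harish_chandra_realization_hc_domain:
  assumes "harish_chandra_realization \<Omega> h"
  obtains M d G c m where "hc_domain M d G h \<Omega> c m"
proof -
  from assms have bsd: "bounded_symmetric_domain \<Omega>" and circ: "circular \<Omega>"
    by (auto simp: harish_chandra_realization_def irreducible_bsd_def)
  obtain M :: nat and d G where G: "\<forall>l<M. 2 \<le> d l \<and> homogeneous_poly (d l) (G l)"
    "\<forall>z \<xi>. h z \<xi> = 1 - (\<Sum>j\<in>UNIV. z $ j * cnj (\<xi> $ j)) + (\<Sum>l<M. (-1) ^ d l * G l z * cnj (G l \<xi>))"
    using assms unfolding harish_chandra_realization_def by blast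
  obtain c :: real and m :: nat where cm: "0 < c" "1 \<le> m"
    "is_bergman_kernel \<Omega> (\<lambda>z \<xi>. complex_of_real c * h z \<xi> powi (- int m))"
    using assms unfolding harish_chandra_realization_def by blast
  have "- z \<in> \<Omega>" if "z \<in> \<Omega>" for z
  proof -
    have "(-1) *s z \<in> \<Omega>" using circ that unfolding circular_def by (metis norm_minus_cancel norm_one)
    then show ?thesis by simp
  qed
  then have "hc_domain M d G h \<Omega> c m"
    using G cm bsd circ unfolding bounded_symmetric_domain_def complex_domain_def circular_def
    by unfold_locales (auto simp: hip_def)
  then show ?thesis by (rule that)
qed

lemma holomorphic_map_linear:
  fixes p :: "complex^'a \<Rightarrow> complex^'b"
  assumes p: "bounded_linear p" "\<And>c v. p (c *s v) = c *s p v" and S: "open S"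
  shows "holomorphic_map_on p S" and "z \<in> S \<Longrightarrow> cjacobian p z *v v = p v"
proof -
  have d: "(p has_derivative p) (at z)" for z using p(1) by (rule bounded_linear_imp_has_derivative)
  have "holomorphic_fun_on (\<lambda>z. p z $ i) S" for i
    by (rule holomorphic_fun_onI[OF S bounded_linear.has_derivative[OF bounded_linear_vec_nth d]]) (simp add: p(2))
  then show h: "holomorphic_map_on p S" by (simp add: holomorphic_map_on_def)
  show "cjacobian p z *v v = p v" if "z \<in> S"
    using has_derivative_unique[OF has_derivative_cjacobian[OF h that] d] by metis
qed

context hc_domain begin

text \<open>\<open>D_dom\<close> is \<open>\<Omega>\<close> intersected with the preimage of a ball
  under the adjoint \<open>A\<close> of the Jacobian, so its shape follows from that of
  \<open>\<Omega>\<close>. Being linear, the projection is its own derivative, and the submersion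
  property is its surjectivity.\<close>

lemma section_of_isometric_embedding:
  fixes f :: "complex^'n \<Rightarrow> complex^'N"
  assumes k: "0 < k" and f: "holomorphic_map_on f (ball 0 1)" "f ` ball 0 1 \<subseteq> \<Omega>" "f 0 = 0"
    and iso: "isometric_on f (ball 0 1) k (metric_of h_ball) (metric_of h)"
  shows "hermitian_form (f_form f)"
    and "f_form f z z = complex_of_real ((norm (conj_transpose (cjacobian f 0) *v z))\<^sup>2)"
    and "complex_domain (D_dom \<Omega> f k)" "bounded (D_dom \<Omega> f k)" "balanced (D_dom \<Omega> f k)" "convex (D_dom \<Omega> f k)"
    and "f ` ball 0 1 \<subseteq> D_dom \<Omega> f k"
    and "\<exists>p :: complex^'N \<Rightarrow> complex^'n. holomorphic_submersion_on p (D_dom \<Omega> f k) \<and> p ` D_dom \<Omega> f k = ball 0 1 \<and>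
          (\<forall>w\<in>ball 0 1. p (f w) = w)"
proof -
  define A where "A z = conj_transpose (cjacobian f 0) *v z" for z
  have A_scale: "A (c *s z) = c *s A z" for c z
    unfolding A_def by (rule vec.linear_scale[OF matrix_vector_mul_linear_gen])
  have A_add: "A (x + y) = A x + A y" for x y unfolding A_def by (rule matrix_vector_right_distrib)
  have "linear A" by (rule linearI) (simp_all add: A_add A_scale scaleR_vec_complex)
  note A_linear = this
  then have A_bl: "bounded_linear A" by (simp add: linear_conv_bounded_linear)
  have Af: "A (f w) = of_real k *s w" if "w \<in> ball 0 1" for w
    unfolding A_def by (rule hip_eqI) (simp add: hip_conj_transpose isometric_adjoint[OF f iso that] hip_scale_left)
  have form: "f_form f z \<xi> = hip (A z) (A \<xi>)" for z \<xi>
  proof -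
    have "f_form f z \<xi> = hip (cjacobian f 0 *v A z) \<xi>" by (simp add: f_form_def hip_def A_def mult.commute)
    also have "\<dots> = cnj (hip (A \<xi>) (A z))" by (simp only: A_def[of \<xi>] hip_conj_transpose cnj_hip)
    finally show ?thesis by (simp only: cnj_hip)
  qed
  show "hermitian_form (f_form f)"
    unfolding hermitian_form_def form A_add A_scale hip_add_left hip_scale_left cnj_hip by simp
  show f_self: "f_form f z z = complex_of_real ((norm (conj_transpose (cjacobian f 0) *v z))\<^sup>2)" for z
    unfolding form hip_self A_def ..
  have D: "D_dom \<Omega> f k = \<Omega> \<inter> A -` ball 0 k"
    unfolding D_dom_def f_norm_def f_self A_def by auto
  show conv: "convex (D_dom \<Omega> f k)"
    unfolding D by (intro convex_Int convex_\<Omega> convex_linear_vimage A_linear convex_ball)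
  have openD: "open (D_dom \<Omega> f k)"
    unfolding D by (intro open_Int open_\<Omega> open_vimage open_ball linear_continuous_on A_bl)
  have "0 \<in> D_dom \<Omega> f k" using k zero_in_\<Omega> linear_0[OF A_linear] by (simp add: D)
  then show "complex_domain (D_dom \<Omega> f k)"
    unfolding complex_domain_def using openD convex_connected[OF conv] by blast
  show "bounded (D_dom \<Omega> f k)" unfolding D using bounded_\<Omega> by (rule bounded_Int[OF disjI1])
  show "balanced (D_dom \<Omega> f k)" unfolding balanced_def
  proof (intro ballI allI impI)
    fix z and c :: complex assume z: "z \<in> D_dom \<Omega> f k" and c: "norm c \<le> 1"
    have "norm c * norm (A z) \<le> norm (A z)" using c by (simp add: mult_left_le_one_le)
    then show "c *s z \<in> D_dom \<Omega> f k"
      using balanced_\<Omega> z c unfolding D balanced_def by (auto simp: A_scale norm_smult)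
  qed
  show img: "f ` ball 0 1 \<subseteq> D_dom \<Omega> f k"
  proof
    fix y assume "y \<in> f ` ball 0 1"
    then obtain w where w: "w \<in> ball 0 1" "y = f w" by blast
    have "norm (A y) < k" using w k unfolding w(2) Af[OF w(1)] norm_smult by (simp add: mult_less_cancel_left2)
    then show "y \<in> D_dom \<Omega> f k" using f(2) w by (auto simp: D)
  qed
  define p where "p z = of_real (1 / k) *s A z" for z
  have p_lin: "bounded_linear p" "p (c *s v) = c *s p v" for c v
    unfolding p_def using bounded_linear_compose[OF bounded_linear_smult_right A_bl]
    by (simp_all add: A_scale vector_smult_assoc mult.commute)
  have pf: "p (f w) = w" if "w \<in> ball 0 1" for w
    using k unfolding p_def Af[OF that] vector_smult_assoc of_real_mult[symmetric] by simp
  \<comment> \<open>The range of the linear map \<open>p\<close> contains the unit ball because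
    \<open>p\<close> is a left inverse of \<open>f\<close> there; scaling reaches every
    vector.\<close>
  have "surj p"
  proof (rule surjI)
    fix y :: "complex^'n"
    define r where "r = 1 + norm y"
    have r: "0 < r" by (simp add: r_def add_pos_nonneg)
    have "of_real (1 / r) *s y \<in> ball 0 1"
      using r by (simp add: norm_smult norm_divide) (simp add: r_def)
    from pf[OF this] show "p (of_real r *s f (of_real (1 / r) *s y)) = y"
      using r unfolding p_lin(2) by (simp add: vector_smult_assoc flip: of_real_mult)
  qed
  then have "holomorphic_submersion_on p (D_dom \<Omega> f k)"
    unfolding holomorphic_submersion_on_def using holomorphic_map_linear[OF p_lin openD] by simp
  moreover have "p ` D_dom \<Omega> f k = ball 0 1"
  proof
    show "p ` D_dom \<Omega> f k \<subseteq> ball 0 1" using k by (auto simp: D p_def norm_smult norm_divide)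
    show "ball 0 1 \<subseteq> p ` D_dom \<Omega> f k" using pf img by (metis image_eqI image_subset_iff subsetI)
  qed
  ultimately show "\<exists>p :: complex^'N \<Rightarrow> complex^'n. holomorphic_submersion_on p (D_dom \<Omega> f k) \<and> p ` D_dom \<Omega> f k = ball 0 1 \<and>
          (\<forall>w\<in>ball 0 1. p (f w) = w)" using pf by blast
qed

end

theorem theorem4p1:
  fixes \<Omega> :: "(complex^'N) set"
    and h :: "complex^'N \<Rightarrow> complex^'N \<Rightarrow> complex"
    and f :: "complex^'n \<Rightarrow> complex^'N"
    and k :: real
  assumes "harish_chandra_realization \<Omega> h"
    and "0 < k"
    and "holomorphic_embedding f (ball 0 1) \<Omega>"
    and "isometric_on f (ball 0 1) k (metric_of h_ball) (metric_of h)"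
    and "f 0 = 0"
  shows "hermitian_form (f_form f) \<and>
    (\<forall>z. f_form f z z = complex_of_real ((norm (conj_transpose (cjacobian f 0) *v z))\<^sup>2)) \<and>
    complex_domain (D_dom \<Omega> f k) \<and> bounded (D_dom \<Omega> f k) \<and>
    balanced (D_dom \<Omega> f k) \<and> convex (D_dom \<Omega> f k) \<and>
    f ` ball 0 1 \<subseteq> D_dom \<Omega> f k \<and>
    (\<exists>fhat :: complex^'n \<Rightarrow> complex^'N.
       holomorphic_map_on fhat (ball 0 1) \<and> fhat ` ball 0 1 \<subseteq> D_dom \<Omega> f k \<and>
       (\<forall>w\<in>ball 0 1. f w = fhat w) \<and>
       (\<exists>p :: complex^'N \<Rightarrow> complex^'n.
          holomorphic_submersion_on p (D_dom \<Omega> f k) \<and> p ` D_dom \<Omega> f k = ball 0 1 \<and>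
          (\<forall>w\<in>ball 0 1. p (fhat w) = w)))"
proof -
  obtain M d G c m where "hc_domain M d G h \<Omega> c m"
    by (rule harish_chandra_realization_hc_domain[OF assms(1)])
  then interpret hc_domain M d G h \<Omega> c m .
  have f: "holomorphic_map_on f (ball 0 1)" "f ` ball 0 1 \<subseteq> \<Omega>"
    using assms(3) by (simp_all add: holomorphic_embedding_def)
  note s = section_of_isometric_embedding[OF assms(2) f assms(5,4)]
  show ?thesis
    by (intro conjI allI s(1-7) exI[of _ f] f(1) ballI refl s(8))
qed

end
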